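(* Let $N\in\mathbb{N}$, $T>0$, let $a_2,a_{1,1},\dots,a_{1,N},a_0\in C([0,T];\mathbb{C})$ and consider $$P(t,D_x,D_t)=D_t-a_2(t)\Delta_x+\sum_{j=1}^N a_{1,j}(t)D_{x_j}+a_0(t).$$ Assume that $\operatorname{Im}(a_2)(t)<0$ for every $t\in[0,T]$. Then the Cauchy problem $Pu(t,x)=f(t,x)$, $u(0,x)=g(x)$, $t\in[0,T]$, $x\in\mathbb{T}^N$, is well-posed in $H^r$.
   Context: $\mathbb{T}^N=\mathbb{R}^N/2\pi\mathbb{Z}^N$, $D_t=\frac1i\partial_t$, $D_{x_j}=\frac1i\partial_{x_j}$, $\Delta_x=\sum_j\partial_{x_j}^2$. For a distribution $u$ on $\mathbb{T}^N$ its Fourier coefficients are $\widehat u(\xi)=\langle u,e^{-ix\xi}\rangle$, $\xi\in\mathbb{Z}^N$, normalized so that $u=\sum_\xi\widehat u(\xi)e^{ix\xi}$. For $r\in\mathbb{R}$, $H^r(\mathbb{T}^N)$ is the set of distributions with $\|u\|_{H^r}^2=\sum_{\xi}|\widehat u(\xi)|^2(1+|\xi|)^{2r}<\infty$. $C([0,T];X)$ denotes the continuous maps $[0,T]\to X$. Solutions. $u\in C([0,T];H^\rho(\mathbb{T}^N))$ (some $\rho\in\mathbb{R}$) solves the Cauchy problem if $u(0)=g$ and $Pu=f$ holds with $D_tu$ understood as the weak derivative in $t$ on $(0,T)$: $\langle D_tu,\varphi\rangle=\int_0^T u(t)(-D_t\varphi(t))\,dt$ for $\varphi\in C_c^\infty((0,T))$.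 Well-posedness. The Cauchy problem is well-posed in $H^r$ if for every $r\in\mathbb{R}$, $f\in C([0,T];H^r(\mathbb{T}^N))$ and $g\in H^r(\mathbb{T}^N)$ there is a unique solution $u\in C([0,T];H^r(\mathbb{T}^N))$. *)

theory Defs
  imports "HOL-Analysis.Analysis"
begin

text \<open>Functions on the \<open>N\<close>-dimensional torus are functions on \<open>real ^ 'n\<close>, \<open>N = CARD('n)\<close>, that are
  \<open>2\<pi>\<close>-periodic in every coordinate.\<close>

definition pderiv_at :: "'n \<Rightarrow> (real ^ 'n \<Rightarrow> complex) \<Rightarrow> real ^ 'n \<Rightarrow> complex" where
  "pderiv_at j f x = frechet_derivative f (at x) (axis j 1)"

text \<open>A list \<open>js\<close> of coordinates stands for the iterated partial derivative
  \<open>\<partial>\<^sub>j\<^sub>1 \<dots> \<partial>\<^sub>j\<^sub>k\<close>.\<close>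

definition smooth_fun :: "(real ^ 'n \<Rightarrow> complex) \<Rightarrow> bool" where
  "smooth_fun f \<longleftrightarrow> (\<forall>js x. foldr pderiv_at js f differentiable (at x))"

definition torus_periodic :: "(real ^ 'n \<Rightarrow> complex) \<Rightarrow> bool" where
  "torus_periodic f \<longleftrightarrow> (\<forall>j x. f (x + (2 * pi) *\<^sub>R axis j 1) = f x)"

lemma foldr_pderiv_at_const:
  "\<exists>d. foldr pderiv_at js (\<lambda>x::real ^ 'n. c) = (\<lambda>x. d)"
proof (induction js)
  case (Cons j js)
  then obtain d where d: "foldr pderiv_at js (\<lambda>x::real ^ 'n. c) = (\<lambda>x. d)"
    by blast
  have "pderiv_at j (\<lambda>x::real ^ 'n. d) = (\<lambda>x. 0)"
    by (simp add: pderiv_at_def fun_eq_iff)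
  with d show ?case by auto
qed auto

typedef (overloaded) 'n torus_test =
  "{f :: real ^ 'n \<Rightarrow> complex. smooth_fun f \<and> torus_periodic f}"
proof
  have "foldr pderiv_at js (\<lambda>x::real ^ 'n. 0) differentiable (at x)" for js x
    using foldr_pderiv_at_const[of js 0] by auto
  then show "(\<lambda>x. 0) \<in> {f :: real ^ 'n \<Rightarrow> complex. smooth_fun f \<and> torus_periodic f}"
    by (simp add: smooth_fun_def torus_periodic_def)
qed

setup_lifting type_definition_torus_test

lemma pderiv_at_add:
  assumes "f differentiable (at x)" "g differentiable (at x)"
  shows "pderiv_at j (\<lambda>x. f x + g x) x = pderiv_at j f x + pderiv_at j g x"
proof -
  have "((\<lambda>x. f x + g x) has_derivative
      (\<lambda>h. frechet_derivative f (at x) h + frechet_derivative g (at x) h)) (at x)"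
    using assms by (intro has_derivative_add) (simp_all add: frechet_derivative_works)
  from frechet_derivative_at[OF this, symmetric] show ?thesis
    by (simp add: pderiv_at_def)
qed

lemma pderiv_at_scale:
  assumes "f differentiable (at x)"
  shows "pderiv_at j (\<lambda>x. c * f x) x = c * pderiv_at j f x"
proof -
  have "((\<lambda>x. c * f x) has_derivative (\<lambda>h. c * frechet_derivative f (at x) h)) (at x)"
    using assms by (intro has_derivative_mult_right) (simp add: frechet_derivative_works)
  from frechet_derivative_at[OF this, symmetric] show ?thesis
    by (simp add: pderiv_at_def)
qed

lemma foldr_pderiv_at_add:
  assumes "smooth_fun f" "smooth_fun g"
  shows "foldr pderiv_at js (\<lambda>x. f x + g x)
    = (\<lambda>x. foldr pderiv_at js f x + foldr pderiv_at js g x)"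
  using assms
proof (induction js)
  case (Cons j js)
  then have "foldr pderiv_at (j # js) (\<lambda>x. f x + g x)
      = pderiv_at j (\<lambda>x. foldr pderiv_at js f x + foldr pderiv_at js g x)"
    by simp
  with Cons.prems show ?case
    by (simp add: fun_eq_iff smooth_fun_def pderiv_at_add)
qed simp

lemma foldr_pderiv_at_scale:
  assumes "smooth_fun f"
  shows "foldr pderiv_at js (\<lambda>x. c * f x) = (\<lambda>x. c * foldr pderiv_at js f x)"
  using assms
proof (induction js)
  case (Cons j js)
  then have "foldr pderiv_at (j # js) (\<lambda>x. c * f x)
      = pderiv_at j (\<lambda>x. c * foldr pderiv_at js f x)"
    by simp
  with Cons.prems show ?case
    by (simp add: fun_eq_iff smooth_fun_def pderiv_at_scale)
qed simp

lemma smooth_fun_add: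
  assumes "smooth_fun f" "smooth_fun g"
  shows "smooth_fun (\<lambda>x. f x + g x)"
  using assms unfolding smooth_fun_def foldr_pderiv_at_add[OF assms]
  by (auto intro: differentiable_add)

lemma smooth_fun_scale:
  assumes "smooth_fun f"
  shows "smooth_fun (\<lambda>x. c * f x)"
  using assms unfolding smooth_fun_def foldr_pderiv_at_scale[OF assms]
  by (auto intro: differentiable_mult)

lemma smooth_fun_pderiv_at:
  assumes "smooth_fun f"
  shows "smooth_fun (pderiv_at j f)"
  unfolding smooth_fun_def
proof (intro allI)
  fix js x
  have "foldr pderiv_at (js @ [j]) f differentiable (at x)"
    using assms unfolding smooth_fun_def by blast
  then show "foldr pderiv_at js (pderiv_at j f) differentiable (at x)" by simp
qed

lemma torus_periodic_pderiv_at: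
  assumes "smooth_fun f" "torus_periodic f"
  shows "torus_periodic (pderiv_at j f)"
  unfolding torus_periodic_def
proof (intro allI)
  fix k x
  let ?h = "(2 * pi) *\<^sub>R axis k 1 :: real ^ 'a"
  have "f differentiable (at (x + ?h))"
    using assms(1) foldr.simps(1) unfolding smooth_fun_def by (metis id_apply)
  then have D: "(f has_derivative frechet_derivative f (at (x + ?h))) (at (x + ?h))"
    by (simp add: frechet_derivative_works)
  have "((\<lambda>y. y + ?h) has_derivative (\<lambda>y. y)) (at x)"
    by (auto intro!: derivative_eq_intros)
  from has_derivative_compose[OF this D]
  have "((\<lambda>y. f (y + ?h)) has_derivative frechet_derivative f (at (x + ?h))) (at x)" .
  moreover have "(\<lambda>y. f (y + ?h)) = f"
    using assms(2) by (auto simp: torus_periodic_def)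
  ultimately have "frechet_derivative f (at (x + ?h)) = frechet_derivative f (at x)"
    by (simp add: frechet_derivative_at)
  then show "pderiv_at j f (x + ?h) = pderiv_at j f x"
    by (simp add: pderiv_at_def)
qed

lift_definition test_add :: "('n::finite) torus_test \<Rightarrow> 'n torus_test \<Rightarrow> 'n torus_test"
  is "\<lambda>f g x. f x + g x"
  by (auto simp: smooth_fun_add torus_periodic_def)

lift_definition test_scale :: "complex \<Rightarrow> ('n::finite) torus_test \<Rightarrow> 'n torus_test"
  is "\<lambda>c f x. c * f x"
  by (auto simp: smooth_fun_scale torus_periodic_def)

lift_definition test_pderiv :: "'n::finite \<Rightarrow> 'n torus_test \<Rightarrow> 'n torus_test"
  is pderiv_at
  by (auto simp: smooth_fun_pderiv_at torus_periodic_pderiv_at)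

definition freq :: "int ^ 'n \<Rightarrow> real ^ 'n" where
  "freq \<xi> = (\<chi> j. of_int (\<xi> $ j))"

lemma has_derivative_wave:
  "((\<lambda>x. c * exp (\<i> * complex_of_real (x \<bullet> w))) has_derivative
    (\<lambda>h. c * (exp (\<i> * complex_of_real (x \<bullet> w)) * (\<i> * complex_of_real (h \<bullet> w))))) (at x)"
  for w :: "real ^ 'n"
proof -
  have "((\<lambda>x. \<i> * complex_of_real (x \<bullet> w)) has_derivative
      (\<lambda>h. \<i> * complex_of_real (h \<bullet> w))) (at x)"
    by (auto intro!: derivative_eq_intros)
  moreover have "(exp has_derivative (\<lambda>h. exp z * h)) (at z)" for z :: complex
    using DERIV_exp[of z] by (simp add: has_field_derivative_def)
  ultimately have "((\<lambda>x. exp (\<i> * complex_of_real (x \<bullet> w))) has_derivative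
      (\<lambda>h. exp (\<i> * complex_of_real (x \<bullet> w)) * (\<i> * complex_of_real (h \<bullet> w)))) (at x)"
    by (rule has_derivative_compose)
  then show ?thesis
    by (rule has_derivative_mult_right)
qed

lemma pderiv_at_wave:
  "pderiv_at j (\<lambda>x. c * exp (\<i> * complex_of_real (x \<bullet> w)))
    = (\<lambda>x. (\<i> * complex_of_real (w $ j) * c) * exp (\<i> * complex_of_real (x \<bullet> w)))"
  by (auto simp: pderiv_at_def fun_eq_iff frechet_derivative_at[OF has_derivative_wave, symmetric]
      inner_axis' algebra_simps)

lemma smooth_fun_wave: "smooth_fun (\<lambda>x. c * exp (\<i> * complex_of_real (x \<bullet> w)))"
proof -
  have "\<exists>d. foldr pderiv_at js (\<lambda>x. c * exp (\<i> * complex_of_real (x \<bullet> w)))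
    = (\<lambda>x. d * exp (\<i> * complex_of_real (x \<bullet> w)))" for js
    by (induction js) (auto simp: pderiv_at_wave)
  then show ?thesis
    unfolding smooth_fun_def by (metis has_derivative_wave differentiable_def)
qed

lemma torus_periodic_wave: "torus_periodic (\<lambda>x. exp (\<i> * complex_of_real (x \<bullet> freq \<xi>)))"
proof -
  have "exp (\<i> * complex_of_real ((x + (2 * pi) *\<^sub>R axis j 1) \<bullet> freq \<xi>))
    = exp (\<i> * complex_of_real (x \<bullet> freq \<xi>))" for j x
  proof -
    have "\<i> * complex_of_real ((x + (2 * pi) *\<^sub>R axis j 1) \<bullet> freq \<xi>)
      = \<i> * complex_of_real (x \<bullet> freq \<xi>) + complex_of_int (2 * (\<xi> $ j)) * (complex_of_real pi * \<i>)"
      by (simp add: inner_add_left inner_axis' freq_def algebra_simps)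
    then show ?thesis
      by (auto simp: exp_eq)
  qed
  then show ?thesis by (simp add: torus_periodic_def)
qed

lift_definition wave :: "int ^ ('n::finite) \<Rightarrow> 'n torus_test"
  is "\<lambda>\<xi> x. exp (\<i> * complex_of_real (x \<bullet> freq \<xi>))"
  using smooth_fun_wave[where c = 1] torus_periodic_wave by auto

definition test_seminorm :: "nat \<Rightarrow> ('n::finite) torus_test \<Rightarrow> real" where
  "test_seminorm m \<psi> =
    (\<Sum>js | length js \<le> m. SUP x. norm (Rep_torus_test (foldr test_pderiv js \<psi>) x))"

type_synonym 'n torus_functional = "'n torus_test \<Rightarrow> complex"

text \<open>Continuity with respect to the Frechet topology generated by the increasing family
  \<open>test_seminorm\<close>.\<close>

definition distributions :: "('n::finite) torus_functional set" where
  "distributions = {u.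
     (\<forall>\<phi> \<psi>. u (test_add \<phi> \<psi>) = u \<phi> + u \<psi>) \<and>
     (\<forall>c \<psi>. u (test_scale c \<psi>) = c * u \<psi>) \<and>
     (\<exists>m C. \<forall>\<psi>. norm (u \<psi>) \<le> C * test_seminorm m \<psi>)}"

definition dist_Dx :: "'n::finite \<Rightarrow> 'n torus_functional \<Rightarrow> 'n torus_functional" where
  "dist_Dx j u = (\<lambda>\<psi>. - ((1 / \<i>) * u (test_pderiv j \<psi>)))"

definition dist_Laplacian :: "('n::finite) torus_functional \<Rightarrow> 'n torus_functional" where
  "dist_Laplacian u = (\<lambda>\<psi>. \<Sum>j\<in>UNIV. u (test_pderiv j (test_pderiv j \<psi>)))"

text \<open>The pairing of a function with a test function is normalised by the total mass
  \<open>(2\<pi>)\<^sup>N\<close> of the torus, so that the distribution \<open>e\<^sup>i\<^sup>x\<^sup>\<eta>\<close> has Fourier coefficients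
  \<open>1\<close> at \<open>\<eta>\<close> and \<open>0\<close> elsewhere.\<close>

definition fourier_coeff :: "('n::finite) torus_functional \<Rightarrow> int ^ 'n \<Rightarrow> complex" where
  "fourier_coeff u \<xi> = u (wave (- \<xi>))"

definition sobolev_term :: "real \<Rightarrow> ('n::finite) torus_functional \<Rightarrow> int ^ 'n \<Rightarrow> real" where
  "sobolev_term r u \<xi> = (norm (fourier_coeff u \<xi>))\<^sup>2 * (1 + norm (freq \<xi>)) powr (2 * r)"

definition sobolev :: "real \<Rightarrow> ('n::finite) torus_functional set" where
  "sobolev r = {u \<in> distributions. sobolev_term r u summable_on UNIV}"

definition sobolev_norm :: "real \<Rightarrow> ('n::finite) torus_functional \<Rightarrow> real" where
  "sobolev_norm r u = sqrt (\<Sum>\<^sub>\<infinity>\<xi>. sobolev_term r u \<xi>)"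

text \<open>\<open>C([0,T]; H\<^sup>r)\<close>; values outside \<open>[0,T]\<close> are irrelevant.\<close>

definition C_sobolev :: "real \<Rightarrow> real \<Rightarrow> (real \<Rightarrow> ('n::finite) torus_functional) set" where
  "C_sobolev T r = {u.
     (\<forall>t\<in>{0..T}. u t \<in> sobolev r) \<and>
     (\<forall>t\<in>{0..T}. ((\<lambda>s. sobolev_norm r (\<lambda>\<psi>. u s \<psi> - u t \<psi>)) \<longlongrightarrow> 0) (at t within {0..T}))}"

definition time_test :: "real \<Rightarrow> (real \<Rightarrow> complex) set" where
  "time_test T = {\<phi>.
     (\<forall>k t. ((\<lambda>h s. vector_derivative h (at s)) ^^ k) \<phi> differentiable (at t)) \<and>
     compact (closure {t. \<phi> t \<noteq> 0}) \<and> closure {t. \<phi> t \<noteq> 0} \<subseteq> {0<..<T}}"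

text \<open>The integral of a distribution-valued function is taken in the weak sense,
  \<open>\<langle>\<integral>F(t)dt, \<psi>\<rangle> = \<integral>\<langle>F(t), \<psi>\<rangle>dt\<close>; for \<open>F \<in> C([0,T]; H\<^sup>s)\<close> this is the
  \<open>H\<^sup>s\<close>-valued integral.\<close>

definition dist_integral :: "real \<Rightarrow> (real \<Rightarrow> ('n::finite) torus_functional) \<Rightarrow> 'n torus_functional" where
  "dist_integral T F = (\<lambda>\<psi>. integral {0..T} (\<lambda>t. F t \<psi>))"

text \<open>A function \<open>v\<close> of \<open>t\<close> with values in the distributions on the torus is identified with the
  vector-valued distribution \<open>\<phi> \<mapsto> \<integral> v(t) \<phi>(t) dt\<close> on \<open>(0,T)\<close>.\<close>

definition regular_distr ::
    "real \<Rightarrow> (real \<Rightarrow> ('n::finite) torus_functional) \<Rightarrow> (real \<Rightarrow> complex) \<Rightarrow> 'n torus_functional" where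
  "regular_distr T v \<phi> = dist_integral T (\<lambda>t \<psi>. v t \<psi> * \<phi> t)"

definition weak_Dt ::
    "real \<Rightarrow> (real \<Rightarrow> ('n::finite) torus_functional) \<Rightarrow> (real \<Rightarrow> complex) \<Rightarrow> 'n torus_functional" where
  "weak_Dt T u \<phi> =
    dist_integral T (\<lambda>t \<psi>. u t \<psi> * (- ((1 / \<i>) * vector_derivative \<phi> (at t))))"

definition evolution_op ::
    "real \<Rightarrow> (real \<Rightarrow> complex) \<Rightarrow> ('n::finite \<Rightarrow> real \<Rightarrow> complex) \<Rightarrow> (real \<Rightarrow> complex) \<Rightarrow>
      (real \<Rightarrow> 'n torus_functional) \<Rightarrow> (real \<Rightarrow> complex) \<Rightarrow> 'n torus_functional" where
  "evolution_op T a2 a1 a0 u \<phi> = (\<lambda>\<psi>. weak_Dt T u \<phi> \<psi> +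
     regular_distr T (\<lambda>t \<psi>. - (a2 t * dist_Laplacian (u t) \<psi>)
        + (\<Sum>j\<in>UNIV. a1 j t * dist_Dx j (u t) \<psi>) + a0 t * u t \<psi>) \<phi> \<psi>)"

definition solves_cauchy ::
    "real \<Rightarrow> (real \<Rightarrow> complex) \<Rightarrow> ('n::finite \<Rightarrow> real \<Rightarrow> complex) \<Rightarrow> (real \<Rightarrow> complex) \<Rightarrow>
      (real \<Rightarrow> 'n torus_functional) \<Rightarrow> 'n torus_functional \<Rightarrow>
      (real \<Rightarrow> 'n torus_functional) \<Rightarrow> bool" where
  "solves_cauchy T a2 a1 a0 f g u \<longleftrightarrow>
     (\<exists>\<rho>. u \<in> C_sobolev T \<rho>) \<and> u 0 = g \<and>
     (\<forall>\<phi>\<in>time_test T. evolution_op T a2 a1 a0 u \<phi> = regular_distr T f \<phi>)"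

definition well_posed_sobolev ::
    "real \<Rightarrow> (real \<Rightarrow> complex) \<Rightarrow> ('n::finite \<Rightarrow> real \<Rightarrow> complex) \<Rightarrow> (real \<Rightarrow> complex) \<Rightarrow> bool" where
  "well_posed_sobolev T a2 a1 a0 \<longleftrightarrow>
     (\<forall>r. \<forall>f\<in>C_sobolev T r. \<forall>g\<in>sobolev r.
        \<exists>u\<in>C_sobolev T r. solves_cauchy T a2 a1 a0 f g u \<and>
          (\<forall>v\<in>C_sobolev T r. solves_cauchy T a2 a1 a0 f g v \<longrightarrow> (\<forall>t\<in>{0..T}. v t = u t)))"

end

theory Submission
  imports Defs
begin

text \<open>On the Fourier side the equation decouples into \<open>y' = - \<i> p\<^sub>\<xi>(t) y + \<i> f(t)\<close> with
  \<open>p\<^sub>\<xi> = a\<^sub>2 |\<xi>|\<^sup>2 + a\<^sub>1 \<cdot> \<xi> + a\<^sub>0\<close>. Since \<open>Im a\<^sub>2 < 0\<close>, \<open>Im p\<^sub>\<xi>\<close> is bounded above uniformly in \<open>\<xi>\<close>,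
  so the propagators are bounded uniformly in \<open>\<xi>\<close> and the variation-of-constants solutions
  stay in \<open>H\<^sup>r\<close>, with a dominating summable sequence that gives continuity in time. Both sides of
  the equation, tested in time, are distributions on the torus, hence it suffices to compare
  them on exponentials; this uses that a distribution is determined by its Fourier coefficients
  (rapid decay of the coefficients of test functions, and Stone-Weierstrass on the product of
  circles). Uniqueness is du Bois-Reymond's lemma for each coefficient.\<close>

section \<open>Integration over a period box\<close>

text \<open>The first obstacle is uniformity in \<open>\<xi>\<close>. The factor
  \<open>exp (\<i> * integral {0..s} p)\<close> of Duhamel's formula may by itself grow like
  \<open>exp (c |\<xi>|^2)\<close>; only the combined kernel from \<open>s\<close> to
  \<open>t\<close> is controlled, because its modulus is the exponential of the integral of
  \<open>Im p\<close> over \<open>{s..t}\<close>, and this works for \<open>s \<le> t\<close> only.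
  The second obstacle is a majorant independent of time. Continuity into \<open>H^r\<close> does not
  make the supremum over \<open>t\<close> of the weighted squared coefficients of \<open>f\<close>
  summable in \<open>\<xi>\<close>. Their time integral is summable, because finite partial sums
  commute with the integral, and Cauchy-Schwarz in time turns Duhamel's integral into that quantity.
  Thirdly, the equation is an equality of functionals that are bounded by seminorms with
  derivatives, so Fourier series of test functions must converge uniformly together with each
  derivative.\<close>

lemma continuous_on_smooth_fun:
  assumes "smooth_fun f"
  shows "continuous_on S f"
proof -
  have "foldr pderiv_at [] f differentiable (at x)" for x
    using assms unfolding smooth_fun_def by blast
  then show ?thesis
    by (simp add: differentiable_imp_continuous_on differentiable_on_def
        differentiable_at_withinI)
qed

lemma continuous_on_Rep_test [continuous_intros]:
  assumes "continuous_on S g"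
  shows "continuous_on S (\<lambda>x. Rep_torus_test \<psi> (g x))"
  using Rep_torus_test[of \<psi>] continuous_on_smooth_fun
  by (intro continuous_on_compose2[OF _ assms, of UNIV]) auto

text \<open>One side is left free so that cutting and translating along a single coordinate stays
  within one family of boxes.\<close>

definition slab :: "'n::finite \<Rightarrow> real \<Rightarrow> real \<Rightarrow> (real ^ 'n) set" where
  "slab j l u = cbox (\<chi> i. if i = j then l else 0) (\<chi> i. if i = j then u else 2 * pi)"

definition period_box :: "(real ^ 'n::finite) set" where
  "period_box = cbox 0 (\<chi> i. 2 * pi)"

lemma slab_period: "slab j 0 (2 * pi) = period_box"
  unfolding slab_def period_box_def
  by (rule arg_cong2[where f = cbox]) (auto simp: vec_eq_iff)

lemma integral_slab_combine:
  fixes f :: "real ^ 'n::finite \<Rightarrow> complex"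
  assumes "continuous_on UNIV f" "l \<le> m" "m \<le> u"
  shows "integral (slab j l u) f = integral (slab j l m) f + integral (slab j m u) f"
proof -
  have int: "(f has_integral integral (slab j a b) f) (slab j a b)" for a b
    unfolding slab_def
    by (intro integrable_integral integrable_continuous continuous_on_subset[OF assms(1)]) auto
  have "slab j l u \<inter> {x. x \<bullet> axis j 1 \<le> m} = slab j l m"
       "slab j l u \<inter> {x. x \<bullet> axis j 1 \<ge> m} = slab j m u"
    using assms(2,3) by (fastforce simp: slab_def mem_box_cart inner_axis split: if_splits)+
  then have "(f has_integral integral (slab j l m) f + integral (slab j m u) f) (slab j l u)"
    using int has_integral_split[of f _ "\<chi> i. if i = j then l else 0" "\<chi> i. if i = j then u else 2 * pi"
        "axis j 1" m]
    unfolding slab_def by (auto simp: axis_in_Basis_iff)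
  then show ?thesis by (rule integral_unique)
qed

lemma integral_slab_shift:
  fixes f :: "real ^ 'n::finite \<Rightarrow> complex"
  shows "integral (slab j (l + s) (u + s)) f = integral (slab j l u) (\<lambda>x. f (x + s *\<^sub>R axis j 1))"
proof -
  have "(\<chi> i. if i = j then a + s else b) = (\<chi> i. if i = j then a else b) + s *\<^sub>R axis j 1"
    for a :: real and b by (auto simp: vec_eq_iff axis_def)
  then show ?thesis
    using integral_shift_cbox_plus[of "\<chi> i. if i = j then l else 0" "\<chi> i. if i = j then u else 2 * pi"
        f "s *\<^sub>R axis j 1"]
    by (simp add: slab_def o_def add.commute[of "s *\<^sub>R axis j 1"])
qed

text \<open>The slab from \<open>0\<close> to \<open>2 * pi + h\<close> is cut once at
  \<open>2 * pi\<close> and once at \<open>h\<close>. By periodicity the piece beyond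
  \<open>2 * pi\<close> has the same integral as the piece below \<open>h\<close>, so the remaining
  pieces agree.\<close>

lemma integral_period_box_shift:
  fixes f :: "real ^ 'n::finite \<Rightarrow> complex"
  assumes f: "continuous_on UNIV f" "torus_periodic f" and "0 \<le> h" "h \<le> 2 * pi"
  shows "integral period_box (\<lambda>x. f (x + h *\<^sub>R axis j 1)) = integral period_box f"
proof -
  have "integral (slab j 0 (2 * pi + h)) f
      = integral (slab j 0 (2 * pi)) f + integral (slab j (2 * pi) (2 * pi + h)) f"
    by (rule integral_slab_combine) (use assms in auto)
  moreover have "integral (slab j 0 (2 * pi + h)) f
      = integral (slab j 0 h) f + integral (slab j h (2 * pi + h)) f"
    by (rule integral_slab_combine) (use assms in auto)
  moreover have "integral (slab j (2 * pi) (2 * pi + h)) f = integral (slab j 0 h) f"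
    using integral_slab_shift[of j 0 "2 * pi" h f] f(2)
    by (simp add: add.commute torus_periodic_def)
  moreover have "integral (slab j h (2 * pi + h)) f
      = integral (slab j 0 (2 * pi)) (\<lambda>x. f (x + h *\<^sub>R axis j 1))"
    using integral_slab_shift[of j 0 h "2 * pi" f] by simp
  ultimately show ?thesis by (simp add: slab_period)
qed

text \<open>The integral of the translate of \<open>f\<close> by \<open>h\<close> along coordinate
  \<open>j\<close> is constant in \<open>h\<close>; differentiating under the integral sign at
  \<open>h = 0\<close> gives the claim without iterated integrals. The derivative is one-sided
  because translation invariance is available for \<open>0 \<le> h\<close> only.\<close>

lemma integral_pderiv_zero:
  fixes f :: "real ^ 'n::finite \<Rightarrow> complex"
  assumes d: "\<And>x. f differentiable (at x)" and p: "torus_periodic f"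
    and c: "continuous_on UNIV (pderiv_at j f)"
  shows "integral period_box (pderiv_at j f) = 0"
proof -
  define e where "e = (axis j 1 :: real ^ 'n)"
  have cf: "continuous_on UNIV f"
    using d by (simp add: continuous_on_eq_continuous_at differentiable_imp_continuous_within)
  have D: "((\<lambda>h. f (x + h *\<^sub>R e)) has_vector_derivative pderiv_at j f (x + h *\<^sub>R e)) (at h within U)"
    for x h U
  proof -
    have "(f has_derivative frechet_derivative f (at (x + h *\<^sub>R e))) (at (x + h *\<^sub>R e))"
      using d by (simp add: frechet_derivative_works)
    moreover have "((\<lambda>h. x + h *\<^sub>R e) has_derivative (\<lambda>k. k *\<^sub>R e)) (at h within U)"
      by (auto intro!: derivative_eq_intros)
    ultimately have "((\<lambda>h. f (x + h *\<^sub>R e)) has_derivative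
        (\<lambda>k. frechet_derivative f (at (x + h *\<^sub>R e)) (k *\<^sub>R e))) (at h within U)"
      using has_derivative_compose by blast
    moreover have "linear (frechet_derivative f (at (x + h *\<^sub>R e)))"
      using d linear_frechet_derivative by blast
    ultimately show ?thesis
      by (simp add: has_vector_derivative_def pderiv_at_def e_def linear_scale)
  qed
  let ?G = "\<lambda>h. integral period_box (\<lambda>x. f (x + h *\<^sub>R e))"
  have "(?G has_vector_derivative integral period_box (\<lambda>x. pderiv_at j f (x + 0 *\<^sub>R e)))
      (at 0 within {0..2 * pi})"
    unfolding period_box_def
  proof (rule leibniz_rule_vector_derivative)
    show "((\<lambda>h. f (x + h *\<^sub>R e)) has_vector_derivative pderiv_at j f (x + h *\<^sub>R e))
        (at h within {0..2 * pi})" for h x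
      by (rule D)
    show "(\<lambda>x. f (x + h *\<^sub>R e)) integrable_on cbox 0 (\<chi> i. 2 * pi)" for h
      by (intro integrable_continuous continuous_on_compose2[OF cf] continuous_intros) auto
    show "continuous_on ({0..2 * pi} \<times> cbox 0 (\<chi> i. 2 * pi))
        (\<lambda>(h, x). pderiv_at j f (x + h *\<^sub>R e))"
      unfolding split_beta
      by (intro continuous_on_compose2[OF c] continuous_intros) auto
  qed auto
  then have G: "(?G has_vector_derivative integral period_box (pderiv_at j f)) (at 0 within {0..2 * pi})"
    by simp
  have G': "(?G has_vector_derivative 0) (at 0 within {0..2 * pi})"
    by (rule has_vector_derivative_transform[OF _ _ has_vector_derivative_const[of "integral period_box f"]])
      (auto simp: e_def integral_period_box_shift[OF cf p])
  show ?thesis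
    by (rule vector_derivative_unique_within[OF _ G G'])
      (simp add: at_within_Icc_at_right)
qed

section \<open>Fourier coefficients of functions\<close>

definition fcoef :: "(real ^ 'n::finite \<Rightarrow> complex) \<Rightarrow> int ^ 'n \<Rightarrow> complex" where
  "fcoef f \<xi> = integral period_box (\<lambda>x. f x * exp (- (\<i> * complex_of_real (x \<bullet> freq \<xi>))))
     / (2 * pi) ^ CARD('n)"

lemma content_period_box: "measure lborel (period_box :: (real ^ 'n::finite) set) = (2 * pi) ^ CARD('n)"
proof -
  have "measure lborel (cbox 0 (\<chi> i. 2 * pi) :: (real ^ 'n) set) = (2 * pi) ^ CARD('n)"
    by (subst content_cbox_cart) (auto simp: interval_eq_empty_cart not_less)
  then show ?thesis by (simp add: period_box_def)
qed

lemma integrable_period_box: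
  fixes f :: "real ^ 'n::finite \<Rightarrow> 'b::banach"
  shows "continuous_on UNIV f \<Longrightarrow> f integrable_on period_box"
  unfolding period_box_def
  by (intro integrable_continuous) (auto elim: continuous_on_subset)

lemma norm_fcoef_le:
  fixes f :: "real ^ 'n::finite \<Rightarrow> complex"
  assumes "continuous_on UNIV f" "\<And>x. norm (f x) \<le> B"
  shows "norm (fcoef f \<xi>) \<le> B"
proof -
  have "norm (integral period_box (\<lambda>x. f x * exp (- (\<i> * complex_of_real (x \<bullet> freq \<xi>)))))
     \<le> integral period_box (\<lambda>x::real^'n. B)"
  proof (rule integral_norm_bound_integral)
    show "(\<lambda>x. f x * exp (- (\<i> * complex_of_real (x \<bullet> freq \<xi>)))) integrable_on period_box"
      by (intro integrable_period_box continuous_intros assms)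
    show "(\<lambda>x::real^'n. B) integrable_on period_box"
      by (intro integrable_period_box continuous_intros)
  qed (use assms in \<open>simp add: norm_mult\<close>)
  also have "\<dots> = B * (2 * pi) ^ CARD('n)"
    using content_period_box[where 'n='n] by (simp add: period_box_def)
  finally show ?thesis
    by (simp add: fcoef_def norm_divide norm_power norm_mult power_mult_distrib field_simps)
qed

lemma fcoef_add:
  assumes "continuous_on UNIV f" "continuous_on UNIV g"
  shows "fcoef (\<lambda>x. f x + g x) \<xi> = fcoef f \<xi> + fcoef g \<xi>"
  unfolding fcoef_def distrib_right add_divide_distrib[symmetric]
  by (subst integral_add) (auto intro!: integrable_period_box continuous_intros assms)

lemma fcoef_scale: "fcoef (\<lambda>x. c * f x) \<xi> = c * fcoef f \<xi>"
  by (simp add: fcoef_def mult.assoc)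

text \<open>Integration by parts: the derivative of the periodic product of \<open>f\<close> with
  the exponential has integral zero, and the product rule splits it into the two sides.\<close>

lemma fcoef_pderiv:
  fixes f :: "real ^ 'n::finite \<Rightarrow> complex"
  assumes "smooth_fun f" "torus_periodic f"
  shows "fcoef (pderiv_at j f) \<xi> = \<i> * of_int (\<xi> $ j) * fcoef f \<xi>"
proof -
  let ?w = "freq (- \<xi>)"
  have freq: "freq (- \<xi>) = - freq \<xi>" by (simp add: freq_def vec_eq_iff)
  let ?E = "\<lambda>x::real^'n. exp (\<i> * complex_of_real (x \<bullet> ?w))"
  let ?g = "\<lambda>x. f x * ?E x"
  have df: "f differentiable (at x)" for x
  proof -
    have "foldr pderiv_at [] f differentiable (at x)"
      using assms(1) unfolding smooth_fun_def by blast
    then show ?thesis by simp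
  qed
  have D: "(?g has_derivative (\<lambda>h. f x * (?E x * (\<i> * complex_of_real (h \<bullet> ?w)))
      + frechet_derivative f (at x) h * ?E x)) (at x)" for x
    by (intro has_derivative_mult has_derivative_wave[where c = 1, simplified])
      (use df in \<open>simp add: frechet_derivative_works\<close>)
  have P: "pderiv_at j ?g = (\<lambda>x. - (\<i> * of_int (\<xi> $ j)) * ?g x + pderiv_at j f x * ?E x)"
    unfolding pderiv_at_def frechet_derivative_at[OF D, symmetric]
    by (auto simp: fun_eq_iff inner_axis' freq_def algebra_simps)
  note cont = continuous_on_smooth_fun[OF assms(1)]
    continuous_on_smooth_fun[OF smooth_fun_pderiv_at[OF assms(1)]]
  have "integral period_box (pderiv_at j ?g) = 0"
  proof (rule integral_pderiv_zero)
    show "?g differentiable (at x)" for x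
      using D differentiable_def by blast
    show "torus_periodic ?g"
      using assms(2) torus_periodic_wave[of "- \<xi>"] by (simp add: torus_periodic_def)
    show "continuous_on UNIV (pderiv_at j ?g)"
      unfolding P by (intro continuous_intros cont)
  qed
  then have "integral period_box (\<lambda>x. pderiv_at j f x * ?E x)
      = \<i> * of_int (\<xi> $ j) * integral period_box ?g"
    unfolding P
    by (subst (asm) integral_add)
      (auto intro!: integrable_period_box continuous_intros cont)
  then show ?thesis by (simp add: fcoef_def freq)
qed

lemma freq_simps [simp]:
  "freq 0 = 0" "freq (\<xi> + \<eta>) = freq \<xi> + freq \<eta>" "freq (- \<xi>) = - freq \<xi>"
  "freq (\<xi> - \<eta>) = freq \<xi> - freq \<eta>" "freq (axis j 1) = axis j 1" "freq \<xi> $ j = of_int (\<xi> $ j)"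
  by (auto simp: freq_def vec_eq_iff axis_def)

lemma fcoef_mult_wave:
  "fcoef (\<lambda>x. f x * exp (\<i> * complex_of_real (x \<bullet> freq \<eta>))) \<xi> = fcoef f (\<xi> - \<eta>)"
proof -
  have "exp (\<i> * complex_of_real (x \<bullet> freq \<eta>)) * exp (- (\<i> * complex_of_real (x \<bullet> freq \<xi>)))
      = exp (- (\<i> * complex_of_real (x \<bullet> freq (\<xi> - \<eta>))))" for x :: "real ^ 'a"
    by (simp only: mult_exp_exp) (simp add: inner_diff_right right_diff_distrib)
  then show ?thesis by (simp add: fcoef_def mult.assoc)
qed

lemma Rep_torus_test_props [simp]:
  "smooth_fun (Rep_torus_test \<psi>)" "torus_periodic (Rep_torus_test \<psi>)"
  using Rep_torus_test[of \<psi>] by auto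

lemma test_pderiv_wave: "test_pderiv j (wave \<xi>) = test_scale (\<i> * of_int (\<xi> $ j)) (wave \<xi>)"
  by transfer (simp add: pderiv_at_wave[where c = 1, simplified])

lemma fcoef_const: "fcoef (\<lambda>x. c) 0 = c"
  using content_period_box[where 'n='a] by (simp add: fcoef_def period_box_def scaleR_conv_of_real power_mult_distrib)

text \<open>Off the diagonal, the coefficient of \<open>test_pderiv j (wave \<eta>)\<close> is
  computed in two ways, with factor \<open>\<xi> $ j\<close> by \<open>fcoef_pderiv\<close> and with
  factor \<open>\<eta> $ j\<close> by the eigenvalue equation. A coordinate where they differ forces
  the coefficient to vanish.\<close>

lemma fcoef_wave: "fcoef (Rep_torus_test (wave \<eta>)) \<xi> = of_bool (\<xi> = \<eta>)"
proof (cases "\<xi> = \<eta>")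
  case True
  then show ?thesis
    using fcoef_mult_wave[of "\<lambda>x. 1" \<eta> \<xi>] by (simp add: wave.rep_eq fcoef_const)
next
  case False
  then obtain j where j: "\<xi> $ j \<noteq> \<eta> $ j" by (auto simp: vec_eq_iff)
  have "fcoef (Rep_torus_test (test_pderiv j (wave \<eta>))) \<xi>
      = \<i> * of_int (\<xi> $ j) * fcoef (Rep_torus_test (wave \<eta>)) \<xi>"
    by (simp add: test_pderiv.rep_eq fcoef_pderiv)
  moreover have "fcoef (Rep_torus_test (test_pderiv j (wave \<eta>))) \<xi>
      = \<i> * of_int (\<eta> $ j) * fcoef (Rep_torus_test (wave \<eta>)) \<xi>"
    by (simp add: test_pderiv_wave test_scale.rep_eq fcoef_scale)
  ultimately show ?thesis using j False by simp
qed

section \<open>The torus as a quotient and as a product of circles\<close>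

lemma torus_periodic_lattice:
  fixes f :: "real ^ 'n::finite \<Rightarrow> complex"
  assumes "torus_periodic f"
  shows "f (x + (2 * pi) *\<^sub>R freq \<xi>) = f x"
proof -
  have shift: "f (y + (2 * pi * of_int k) *\<^sub>R axis j 1) = f y" for y :: "real ^ 'n" and j k
  proof (induction k rule: int_induct[where k = 0])
    case (step1 i)
    have "y + (2 * pi * of_int (i + 1)) *\<^sub>R axis j 1
        = (y + (2 * pi * of_int i) *\<^sub>R axis j 1) + (2 * pi) *\<^sub>R axis j 1"
      by (simp add: algebra_simps)
    then show ?case using step1 assms by (simp only: torus_periodic_def)
  next
    case (step2 i)
    have "y + (2 * pi * of_int i) *\<^sub>R axis j 1
        = (y + (2 * pi * of_int (i - 1)) *\<^sub>R axis j 1) + (2 * pi) *\<^sub>R axis j 1"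
      by (simp add: algebra_simps)
    then show ?case using step2 assms by (metis torus_periodic_def)
  qed simp
  have "f (x + (\<Sum>j\<in>J. (2 * pi * of_int (\<xi> $ j)) *\<^sub>R axis j 1)) = f x" if "finite J" for J
    using that
  proof (induction J)
    case (insert j J)
    then show ?case
      using shift[of "x + (\<Sum>j\<in>J. (2 * pi * of_int (\<xi> $ j)) *\<^sub>R axis j 1)" "\<xi> $ j" j]
      by (simp add: add_ac)
  qed simp
  moreover have "(\<Sum>j\<in>UNIV. (2 * pi * of_int (\<xi> $ j)) *\<^sub>R axis j 1) = (2 * pi) *\<^sub>R freq \<xi>"
    by (auto simp: vec_eq_iff axis_def if_distrib cong: if_cong)
  ultimately show ?thesis by (metis finite_class.finite_UNIV)
qed

lemma ex_period_box_translate: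
  fixes x :: "real ^ 'n::finite"
  shows "\<exists>\<xi>. x + (2 * pi) *\<^sub>R freq \<xi> \<in> period_box"
proof
  have "0 \<le> x $ j - 2 * pi * of_int \<lfloor>x $ j / (2 * pi)\<rfloor>"
       "x $ j - 2 * pi * of_int \<lfloor>x $ j / (2 * pi)\<rfloor> \<le> 2 * pi" for j
    using floor_divide_lower[of "2 * pi" "x $ j"] floor_divide_upper[of "2 * pi" "x $ j"]
    by (auto simp: algebra_simps)
  then show "x + (2 * pi) *\<^sub>R freq (\<chi> j. - \<lfloor>x $ j / (2 * pi)\<rfloor>) \<in> period_box"
    by (auto simp: period_box_def mem_box_cart)
qed

lemma torus_periodic_bounded:
  fixes f :: "real ^ 'n::finite \<Rightarrow> complex"
  assumes "continuous_on UNIV f" "torus_periodic f"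
  obtains B where "\<And>x. norm (f x) \<le> B"
proof -
  have "compact (f ` period_box)"
    unfolding period_box_def
    by (intro compact_continuous_image continuous_on_subset[OF assms(1)]) auto
  then obtain B where B: "\<And>x. x \<in> period_box \<Longrightarrow> norm (f x) \<le> B"
    by (meson compact_imp_bounded bounded_iff imageI)
  show thesis
    by (rule that[of B]) (metis B ex_period_box_translate torus_periodic_lattice[OF assms(2)])
qed

text \<open>Wraps the space onto a compact set on which \<open>Re\<close> and \<open>Im\<close> of
  the coordinates separate points. On the period box \<open>cos\<close> and \<open>sin\<close> would
  not separate opposite faces.\<close>

definition cis_vec :: "real ^ 'n \<Rightarrow> complex ^ 'n" where
  "cis_vec x = (\<chi> j. cis (x $ j))"

definition circles :: "(complex ^ 'n) set" where
  "circles = {z. \<forall>j. norm (z $ j) = 1}"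

lemma cis_vec_in_circles: "cis_vec x \<in> circles"
  by (simp add: cis_vec_def circles_def)

lemma compact_circles: "compact (circles :: (complex ^ 'n::finite) set)"
proof -
  have "norm z \<le> CARD('n)" if "z \<in> circles" for z :: "complex ^ 'n"
    using L2_set_le_sum[of UNIV "\<lambda>j. norm (z $ j)"] that
    by (simp add: norm_vec_def circles_def)
  then have "bounded (circles :: (complex ^ 'n) set)"
    by (auto simp: bounded_iff)
  moreover have "closed (circles :: (complex ^ 'n) set)"
    unfolding circles_def by (intro closed_Collect_all closed_Collect_eq continuous_intros)
  ultimately show ?thesis by (simp add: compact_eq_bounded_closed)
qed

text \<open>Two points with the same image differ by \<open>2 * pi\<close> times an integer vector,
  so \<open>f\<close> descends to a function on \<open>circles\<close>.\<close>

lemma cis_vec_eqD: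
  fixes f :: "real ^ 'n::finite \<Rightarrow> complex"
  assumes "torus_periodic f" "cis_vec x = cis_vec y"
  shows "f x = f y"
proof -
  have "\<exists>k::int. x $ j = y $ j + 2 * pi * of_int k" for j
  proof -
    have "exp (\<i> * complex_of_real (x $ j)) = exp (\<i> * complex_of_real (y $ j))"
      using assms(2) by (simp add: cis_vec_def vec_eq_iff cis_conv_exp)
    then obtain k :: int where
      "\<i> * complex_of_real (x $ j) = \<i> * complex_of_real (y $ j) + (of_int (2 * k) * pi) * \<i>"
      unfolding exp_eq by blast
    then have "\<i> * complex_of_real (x $ j) = \<i> * complex_of_real (y $ j + 2 * pi * of_int k)"
      by (simp add: algebra_simps)
    then show ?thesis
      by (metis complex_i_not_zero mult_cancel_left of_real_eq_iff)
  qed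
  then obtain k :: "'n \<Rightarrow> int" where "x $ j = y $ j + 2 * pi * of_int (k j)" for j
    by metis
  then have "x = y + (2 * pi) *\<^sub>R freq (\<chi> j. k j)"
    by (simp add: vec_eq_iff)
  then show ?thesis using torus_periodic_lattice[OF assms(1)] by simp
qed

lemma circles_eq_cis_vec: "z \<in> circles \<Longrightarrow> cis_vec (\<chi> j. Arg (z $ j)) = z"
  by (auto simp: cis_vec_def circles_def vec_eq_iff cis_Arg_unique)
    (metis Arg_zero cis_Arg div_by_1 norm_zero of_real_1 sgn_eq zero_neq_one)

text \<open>Near a point \<open>z\<^sub>0\<close> of the product of circles, \<open>z \<mapsto> x\<^sub>0 + Arg (z / z\<^sub>0)\<close> is a continuous
  right inverse of \<open>cis_vec\<close>; this makes the induced function continuous although \<open>Arg\<close> is not.\<close>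

lemma torus_periodic_factor:
  fixes f :: "real ^ 'n::finite \<Rightarrow> complex"
  assumes "continuous_on UNIV f" "torus_periodic f"
  obtains H where "continuous_on circles H" "\<And>x. H (cis_vec x) = f x"
proof -
  define H where "H z = f (\<chi> j. Arg (z $ j))" for z
  have H: "H (cis_vec x) = f x" for x
    unfolding H_def
    by (rule cis_vec_eqD[OF assms(2)]) (simp add: circles_eq_cis_vec cis_vec_in_circles)
  have "continuous_on circles H"
    unfolding continuous_on_def
  proof
    fix z0 :: "complex ^ 'n" assume z0: "z0 \<in> circles"
    then have "norm (z0 $ j) = 1" for j by (simp add: circles_def)
    then have z0_nz: "z0 $ j \<noteq> 0" for j using norm_zero zero_neq_one by metis
    define x0 where "x0 = (\<chi> j. Arg (z0 $ j))"
    define G where "G z = f (\<chi> j. x0 $ j + Arg (z $ j / z0 $ j))" for z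
    have HG: "H z = G z" if z: "z \<in> circles" for z
    proof -
      have "cis (Arg (z0 $ j)) = z0 $ j" "cis (Arg (z $ j / z0 $ j)) = z $ j / z0 $ j" for j
        using z z0 z0_nz[of j] circles_eq_cis_vec[of z0] circles_eq_cis_vec[of "\<chi> j. z $ j / z0 $ j"]
        by (auto simp: circles_def cis_vec_def vec_eq_iff norm_divide)
      then have "cis_vec (\<chi> j. x0 $ j + Arg (z $ j / z0 $ j)) = z"
        using z0_nz by (simp add: cis_vec_def vec_eq_iff x0_def cis_mult[symmetric])
      then show ?thesis by (metis H G_def)
    qed
    have "((\<lambda>z. Arg (z $ j / z0 $ j)) \<longlongrightarrow> Arg 1) (at z0 within circles)" for j
    proof (rule isCont_tendsto_compose[OF continuous_at_Arg])
      have "((\<lambda>z. z $ j / z0 $ j) \<longlongrightarrow> z0 $ j / z0 $ j) (at z0 within circles)"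
        by (intro tendsto_intros) (use z0_nz in auto)
      then show "((\<lambda>z. z $ j / z0 $ j) \<longlongrightarrow> 1) (at z0 within circles)"
        using z0_nz by simp
    qed auto
    then have "((\<lambda>z. \<chi> j. x0 $ j + Arg (z $ j / z0 $ j)) \<longlongrightarrow> (\<chi> j. x0 $ j + Arg 1))
        (at z0 within circles)"
      by (intro tendsto_vec_lambda tendsto_add tendsto_const)
    moreover have "isCont f (\<chi> j. x0 $ j + Arg 1)"
      using assms(1) by (simp add: continuous_on_eq_continuous_at)
    ultimately have "(G \<longlongrightarrow> f (\<chi> j. x0 $ j + Arg 1)) (at z0 within circles)"
      unfolding G_def by (rule isCont_tendsto_compose[rotated])
    moreover have "f (\<chi> j. x0 $ j + Arg 1) = G z0" using z0_nz by (simp add: G_def)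
    ultimately have "(G \<longlongrightarrow> H z0) (at z0 within circles)" using HG[OF z0] by simp
    then show "(H \<longlongrightarrow> H z0) (at z0 within circles)"
      by (rule Lim_transform_within[OF _ zero_less_one]) (simp add: HG)
  qed
  with H that show thesis by blast
qed

section \<open>Injectivity of the Fourier transform\<close>

text \<open>The functions that preserve the vanishing of all Fourier coefficients form an algebra, to which
  Stone-Weierstrass applies directly; no trigonometric polynomials are needed.\<close>

definition multiplier_closed :: "(complex ^ 'n::finite \<Rightarrow> real) \<Rightarrow> bool" where
  "multiplier_closed q \<longleftrightarrow> continuous_on circles q \<and>
     (\<forall>f. continuous_on UNIV f \<and> torus_periodic f \<and> (\<forall>\<xi>. fcoef f \<xi> = 0) \<longrightarrow>
        (\<forall>\<xi>. fcoef (\<lambda>x. f x * complex_of_real (q (cis_vec x))) \<xi> = 0))"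

lemma continuous_on_cis_vec [continuous_intros]:
  "continuous_on S g \<Longrightarrow> continuous_on S (\<lambda>x. cis_vec (g x))"
  unfolding cis_vec_def cis_conv_exp by (intro continuous_intros)

lemma torus_periodic_cis_vec:
  "cis_vec (x + (2 * pi) *\<^sub>R axis j 1) = cis_vec x"
  by (auto simp: cis_vec_def vec_eq_iff axis_def complex_eq_iff)

lemma multiplier_closed_continuous:
  assumes "multiplier_closed q"
  shows "continuous_on UNIV (\<lambda>x. complex_of_real (q (cis_vec x)))"
proof -
  have "continuous_on circles q" using assms by (simp add: multiplier_closed_def)
  then have "continuous_on UNIV (\<lambda>x. q (cis_vec x))"
    by (rule continuous_on_compose2[OF _ continuous_on_cis_vec[OF continuous_on_id]])
      (auto simp: cis_vec_in_circles)
  then show ?thesis by (rule continuous_on_of_real)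
qed

text \<open>The function \<open>f\<close> times \<open>p\<close> is again continuous and periodic
  with vanishing coefficients, so the property of \<open>q\<close> applies to it. For this reason
  \<open>multiplier_closed\<close> quantifies over all such \<open>f\<close> instead of fixing
  one.\<close>

lemma multiplier_closed_mult:
  assumes p: "multiplier_closed p" and q: "multiplier_closed q"
  shows "multiplier_closed (\<lambda>z. p z * q z)"
proof -
  have "fcoef (\<lambda>x. f x * complex_of_real (p (cis_vec x) * q (cis_vec x))) \<xi> = 0"
    if f: "continuous_on UNIV f" "torus_periodic f" "\<forall>\<xi>. fcoef f \<xi> = 0" for f \<xi>
  proof -
    let ?g = "\<lambda>x. f x * complex_of_real (p (cis_vec x))"
    have "continuous_on UNIV ?g"
      by (intro continuous_intros f multiplier_closed_continuous p)
    moreover have "torus_periodic ?g"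
      using f by (simp add: torus_periodic_def torus_periodic_cis_vec)
    moreover have "\<forall>\<xi>. fcoef ?g \<xi> = 0"
      using p f unfolding multiplier_closed_def by blast
    ultimately have "fcoef (\<lambda>x. ?g x * complex_of_real (q (cis_vec x))) \<xi> = 0"
      using q unfolding multiplier_closed_def by blast
    then show ?thesis by (simp add: mult.assoc)
  qed
  then show ?thesis
    using p q unfolding multiplier_closed_def by (auto intro: continuous_on_mult)
qed

lemma multiplier_closed_add:
  assumes p: "multiplier_closed p" and q: "multiplier_closed q"
  shows "multiplier_closed (\<lambda>z. p z + q z)"
proof -
  have "fcoef (\<lambda>x. f x * complex_of_real (p (cis_vec x) + q (cis_vec x))) \<xi> = 0"
    if f: "continuous_on UNIV f" "torus_periodic f" "\<forall>\<xi>. fcoef f \<xi> = 0" for f \<xi>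
    unfolding of_real_add distrib_left
    by (subst fcoef_add; (intro continuous_intros f multiplier_closed_continuous p q)?)
      (use p q f in \<open>simp add: multiplier_closed_def\<close>)
  then show ?thesis
    using p q unfolding multiplier_closed_def by (auto intro: continuous_on_add)
qed

lemma multiplier_closed_const: "multiplier_closed (\<lambda>z. c)"
  by (simp add: multiplier_closed_def mult.commute[of _ "complex_of_real c"] fcoef_scale)

text \<open>Multiplication by \<open>cos x\<^sub>j\<close> and \<open>sin x\<^sub>j\<close> shifts Fourier coefficients.\<close>

lemma multiplier_closed_coordinate:
  fixes j :: "'n::finite"
  shows "multiplier_closed (\<lambda>z. Re (z $ j))" "multiplier_closed (\<lambda>z. Im (z $ j))"
proof -
  let ?E = "\<lambda>\<eta> (x::real^'n). exp (\<i> * complex_of_real (x \<bullet> freq \<eta>))"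
  let ?e = "axis j 1 :: int ^ 'n"
  have E: "cis (x $ j) = ?E ?e x" "cis (- (x $ j)) = ?E (- ?e) x" for x
    by (simp_all add: cis_conv_exp inner_axis)
  have sum: "fcoef (\<lambda>x. f x * (a * ?E ?e x + b * ?E (- ?e) x)) \<xi> = 0"
    if f: "continuous_on UNIV f" "\<forall>\<xi>. fcoef f \<xi> = 0" for f a b \<xi>
  proof -
    have "fcoef (\<lambda>x. a * (f x * ?E ?e x) + b * (f x * ?E (- ?e) x)) \<xi> = 0"
      by (subst fcoef_add; (intro continuous_intros f)?)
        (simp only: fcoef_scale fcoef_mult_wave f(2) mult_zero_right add_0)
    then show ?thesis by (simp only: distrib_left mult.left_commute)
  qed
  have Re: "complex_of_real (cos t) = 1/2 * cis t + 1/2 * cis (- t)"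
    and Im: "complex_of_real (sin t) = (1/(2*\<i>)) * cis t + (- 1/(2*\<i>)) * cis (- t)" for t
    by (simp_all add: complex_eq_iff)
  have cr: "(\<lambda>x. f x * complex_of_real (Re (cis_vec x $ j)))
      = (\<lambda>x. f x * (1/2 * ?E ?e x + 1/2 * ?E (- ?e) x))" for f :: "real ^ 'n \<Rightarrow> complex"
    by (rule ext, simp only: cis_vec_def vec_lambda_beta cis.sel Re) (simp only: E)
  have ci: "(\<lambda>x. f x * complex_of_real (Im (cis_vec x $ j)))
      = (\<lambda>x. f x * (1/(2*\<i>) * ?E ?e x + - 1/(2*\<i>) * ?E (- ?e) x))" for f :: "real ^ 'n \<Rightarrow> complex"
    by (rule ext, simp only: cis_vec_def vec_lambda_beta cis.sel Im) (simp only: E)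
  show "multiplier_closed (\<lambda>z. Re (z $ j))"
    unfolding multiplier_closed_def cr by (intro conjI allI impI sum continuous_intros) auto
  show "multiplier_closed (\<lambda>z. Im (z $ j))"
    unfolding multiplier_closed_def ci by (intro conjI allI impI sum continuous_intros) auto
qed

text \<open>Stone-Weierstrass replaces \<open>q\<close> by some \<open>p\<close> with
  \<open>multiplier_closed p\<close>, uniformly within \<open>e\<close>. The integral with
  \<open>p\<close> is, up to normalisation, the coefficient at frequency \<open>0\<close> of a
  function all of whose coefficients vanish, so only an error of size \<open>e\<close> times a
  constant remains.\<close>

lemma fcoef_eq_zero_integral:
  fixes f :: "real ^ 'n::finite \<Rightarrow> complex"
  assumes f: "continuous_on UNIV f" "torus_periodic f" "\<And>\<xi>. fcoef f \<xi> = 0"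
    and q: "continuous_on circles q"
  shows "integral period_box (\<lambda>x. f x * complex_of_real (q (cis_vec x))) = 0"
proof -
  obtain B where B: "\<And>x. norm (f x) \<le> B"
    using torus_periodic_bounded[OF f(1,2)] by blast
  have q_cont: "continuous_on UNIV (\<lambda>x. complex_of_real (q (cis_vec x)))"
    using cis_vec_in_circles
    by (intro continuous_intros continuous_on_compose2[OF q]) auto
  let ?I = "integral period_box (\<lambda>x. f x * complex_of_real (q (cis_vec x)))"
  have *: "norm ?I \<le> e * (B * (2 * pi) ^ CARD('n))" if e: "e > 0" for e
  proof -
    have "\<exists>p. multiplier_closed p \<and> (\<forall>z\<in>circles. \<bar>q z - p z\<bar> < e)"
    proof (rule Stone_Weierstrass_HOL[OF compact_circles])
      show "\<exists>p. multiplier_closed p \<and> p z \<noteq> p w"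
        if "z \<in> circles \<and> w \<in> circles \<and> z \<noteq> w" for z w :: "complex ^ 'n"
      proof -
        from that have "z \<noteq> w" by blast
        then obtain j where "z $ j \<noteq> w $ j" by (auto simp: vec_eq_iff)
        then show ?thesis using multiplier_closed_coordinate[of j] complex_eqI by blast
      qed
      show "continuous_on circles p" if "multiplier_closed p" for p :: "complex ^ 'n \<Rightarrow> real"
        using that by (simp add: multiplier_closed_def)
    qed (use q e in \<open>auto intro: multiplier_closed_const multiplier_closed_add
          multiplier_closed_mult\<close>)
    then obtain p where p: "multiplier_closed p" "\<And>z. z \<in> circles \<Longrightarrow> \<bar>q z - p z\<bar> < e"
      by blast
    note p_cont = multiplier_closed_continuous[OF p(1)]
    have "fcoef (\<lambda>x. f x * complex_of_real (p (cis_vec x))) 0 = 0"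
      using p(1) f unfolding multiplier_closed_def by blast
    then have "integral period_box (\<lambda>x. f x * complex_of_real (p (cis_vec x))) = 0"
      by (simp add: fcoef_def)
    then have "?I = integral period_box (\<lambda>x. f x * complex_of_real (q (cis_vec x))
        - f x * complex_of_real (p (cis_vec x)))"
      by (subst integral_diff) (auto intro!: integrable_period_box continuous_intros f q_cont p_cont)
    also have "norm \<dots> \<le> integral period_box (\<lambda>x::real^'n. B * e)"
    proof (rule integral_norm_bound_integral)
      show "norm (f x * complex_of_real (q (cis_vec x)) - f x * complex_of_real (p (cis_vec x)))
          \<le> B * e" for x
      proof -
        have "norm (f x * complex_of_real (q (cis_vec x)) - f x * complex_of_real (p (cis_vec x)))
            = norm (f x) * \<bar>q (cis_vec x) - p (cis_vec x)\<bar>"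
          by (simp flip: right_diff_distrib of_real_diff add: norm_mult)
        also have "\<dots> \<le> B * e"
          using p(2)[OF cis_vec_in_circles, of x] B[of x] norm_ge_zero[of "f x"]
          by (intro mult_mono) linarith+
        finally show ?thesis .
      qed
    qed (auto intro!: integrable_period_box continuous_intros f q_cont p_cont)
    also have "\<dots> = e * (B * (2 * pi) ^ CARD('n))"
      using content_period_box[where 'n='n] by (simp add: period_box_def)
    finally show ?thesis .
  qed
  have "norm ?I \<le> 0"
  proof (rule tendsto_lowerbound)
    show "((\<lambda>e. e * (B * (2 * pi) ^ CARD('n))) \<longlongrightarrow> 0) (at_right 0)"
      by (rule tendsto_eq_intros refl | simp)+
    show "\<forall>\<^sub>F e in at_right 0. norm ?I \<le> e * (B * (2 * pi) ^ CARD('n))"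
      using * by (auto simp: eventually_at_right_field intro: exI[of _ 1])
  qed simp
  then show ?thesis by simp
qed

text \<open>With \<open>q\<close> the real and the imaginary part of \<open>f\<close> itself, seen
  on the circles, the two vanishing integrals combine to the integral of \<open>f\<close> times its
  conjugate. A continuous nonnegative function with integral zero vanishes on the box, and
  periodicity spreads this.\<close>

lemma fcoef_eq_zero_imp_zero:
  fixes f :: "real ^ 'n::finite \<Rightarrow> complex"
  assumes f: "continuous_on UNIV f" "torus_periodic f" "\<And>\<xi>. fcoef f \<xi> = 0"
  shows "f x = 0"
proof -
  obtain H where H: "continuous_on circles H" "\<And>x. H (cis_vec x) = f x"
    using torus_periodic_factor[OF f(1,2)] by blast
  have "integral period_box (\<lambda>x. f x * complex_of_real (Re (f x))) = 0"
       "integral period_box (\<lambda>x. f x * complex_of_real (Im (f x))) = 0"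
    using fcoef_eq_zero_integral[OF f, of "\<lambda>z. Re (H z)"]
      fcoef_eq_zero_integral[OF f, of "\<lambda>z. Im (H z)"] H
    by (auto intro: continuous_intros)
  then have "integral period_box (\<lambda>x. f x * complex_of_real (Re (f x))
      + (- \<i>) * (f x * complex_of_real (Im (f x)))) = 0"
    by (subst integral_add) (auto intro!: integrable_period_box continuous_intros f)
  moreover have "f x * complex_of_real (Re (f x)) + (- \<i>) * (f x * complex_of_real (Im (f x)))
      = complex_of_real ((norm (f x))\<^sup>2)" for x
    by (simp add: complex_eq_iff cmod_power2) (simp add: power2_eq_square)
  ultimately have "integral period_box (\<lambda>x. complex_of_real ((norm (f x))\<^sup>2)) = 0"
    by simp
  moreover have "((\<lambda>x. complex_of_real ((norm (f x))\<^sup>2)) has_integral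
      integral period_box (\<lambda>x. complex_of_real ((norm (f x))\<^sup>2))) period_box"
    by (intro integrable_integral integrable_period_box continuous_intros f)
  ultimately have "((\<lambda>x. complex_of_real ((norm (f x))\<^sup>2)) has_integral 0) period_box"
    by simp
  from has_integral_linear[OF this bounded_linear_Re]
  have int: "((\<lambda>x. (norm (f x))\<^sup>2) has_integral 0) (cbox 0 (\<chi> i. 2 * pi))"
    by (simp add: period_box_def o_def)
  have zero: "f y = 0" if "y \<in> period_box" for y
  proof -
    have "(norm (f y))\<^sup>2 = 0"
    proof (rule has_integral_0_cbox_imp_0[OF _ _ int])
      show "continuous_on (cbox 0 (\<chi> i. 2 * pi)) (\<lambda>x. (norm (f x))\<^sup>2)"
        by (intro continuous_intros continuous_on_subset[OF f(1)]) auto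
      show "box 0 (\<chi> i. 2 * pi) \<noteq> ({} :: (real ^ 'n) set)"
        by (simp add: interval_ne_empty_cart)
    qed (use that in \<open>auto simp: period_box_def\<close>)
    then show ?thesis by simp
  qed
  then show ?thesis
    using ex_period_box_translate[of x] torus_periodic_lattice[OF f(2), of x] by metis
qed

section \<open>Fourier series of test functions and distributions\<close>

definition bracket :: "int ^ 'n::finite \<Rightarrow> real" where
  "bracket \<xi> = 1 + norm (freq \<xi>)"

lemma bracket_ge_1: "bracket \<xi> \<ge> 1" and bracket_pos [simp]: "bracket \<xi> > 0"
  and bracket_nonzero [simp]: "bracket \<xi> \<noteq> 0"
  using norm_ge_zero[of "freq \<xi>"] unfolding bracket_def by linarith+

lemma bracket_uminus [simp]: "bracket (- \<xi>) = bracket \<xi>"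
  by (simp add: bracket_def)

section \<open>Summability over the frequency lattice\<close>

lemma summable_on_int_inverse_squares: "(\<lambda>k::int. 1 / (1 + (real_of_int k)\<^sup>2)) summable_on UNIV"
proof -
  have "summable (\<lambda>n. 1 / (1 + (real n)\<^sup>2))"
  proof (rule summable_comparison_test')
    show "summable (\<lambda>n. inverse ((real n)\<^sup>2))"
      using inverse_power_summable[of 2, where 'a = real] by simp
    show "norm (1 / (1 + (real n)\<^sup>2)) \<le> inverse ((real n)\<^sup>2)" if "n \<ge> 1" for n
    proof -
      have "0 < (real n)\<^sup>2" using that by simp
      then have "1 / (1 + (real n)\<^sup>2) \<le> 1 / (real n)\<^sup>2"
        by (intro frac_le) auto
      moreover have "0 < 1 + (real n)\<^sup>2" by (rule add_pos_nonneg) auto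
      ultimately show ?thesis by (simp add: inverse_eq_divide)
    qed
  qed
  then have nat: "(\<lambda>n::nat. 1 / (1 + (real n)\<^sup>2)) summable_on UNIV"
    by (rule summable_nonneg_imp_summable_on) simp
  have pos: "(\<lambda>k::int. 1 / (1 + (real_of_int k)\<^sup>2)) summable_on range int"
    using nat by (subst summable_on_reindex) (auto simp: o_def)
  have neg: "(\<lambda>k::int. 1 / (1 + (real_of_int k)\<^sup>2)) summable_on range (\<lambda>n. - int n)"
    using nat by (subst summable_on_reindex) (auto simp: o_def inj_on_def)
  have "k \<in> range int \<union> range (\<lambda>n. - int n)" for k
    by (cases k rule: int_cases2) auto
  then have "range int \<union> range (\<lambda>n. - int n) = UNIV" by blast
  with summable_on_union[OF pos neg] show ?thesis by simp
qed

text \<open>A finite set of lattice points lies in a cube \<open>I^N\<close>, where \<open>I\<close>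
  is finite and collects all coordinates; over the cube the sum factors into a product of
  one-dimensional sums.\<close>

lemma summable_on_prod_coordinates:
  fixes g :: "int \<Rightarrow> real"
  assumes g: "g summable_on UNIV" "\<And>k. g k \<ge> 0"
  shows "(\<lambda>\<xi>::int ^ 'n::finite. \<Prod>j\<in>UNIV. g (\<xi> $ j)) summable_on UNIV"
proof (rule nonneg_bdd_above_summable_on)
  show "bdd_above (sum (\<lambda>\<xi>::int ^ 'n. \<Prod>j\<in>UNIV. g (\<xi> $ j)) ` {F. F \<subseteq> UNIV \<and> finite F})"
  proof (rule bdd_aboveI2)
    fix F :: "(int ^ 'n) set" assume "F \<in> {F. F \<subseteq> UNIV \<and> finite F}"
    then have F: "finite F" by simp
    define I where "I = (\<Union>j. (\<lambda>\<xi>. \<xi> $ j) ` F)"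
    have fin: "finite I" using F by (simp add: I_def)
    let ?P = "PiE UNIV (\<lambda>_::'n. I)"
    have "(\<Sum>\<xi>\<in>F. \<Prod>j\<in>UNIV. g (\<xi> $ j)) = (\<Sum>h\<in>vec_nth ` F. \<Prod>j\<in>UNIV. g (h j))"
      by (subst sum.reindex) (auto simp: inj_on_def vec_nth_inject)
    also have "\<dots> \<le> (\<Sum>h\<in>?P. \<Prod>j\<in>UNIV. g (h j))"
      by (rule sum_mono2) (use fin g(2) in \<open>auto simp: I_def intro: finite_PiE prod_nonneg\<close>)
    also have "\<dots> = (\<Prod>j\<in>(UNIV::'n set). \<Sum>k\<in>I. g k)"
      by (rule prod_sum_PiE[symmetric]) (use fin in auto)
    also have "\<dots> \<le> (\<Prod>j\<in>(UNIV::'n set). infsum g UNIV)"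
      by (intro prod_mono conjI sum_nonneg finite_sum_le_infsum g fin) (use g in auto)
    finally show "(\<Sum>\<xi>\<in>F. \<Prod>j\<in>UNIV. g (\<xi> $ j)) \<le> (\<Prod>j\<in>(UNIV::'n set). infsum g UNIV)" .
  qed
qed (auto intro: prod_nonneg g)

text \<open>Each factor \<open>1 + \<xi>_j^2\<close> is at most \<open>(bracket \<xi>)^2\<close>,
  hence their product over the \<open>N\<close> coordinates is at most the power
  \<open>2 * N\<close>. The comparison is with the product of one-dimensional inverse
  squares.\<close>

lemma summable_on_bracket:
  assumes "p \<ge> 2 * real CARD('n::finite)"
  shows "(\<lambda>\<xi>::int ^ 'n. bracket \<xi> powr (- p)) summable_on UNIV"
proof (rule summable_on_comparison_test)
  show "(\<lambda>\<xi>::int ^ 'n. \<Prod>j\<in>UNIV. 1 / (1 + (real_of_int (\<xi> $ j))\<^sup>2)) summable_on UNIV"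
    by (intro summable_on_prod_coordinates summable_on_int_inverse_squares) auto
  fix \<xi> :: "int ^ 'n"
  have "1 + (real_of_int (\<xi> $ j))\<^sup>2 \<le> (bracket \<xi>)\<^sup>2" for j
  proof -
    have "(real_of_int (\<xi> $ j))\<^sup>2 \<le> (norm (freq \<xi>))\<^sup>2"
      using component_le_norm_cart[of "freq \<xi>" j] by (intro abs_le_square_iff[THEN iffD1]) simp
    then show ?thesis
      by (simp add: bracket_def power2_sum) (use norm_ge_zero[of "freq \<xi>"] in linarith)
  qed
  then have "(\<Prod>j\<in>UNIV. 1 + (real_of_int (\<xi> $ j))\<^sup>2) \<le> (\<Prod>j\<in>(UNIV::'n set). (bracket \<xi>)\<^sup>2)"
    by (intro prod_mono) (auto simp: add_nonneg_nonneg)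
  also have "\<dots> = bracket \<xi> powr (2 * real CARD('n))"
    using powr_realpow[OF bracket_pos[of \<xi>], of "2 * CARD('n)"] by (simp add: power_mult)
  also have "\<dots> \<le> bracket \<xi> powr p"
    using assms bracket_ge_1[of \<xi>] by (intro powr_mono)
  finally have *: "(\<Prod>j\<in>UNIV. 1 + (real_of_int (\<xi> $ j))\<^sup>2) \<le> bracket \<xi> powr p" .
  have "0 < (\<Prod>j\<in>UNIV. 1 + (real_of_int (\<xi> $ j))\<^sup>2)"
    by (intro prod_pos) (simp add: add_pos_nonneg)
  with * show "bracket \<xi> powr (- p) \<le> (\<Prod>j\<in>UNIV. 1 / (1 + (real_of_int (\<xi> $ j))\<^sup>2))"
    by (simp add: powr_minus prod_dividef divide_simps)
qed simp

section \<open>Seminorms of test functions and decay of their coefficients\<close>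

lemma bdd_above_test:
  "bdd_above (range (\<lambda>x. norm (Rep_torus_test \<psi> x)))"
proof -
  obtain B where "norm (Rep_torus_test \<psi> x) \<le> B" for x
    using torus_periodic_bounded[OF continuous_on_smooth_fun[OF Rep_torus_test_props(1)]
        Rep_torus_test_props(2)] by blast
  then show ?thesis by (intro bdd_aboveI2)
qed

lemma sup_test_nonneg: "0 \<le> (SUP x. norm (Rep_torus_test \<psi> x))"
  by (rule order_trans[OF norm_ge_zero cSUP_upper[OF UNIV_I bdd_above_test]])

lemma finite_short_lists: "finite {js :: 'n::finite list. length js \<le> m}"
  using finite_lists_length_le[of "UNIV :: 'n set" m] by simp

lemma norm_le_test_seminorm:
  assumes "length js \<le> m"
  shows "norm (Rep_torus_test (foldr test_pderiv js \<psi>) x) \<le> test_seminorm m \<psi>"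
proof -
  have "norm (Rep_torus_test (foldr test_pderiv js \<psi>) x)
      \<le> (SUP x. norm (Rep_torus_test (foldr test_pderiv js \<psi>) x))"
    by (rule cSUP_upper[OF UNIV_I bdd_above_test])
  also have "\<dots> \<le> test_seminorm m \<psi>"
    unfolding test_seminorm_def
    by (rule member_le_sum[where f = "\<lambda>js. SUP x. norm (Rep_torus_test (foldr test_pderiv js \<psi>) x)"])
      (use assms in \<open>auto intro: sup_test_nonneg finite_short_lists\<close>)
  finally show ?thesis .
qed

lemma test_seminorm_nonneg: "0 \<le> test_seminorm m \<psi>"
  unfolding test_seminorm_def by (intro sum_nonneg sup_test_nonneg)

lemma test_seminorm_mono:
  "m \<le> m' \<Longrightarrow> test_seminorm m \<psi> \<le> test_seminorm m' \<psi>"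
  unfolding test_seminorm_def
  by (rule sum_mono2) (auto intro: sup_test_nonneg finite_short_lists)

text \<open>The extra derivative acts first and \<open>foldr\<close> applies the last entry of a
  list first, so \<open>js\<close> becomes \<open>js @ [j]\<close>. This map is injective, and the
  left-hand sum is a part of the right-hand one.\<close>

lemma test_seminorm_pderiv: "test_seminorm m (test_pderiv j \<psi>) \<le> test_seminorm (Suc m) \<psi>"
proof -
  have "test_seminorm m (test_pderiv j \<psi>)
      = (\<Sum>js\<in>(\<lambda>js. js @ [j]) ` {js. length js \<le> m}.
          SUP x. norm (Rep_torus_test (foldr test_pderiv js \<psi>) x))"
    unfolding test_seminorm_def by (subst sum.reindex) (auto simp: inj_on_def)
  also have "\<dots> \<le> test_seminorm (Suc m) \<psi>"
    unfolding test_seminorm_def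
    by (rule sum_mono2) (auto intro: sup_test_nonneg finite_short_lists)
  finally show ?thesis .
qed

abbreviation tcoef :: "'n::finite torus_test \<Rightarrow> int ^ 'n \<Rightarrow> complex" where
  "tcoef \<psi> \<equiv> fcoef (Rep_torus_test \<psi>)"

lemma tcoef_pderivs:
  "tcoef (foldr test_pderiv js \<psi>) \<xi> = (\<Prod>j\<leftarrow>js. \<i> * of_int (\<xi> $ j)) * tcoef \<psi> \<xi>"
  by (induction js) (simp_all add: test_pderiv.rep_eq fcoef_pderiv mult.assoc)

lemma foldr_pderiv_wave:
  "Rep_torus_test (foldr test_pderiv js (wave \<xi>)) x
    = (\<Prod>j\<leftarrow>js. \<i> * of_int (\<xi> $ j)) * Rep_torus_test (wave \<xi>) x"
proof -
  have scale: "test_pderiv j (test_scale c \<psi>) = test_scale c (test_pderiv j \<psi>)"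
    for j :: 'a and c and \<psi>
    using foldr_pderiv_at_scale[of "Rep_torus_test \<psi>" "[j]" c]
    by (simp add: Rep_torus_test_inject[symmetric] test_pderiv.rep_eq test_scale.rep_eq)
  have "foldr test_pderiv js (wave \<xi>) = test_scale (\<Prod>j\<leftarrow>js. \<i> * of_int (\<xi> $ j)) (wave \<xi>)"
  proof (induction js)
    case (Cons j js)
    then show ?case
      by (simp add: scale test_pderiv_wave) (simp add: Rep_torus_test_inject[symmetric]
          test_scale.rep_eq fun_eq_iff)
  qed (simp add: Rep_torus_test_inject[symmetric] test_scale.rep_eq)
  then show ?thesis by (simp add: test_scale.rep_eq)
qed

text \<open>With \<open>j\<close> the coordinate of largest modulus, \<open>m\<close> derivatives
  along \<open>j\<close> produce the factor \<open>?M ^ m\<close>, while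
  \<open>norm (freq \<xi>)\<close> is at most \<open>N * ?M\<close>. The undifferentiated bound
  covers \<open>?M < 1\<close>, whence \<open>max 1 ?M\<close> and the constant
  \<open>1 + N\<close>.\<close>

lemma tcoef_decay:
  fixes \<psi> :: "'n::finite torus_test"
  shows "bracket \<xi> ^ m * norm (tcoef \<psi> \<xi>) \<le> (1 + real CARD('n)) ^ m * test_seminorm m \<psi>"
proof -
  obtain j where j: "\<bar>real_of_int (\<xi> $ k)\<bar> \<le> \<bar>real_of_int (\<xi> $ j)\<bar>" for k
  proof -
    have "finite (range (\<lambda>k. \<bar>real_of_int (\<xi> $ k)\<bar>))" by simp
    from Max_in[OF this] Max_ge[OF this] show thesis
      by (metis (no_types, lifting) UNIV_not_empty image_iff image_is_empty rangeI that)
  qed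
  let ?M = "\<bar>real_of_int (\<xi> $ j)\<bar>"
  have bound: "norm (tcoef (foldr test_pderiv js \<psi>) \<xi>) \<le> test_seminorm m \<psi>"
    if "length js \<le> m" for js
    using that by (intro norm_fcoef_le norm_le_test_seminorm continuous_on_Rep_test continuous_on_id)
  have "?M ^ m * norm (tcoef \<psi> \<xi>) \<le> test_seminorm m \<psi>"
    using bound[of "replicate m j"]
    by (simp only: tcoef_pderivs map_replicate prod_list_replicate)
      (simp add: norm_mult norm_power)
  moreover have "1 ^ m * norm (tcoef \<psi> \<xi>) \<le> test_seminorm m \<psi>"
    using bound[of "[]"] by simp
  ultimately have *: "max 1 ?M ^ m * norm (tcoef \<psi> \<xi>) \<le> test_seminorm m \<psi>"
    by (cases "1 \<le> ?M") (auto simp: max_def)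
  have "norm (freq \<xi>) \<le> (\<Sum>k\<in>UNIV. \<bar>freq \<xi> $ k\<bar>)"
    by (rule norm_le_l1_cart)
  also have "\<dots> \<le> real CARD('n) * ?M"
    using sum_bounded_above[of UNIV "\<lambda>k. \<bar>freq \<xi> $ k\<bar>" ?M] j by simp
  also have "\<dots> \<le> real CARD('n) * max 1 ?M"
    by (intro mult_left_mono) auto
  finally have "bracket \<xi> \<le> (1 + real CARD('n)) * max 1 ?M"
    unfolding bracket_def distrib_right by linarith
  then have "bracket \<xi> ^ m \<le> (1 + real CARD('n)) ^ m * max 1 ?M ^ m"
    using bracket_pos[of \<xi>] by (simp flip: power_mult_distrib add: power_mono less_imp_le)
  then have "bracket \<xi> ^ m * norm (tcoef \<psi> \<xi>)
      \<le> (1 + real CARD('n)) ^ m * (max 1 ?M ^ m * norm (tcoef \<psi> \<xi>))"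
    using mult_right_mono[OF _ norm_ge_zero] by (metis mult.assoc)
  also have "\<dots> \<le> (1 + real CARD('n)) ^ m * test_seminorm m \<psi>"
    by (intro mult_left_mono *) auto
  finally show ?thesis .
qed

lemma tcoef_decay_powr:
  fixes \<psi> :: "'n::finite torus_test"
  assumes "p \<le> real m"
  shows "norm (tcoef \<psi> \<xi>) \<le> (1 + real CARD('n)) ^ m * test_seminorm m \<psi> * bracket \<xi> powr (- p)"
proof -
  have "bracket \<xi> powr p \<le> bracket \<xi> ^ m"
    using powr_mono[OF assms bracket_ge_1[of \<xi>]] by (simp add: powr_realpow)
  then have "bracket \<xi> powr p * norm (tcoef \<psi> \<xi>) \<le> (1 + real CARD('n)) ^ m * test_seminorm m \<psi>"
    using tcoef_decay[of \<xi> m \<psi>] mult_right_mono[OF _ norm_ge_zero] order_trans by blast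
  moreover have "bracket \<xi> powr p > 0" using bracket_pos[of \<xi>] by simp
  ultimately show ?thesis by (simp add: powr_minus_divide pos_le_divide_eq mult.commute)
qed

lemma tcoef_abs_summable: "(\<lambda>\<xi>. norm (tcoef \<psi> \<xi>)) summable_on UNIV"
  for \<psi> :: "'n::finite torus_test"
proof (rule summable_on_comparison_test)
  show "(\<lambda>\<xi>::int^'n. (1 + real CARD('n)) ^ (2 * CARD('n)) * test_seminorm (2 * CARD('n)) \<psi>
      * bracket \<xi> powr (- (2 * real CARD('n)))) summable_on UNIV"
    by (intro summable_on_cmult_right summable_on_bracket) simp
qed (use tcoef_decay_powr[of "2 * real CARD('n)" "2 * CARD('n)" \<psi>] in auto)

text \<open>Absolutely summable coefficients make the series converge uniformly to some continuous
  periodic \<open>S\<close>. Coefficients are continuous for uniform convergence, so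
  \<open>S\<close> has the coefficients of \<open>\<psi>\<close>, and injectivity of the Fourier
  transform identifies the two.\<close>

lemma uniform_limit_fourier_series:
  fixes \<psi> :: "'n::finite torus_test"
  shows "uniform_limit UNIV (\<lambda>F x. \<Sum>\<xi>\<in>F. tcoef \<psi> \<xi> * Rep_torus_test (wave \<xi>) x)
    (Rep_torus_test \<psi>) (finite_subsets_at_top UNIV)"
proof -
  let ?t = "\<lambda>\<xi> x. tcoef \<psi> \<xi> * Rep_torus_test (wave \<xi>) x"
  define S where "S x = (\<Sum>\<^sub>\<infinity>\<xi>. ?t \<xi> x)" for x
  have lim: "uniform_limit UNIV (\<lambda>F x. \<Sum>\<xi>\<in>F. ?t \<xi> x) S (finite_subsets_at_top UNIV)"
    unfolding S_def
    by (rule Weierstrass_m_test_general[OF _ tcoef_abs_summable[of \<psi>]])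
      (simp add: norm_mult wave.rep_eq)
  have cont_sum: "continuous_on UNIV (\<lambda>x. \<Sum>\<xi>\<in>F. ?t \<xi> x)" for F
    by (intro continuous_intros)
  have cont: "continuous_on UNIV S"
    by (rule uniform_limit_theorem[OF _ lim]) (simp_all add: cont_sum)
  have cont\<psi>: "continuous_on UNIV (Rep_torus_test \<psi>)"
    using continuous_on_Rep_test[OF continuous_on_id] .
  have "Rep_torus_test (wave \<xi>) (x + (2 * pi) *\<^sub>R axis j 1) = Rep_torus_test (wave \<xi>) x"
    for \<xi> x and j :: 'n
    using Rep_torus_test_props(2) unfolding torus_periodic_def by blast
  then have per: "torus_periodic S"
    unfolding S_def torus_periodic_def by simp
  have coef: "fcoef (\<lambda>x. Rep_torus_test \<psi> x + (- 1) * S x) \<xi> = 0" for \<xi>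
  proof -
    have fcoef_sum: "fcoef (\<lambda>x. \<Sum>\<eta>\<in>F. ?t \<eta> x) \<xi> = (\<Sum>\<eta>\<in>F. tcoef \<psi> \<eta> * of_bool (\<xi> = \<eta>))"
      if "finite F" for F
      using that
    proof (induction F)
      case empty
      then show ?case by (simp add: fcoef_def)
    next
      case (insert \<eta> F)
      then show ?case
        by simp (subst fcoef_add, auto intro!: continuous_intros simp: fcoef_scale fcoef_wave)
    qed
    \<comment> \<open>The partial sum is taken over an \<open>F\<close> that is close to
      \<open>S\<close> and also contains \<open>\<xi>\<close>; its coefficient at
      \<open>\<xi>\<close> is then exactly that of \<open>\<psi>\<close>.\<close>
    have "norm (tcoef \<psi> \<xi> - fcoef S \<xi>) \<le> e" if "e > 0" for e
    proof -
      have "\<forall>\<^sub>F F in finite_subsets_at_top UNIV. finite F \<and> \<xi> \<in> F"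
        by (auto simp: eventually_finite_subsets_at_top intro!: exI[of _ "{\<xi>}"])
      from eventually_happens'[OF _ eventually_conj[OF uniform_limitD[OF lim that] this]]
      obtain F where F: "finite F" "\<xi> \<in> F" "\<And>x. dist (\<Sum>\<xi>\<in>F. ?t \<xi> x) (S x) < e"
        by auto
      have "tcoef \<psi> \<xi> - fcoef S \<xi> = fcoef (\<lambda>x. (\<Sum>\<xi>\<in>F. ?t \<xi> x) + (- 1) * S x) \<xi>"
        by (subst fcoef_add)
          (use F(1,2) in \<open>auto intro!: continuous_intros cont simp: fcoef_sum fcoef_scale[of "- 1", simplified]\<close>)
      also have "norm \<dots> \<le> e"
        by (rule norm_fcoef_le)
          (use F(3) in \<open>auto intro!: continuous_intros cont less_imp_le simp: dist_norm\<close>)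
      finally show ?thesis .
    qed
    then have "tcoef \<psi> \<xi> - fcoef S \<xi> = 0"
      by (metis dense_eq0_I norm_eq_zero abs_norm_cancel)
    then show ?thesis
      by (subst fcoef_add)
        (auto intro!: continuous_intros cont cont\<psi> simp: fcoef_scale[of "- 1", simplified])
  qed
  have "Rep_torus_test \<psi> x + (- 1) * S x = 0" for x
    by (rule fcoef_eq_zero_imp_zero[OF _ _ coef])
      (use per Rep_torus_test_props(2)[of \<psi>] in
        \<open>auto intro!: continuous_intros cont cont\<psi> simp: torus_periodic_def\<close>)
  then have "S = Rep_torus_test \<psi>" by (simp add: fun_eq_iff)
  with lim show ?thesis by simp
qed

section \<open>Fourier series of distributions\<close>

lemma distributionsD:
  assumes "u \<in> distributions"
  shows "u (test_add \<phi> \<psi>) = u \<phi> + u \<psi>" "u (test_scale c \<psi>) = c * u \<psi>"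
    and "\<exists>m C. \<forall>\<psi>. norm (u \<psi>) \<le> C * test_seminorm m \<psi>"
  using assms unfolding distributions_def by auto

text \<open>The Fourier remainder is needed as an element of \<open>torus_test\<close>, so it is
  built up from \<open>test_add\<close> and \<open>test_scale\<close> along \<open>F\<close>.
  Differentiating it gives the remainder of the differentiated function, as both
  \<open>tcoef\<close> and \<open>wave\<close> pick up the same factor.\<close>

lemma ex_fourier_remainder:
  fixes \<psi> :: "'n::finite torus_test"
  assumes "finite F"
  shows "\<exists>p. (\<forall>js x. Rep_torus_test (foldr test_pderiv js p) x
      = Rep_torus_test (foldr test_pderiv js \<psi>) x
        - (\<Sum>\<xi>\<in>F. tcoef (foldr test_pderiv js \<psi>) \<xi> * Rep_torus_test (wave \<xi>) x)) \<and>
    (\<forall>u\<in>distributions. u p = u \<psi> - (\<Sum>\<xi>\<in>F. tcoef \<psi> \<xi> * u (wave \<xi>)))"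
  using assms
proof (induction F)
  case (insert \<eta> F)
  then obtain p where p: "\<And>js x. Rep_torus_test (foldr test_pderiv js p) x
      = Rep_torus_test (foldr test_pderiv js \<psi>) x
        - (\<Sum>\<xi>\<in>F. tcoef (foldr test_pderiv js \<psi>) \<xi> * Rep_torus_test (wave \<xi>) x)"
    "\<And>u. u \<in> distributions \<Longrightarrow> u p = u \<psi> - (\<Sum>\<xi>\<in>F. tcoef \<psi> \<xi> * u (wave \<xi>))"
    by blast
  let ?p = "test_add p (test_scale (- tcoef \<psi> \<eta>) (wave \<eta>))"
  have Rep_foldr: "Rep_torus_test (foldr test_pderiv js \<theta>) = foldr pderiv_at js (Rep_torus_test \<theta>)"
    for js and \<theta> :: "'n torus_test"
    by (induction js) (simp_all add: test_pderiv.rep_eq)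
  have "Rep_torus_test (foldr test_pderiv js ?p) x
      = Rep_torus_test (foldr test_pderiv js p) x
        - tcoef \<psi> \<eta> * Rep_torus_test (foldr test_pderiv js (wave \<eta>)) x" for js x
    unfolding Rep_foldr test_add.rep_eq test_scale.rep_eq
    using foldr_pderiv_at_scale[of "Rep_torus_test (wave \<eta>)" js "- tcoef \<psi> \<eta>"]
      foldr_pderiv_at_add[OF Rep_torus_test_props(1)[of p] smooth_fun_scale[OF
        Rep_torus_test_props(1)[of "wave \<eta>"], of "- tcoef \<psi> \<eta>"], of js]
    by simp
  then show ?case
    using insert.hyps p
    by (intro exI[of _ ?p]) (simp add: foldr_pderiv_wave tcoef_pderivs distributionsD)
qed (rule exI[of _ \<psi>], simp)

text \<open>The bound on \<open>u\<close> involves only the finitely many derivatives of order at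
  most \<open>m\<close>. The Fourier series of each of them converges uniformly, so the remainder
  becomes small in \<open>test_seminorm m\<close>, and so does its image under
  \<open>u\<close>.\<close>

lemma distribution_fourier_series:
  fixes u :: "'n::finite torus_functional"
  assumes u: "u \<in> distributions"
  shows "((\<lambda>\<xi>. tcoef \<psi> \<xi> * u (wave \<xi>)) has_sum u \<psi>) UNIV"
proof -
  obtain m C where C: "\<And>\<psi>. norm (u \<psi>) \<le> C * test_seminorm m \<psi>"
    using distributionsD(3)[OF u] by blast
  let ?J = "{js :: 'n list. length js \<le> m}"
  have "((\<lambda>F. \<Sum>\<xi>\<in>F. tcoef \<psi> \<xi> * u (wave \<xi>)) \<longlongrightarrow> u \<psi>) (finite_subsets_at_top UNIV)"
  proof (rule tendstoI)
    fix e :: real assume e: "e > 0"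
    \<comment> \<open>The seminorm is a sum of \<open>card ?J\<close> suprema, each at most
      \<open>e / K\<close>; the summand \<open>1\<close> keeps \<open>K\<close> positive and makes
      the final estimate strict.\<close>
    define K where "K = \<bar>C\<bar> * card ?J + 1"
    have K: "K > 0" by (simp add: K_def add_nonneg_pos)
    have "\<forall>\<^sub>F F in finite_subsets_at_top UNIV. \<forall>js\<in>?J. \<forall>x\<in>UNIV.
        dist (\<Sum>\<xi>\<in>F. tcoef (foldr test_pderiv js \<psi>) \<xi> * Rep_torus_test (wave \<xi>) x)
          (Rep_torus_test (foldr test_pderiv js \<psi>) x) < e / K"
      by (intro eventually_ball_finite finite_short_lists ballI
          uniform_limitD[OF uniform_limit_fourier_series]) (use e K in auto)
    moreover have "\<forall>\<^sub>F F in finite_subsets_at_top (UNIV :: (int^'n) set). finite F"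
      by (simp add: eventually_finite_subsets_at_top_weakI)
    ultimately show "\<forall>\<^sub>F F in finite_subsets_at_top UNIV.
        dist (\<Sum>\<xi>\<in>F. tcoef \<psi> \<xi> * u (wave \<xi>)) (u \<psi>) < e"
    proof eventually_elim
      case (elim F)
      obtain p where p: "\<And>js x. Rep_torus_test (foldr test_pderiv js p) x
          = Rep_torus_test (foldr test_pderiv js \<psi>) x
            - (\<Sum>\<xi>\<in>F. tcoef (foldr test_pderiv js \<psi>) \<xi> * Rep_torus_test (wave \<xi>) x)"
        "u p = u \<psi> - (\<Sum>\<xi>\<in>F. tcoef \<psi> \<xi> * u (wave \<xi>))"
        using ex_fourier_remainder[OF elim(2), of \<psi>] u by blast
      have "test_seminorm m p \<le> (\<Sum>js\<in>?J. e / K)"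
        unfolding test_seminorm_def
      proof (intro sum_mono cSUP_least)
        fix js :: "'n list" and x :: "real ^ 'n"
        assume "js \<in> ?J"
        then show "norm (Rep_torus_test (foldr test_pderiv js p) x) \<le> e / K"
          using elim(1) by (auto simp: p(1) dist_norm norm_minus_commute intro: less_imp_le)
      qed simp
      then have "\<bar>C\<bar> * test_seminorm m p \<le> \<bar>C\<bar> * (card ?J * (e / K))"
        by (intro mult_left_mono) auto
      moreover have "C * test_seminorm m p \<le> \<bar>C\<bar> * test_seminorm m p"
        by (intro mult_right_mono test_seminorm_nonneg) auto
      moreover have "\<bar>C\<bar> * (card ?J * (e / K)) < e"
        using e K by (simp add: field_simps) (simp add: K_def algebra_simps)
      ultimately have "norm (u p) < e" using C[of p] by linarith
      then show ?case by (simp add: p(2) dist_norm norm_minus_commute)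
    qed
  qed
  then show ?thesis by (simp add: has_sum_def)
qed

lemma distributions_eqI:
  fixes u v :: "'n::finite torus_functional"
  assumes "u \<in> distributions" "v \<in> distributions" "\<And>\<xi>. u (wave \<xi>) = v (wave \<xi>)"
  shows "u = v"
proof
  fix \<psi>
  show "u \<psi> = v \<psi>"
    using distribution_fourier_series[OF assms(1), of \<psi>] distribution_fourier_series[OF assms(2), of \<psi>]
    by (simp add: assms(3) has_sum_unique)
qed

section \<open>Bump functions and weak derivatives\<close>

text \<open>The flat function \<open>exp (- 1/x)\<close>, extended by zero, with a polynomial in
  \<open>1/x\<close> carried along so that the family is closed under differentiation.\<close>

definition flat_exp :: "real poly \<Rightarrow> real \<Rightarrow> real" where
  "flat_exp p x = (if x > 0 then poly p (1 / x) * exp (- (1 / x)) else 0)"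

lemma poly_exp_tendsto_0: "((\<lambda>y. poly p y * exp (- y)) \<longlongrightarrow> (0::real)) at_top"
proof -
  have "((\<lambda>y. \<Sum>i\<le>degree p. coeff p i * (y ^ i / exp y)) \<longlongrightarrow> (\<Sum>i\<le>degree p. coeff p i * 0)) at_top"
    by (intro tendsto_intros tendsto_power_div_exp_0)
  then show ?thesis
    by (simp add: poly_altdef exp_minus sum_distrib_right divide_inverse mult.assoc)
qed

lemma flat_exp_tendsto_0: "(flat_exp p \<longlongrightarrow> 0) (at_right 0)"
proof -
  have "((\<lambda>x. poly p (inverse x) * exp (- inverse x)) \<longlongrightarrow> 0) (at_right 0)"
    by (rule filterlim_compose[OF poly_exp_tendsto_0 filterlim_inverse_at_top_right])
  then show ?thesis
    by (rule Lim_transform_eventually)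
      (auto simp: flat_exp_def eventually_at_right_field inverse_eq_divide intro: exI[of _ 1])
qed

text \<open>With \<open>y = 1/x\<close>, the derivative of \<open>p(y) * exp (- y)\<close> is
  \<open>- y^2 * (p'(y) - p(y)) * exp (- y)\<close>, which explains the new polynomial.\<close>

lemma has_real_derivative_flat_exp:
  "(flat_exp p has_real_derivative flat_exp (monom 1 2 * (p - Polynomial.pderiv p)) x) (at x)"
proof -
  consider "x > 0" | "x < 0" | "x = 0" by linarith
  then show ?thesis
  proof cases
    case 1
    have inv: "((\<lambda>x. 1 / x) has_real_derivative - (1 / x\<^sup>2)) (at x)"
      using 1 by (auto intro!: derivative_eq_intros simp: power2_eq_square)
    have "((\<lambda>x. poly p (1 / x) * exp (- (1 / x))) has_real_derivative
        flat_exp (monom 1 2 * (p - Polynomial.pderiv p)) x) (at x)"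
      using 1 by (intro DERIV_cong[OF DERIV_mult[OF DERIV_chain2[OF poly_DERIV inv]
            DERIV_chain2[OF DERIV_exp DERIV_minus[OF inv]]]])
        (simp add: flat_exp_def poly_monom power_one_over algebra_simps)
    then show ?thesis
      by (rule has_field_derivative_transform_within_open[of _ _ _ "{0<..}"])
        (use 1 in \<open>auto simp: flat_exp_def\<close>)
  next
    case 2
    have "((\<lambda>x. 0) has_real_derivative 0) (at x)" by simp
    then show ?thesis
      using has_field_derivative_transform_within_open[of "\<lambda>x. 0" 0 x "{..<0}" "flat_exp p"] 2
      by (auto simp: flat_exp_def)
  next
    case 3
    \<comment> \<open>Dividing by \<open>h\<close> multiplies the polynomial by its variable, so the
      difference quotient is again a \<open>flat_exp\<close> and tends to zero.\<close>
    have "((\<lambda>h. (flat_exp p h - flat_exp p 0) / (h - 0)) \<longlongrightarrow> 0) (at_right 0)"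
      by (rule Lim_transform_eventually[OF flat_exp_tendsto_0[of "monom 1 1 * p"]])
        (auto simp: flat_exp_def eventually_at_right_field poly_monom intro: exI[of _ 1])
    moreover have "((\<lambda>h. (flat_exp p h - flat_exp p 0) / (h - 0)) \<longlongrightarrow> 0) (at_left 0)"
      by (rule Lim_transform_eventually[OF tendsto_const])
        (auto simp: flat_exp_def eventually_at_left_field intro: exI[of _ "-1"])
    ultimately show ?thesis
      using 3 by (simp add: has_field_derivative_iff filterlim_split_at flat_exp_def)
  qed
qed

lemma continuous_on_flat_exp [continuous_intros]:
  "continuous_on S g \<Longrightarrow> continuous_on S (\<lambda>x. flat_exp p (g x))"
  by (rule continuous_on_compose2[of UNIV "flat_exp p"])
    (auto intro!: DERIV_continuous_on has_real_derivative_flat_exp[THEN DERIV_subset])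

text \<open>A class that contains its own derivatives, so that all of its members are smooth by
  induction. The product rule produces sums, hence the rule \<open>add\<close>;
  \<open>p = q = 1\<close> gives a bump positive exactly on the open interval.\<close>

inductive bump_fun :: "real \<Rightarrow> real \<Rightarrow> (real \<Rightarrow> complex) \<Rightarrow> bool" for a b where
  base: "bump_fun a b (\<lambda>x. complex_of_real (flat_exp p (x - a) * flat_exp q (b - x)))"
| add: "bump_fun a b f \<Longrightarrow> bump_fun a b g \<Longrightarrow> bump_fun a b (\<lambda>x. f x + g x)"

lemma bump_fun_support: "bump_fun a b f \<Longrightarrow> x \<notin> {a<..<b} \<Longrightarrow> f x = 0"
  by (induction rule: bump_fun.induct) (auto simp: flat_exp_def)

lemma bump_fun_deriv:
  "bump_fun a b f \<Longrightarrow> \<exists>f'. bump_fun a b f' \<and> (\<forall>x. (f has_vector_derivative f' x) (at x))"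
proof (induction rule: bump_fun.induct)
  case (base p q)
  let ?D = "\<lambda>p. monom 1 2 * (p - Polynomial.pderiv p)"
  \<comment> \<open>The sign from differentiating \<open>b - x\<close> is absorbed in the
    polynomial, since \<open>bump_fun\<close> has no rule for scalar multiples.\<close>
  let ?f' = "\<lambda>x. complex_of_real (flat_exp (?D p) (x - a) * flat_exp q (b - x))
      + complex_of_real (flat_exp p (x - a) * flat_exp (- ?D q) (b - x))"
  have "((\<lambda>x. complex_of_real (flat_exp p (x - a) * flat_exp q (b - x))) has_vector_derivative ?f' x)
      (at x)" for x
  proof -
    have 1: "((\<lambda>x. flat_exp p (x - a)) has_real_derivative flat_exp (?D p) (x - a) * 1) (at x)"
      by (rule DERIV_chain2[OF has_real_derivative_flat_exp]) (auto intro!: derivative_eq_intros)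
    have 2: "((\<lambda>x. flat_exp q (b - x)) has_real_derivative flat_exp (?D q) (b - x) * (- 1)) (at x)"
      by (rule DERIV_chain2[OF has_real_derivative_flat_exp]) (auto intro!: derivative_eq_intros)
    have "flat_exp (- r) y = - flat_exp r y" for r y by (simp add: flat_exp_def)
    then have "((\<lambda>x. flat_exp p (x - a) * flat_exp q (b - x)) has_real_derivative
       flat_exp (?D p) (x - a) * flat_exp q (b - x) + flat_exp p (x - a) * flat_exp (- ?D q) (b - x)) (at x)"
      by (intro DERIV_cong[OF DERIV_mult[OF 1 2]]) simp
    from has_vector_derivative_of_real[OF this] show ?thesis by simp
  qed
  moreover have "bump_fun a b ?f'" by (intro bump_fun.intros)
  ultimately show ?case by blast
next
  case (add f g)
  then obtain f' g' where "bump_fun a b f'" "\<And>x. (f has_vector_derivative f' x) (at x)"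
    "bump_fun a b g'" "\<And>x. (g has_vector_derivative g' x) (at x)" by blast
  then show ?case
    by (intro exI[of _ "\<lambda>x. f' x + g' x"] conjI allI bump_fun.add has_vector_derivative_add)
qed

lemma bump_fun_higher_deriv:
  "bump_fun a b f \<Longrightarrow> bump_fun a b (((\<lambda>h s. vector_derivative h (at s)) ^^ k) f)"
proof (induction k)
  case (Suc k)
  then obtain f' where f': "bump_fun a b f'"
    "\<And>x. ((((\<lambda>h s. vector_derivative h (at s)) ^^ k) f) has_vector_derivative f' x) (at x)"
    using bump_fun_deriv by blast
  then have "((\<lambda>h s. vector_derivative h (at s)) ^^ Suc k) f = f'"
    by (auto simp: fun_eq_iff vector_derivative_at)
  with f' show ?case by simp
qed simp

lemma bump_fun_time_test:
  assumes "bump_fun a b f" "0 < a" "b < T"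
  shows "f \<in> time_test T"
proof -
  have "((\<lambda>h s. vector_derivative h (at s)) ^^ k) f differentiable (at t)" for k t
    using bump_fun_deriv[OF bump_fun_higher_deriv[OF assms(1)], of k]
    by (auto intro: differentiableI_vector)
  moreover have "t \<in> {a..b}" if "f t \<noteq> 0" for t
    using bump_fun_support[OF assms(1), of t] that by (cases "t \<in> {a<..<b}") auto
  then have "{t. f t \<noteq> 0} \<subseteq> {a..b}" by blast
  then have "closure {t. f t \<noteq> 0} \<subseteq> {a..b}" by (rule closure_minimal) simp
  moreover from this have "compact (closure {t. f t \<noteq> 0})"
    using bounded_subset[OF bounded_closed_interval] by (simp add: compact_eq_bounded_closed)
  ultimately show ?thesis
    using assms(2,3) by (fastforce simp: time_test_def)
qed

section \<open>Weak derivatives in time\<close>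

lemma time_test_zero:
  assumes "\<phi> \<in> time_test T" "t \<notin> {0<..<T}"
  shows "\<phi> t = 0"
  using assms closure_subset[of "{t. \<phi> t \<noteq> 0}"] by (auto simp: time_test_def)

lemma time_test_deriv:
  assumes "\<phi> \<in> time_test T"
  shows "(\<phi> has_vector_derivative vector_derivative \<phi> (at t)) (at t within S)"
    and "continuous_on S \<phi>" and "continuous_on S (\<lambda>t. vector_derivative \<phi> (at t))"
proof -
  have d: "((\<lambda>h s. vector_derivative h (at s)) ^^ k) \<phi> differentiable (at t)" for k t
    using assms by (simp add: time_test_def)
  have "\<phi> differentiable (at t)" for t using d[of 0] by simp
  then show "(\<phi> has_vector_derivative vector_derivative \<phi> (at t)) (at t within S)"
    and "continuous_on S \<phi>"
    by (auto simp: vector_derivative_works[symmetric] has_vector_derivative_at_within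
        intro!: continuous_at_imp_continuous_on differentiable_imp_continuous_within)
  have "(\<lambda>t. vector_derivative \<phi> (at t)) differentiable (at t)" for t using d[of 1] by simp
  then show "continuous_on S (\<lambda>t. vector_derivative \<phi> (at t))"
    by (auto intro!: continuous_at_imp_continuous_on differentiable_imp_continuous_within)
qed

text \<open>The boundary terms vanish because \<open>\<phi>\<close> has compact support in \<open>(0,T)\<close>.\<close>

lemma time_test_integral_by_parts:
  assumes "T > 0" "\<phi> \<in> time_test T" "continuous_on {0..T} y'"
    and y: "\<And>t. t \<in> {0..T} \<Longrightarrow> (y has_vector_derivative y' t) (at t within {0..T})"
  shows "integral {0..T} (\<lambda>t. y t * vector_derivative \<phi> (at t)) = - integral {0..T} (\<lambda>t. y' t * \<phi> t)"
proof -
  have "continuous_on {0..T} y"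
    using has_vector_derivative_continuous[OF y] by (simp add: continuous_on_eq_continuous_within)
  then have int: "(\<lambda>t. y t * vector_derivative \<phi> (at t)) integrable_on {0..T}"
      "(\<lambda>t. y' t * \<phi> t) integrable_on {0..T}"
    using assms(3) time_test_deriv(2,3)[OF assms(2)]
    by (auto intro!: integrable_continuous_real continuous_intros)
  have "((\<lambda>t. y t * vector_derivative \<phi> (at t) + y' t * \<phi> t) has_integral (y T * \<phi> T - y 0 * \<phi> 0)) {0..T}"
    by (rule fundamental_theorem_of_calculus)
      (use assms(1) in \<open>auto intro!: has_vector_derivative_mult y time_test_deriv(1)[OF assms(2)]\<close>)
  then have "integral {0..T} (\<lambda>t. y t * vector_derivative \<phi> (at t) + y' t * \<phi> t) = 0"
    using time_test_zero[OF assms(2)] by (simp add: integral_unique)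
  then show ?thesis
    by (subst (asm) integral_add[OF int]) (simp add: eq_neg_iff_add_eq_0)
qed

text \<open>Differentiating the integral of \<open>z x * b (x - s)\<close> in \<open>s\<close> moves
  the derivative onto the bump. For \<open>s\<close> in \<open>(0, T - e)\<close> the translated
  bump is an admissible test function, so this derivative vanishes and the integral is
  constant.\<close>

lemma bump_translate_integral:
  fixes z :: "real \<Rightarrow> complex"
  assumes z: "continuous_on {0..T} z"
    and weak: "\<And>\<phi>. \<phi> \<in> time_test T \<Longrightarrow> integral {0..T} (\<lambda>t. z t * vector_derivative \<phi> (at t)) = 0"
    and st: "s \<in> {0<..<T - e}" "t \<in> {0<..<T - e}"
  shows "integral {0..T} (\<lambda>x. z x * complex_of_real (flat_exp 1 (x - s) * flat_exp 1 (s + e - x)))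
    = integral {0..T} (\<lambda>x. z x * complex_of_real (flat_exp 1 (x - t) * flat_exp 1 (t + e - x)))"
proof -
  define b where "b x = complex_of_real (flat_exp 1 (x - 0) * flat_exp 1 (e - x))" for x
  have "bump_fun 0 e b" unfolding b_def by (rule bump_fun.base)
  then obtain b' where b': "bump_fun 0 e b'" "\<And>x. (b has_vector_derivative b' x) (at x)"
    using bump_fun_deriv by blast
  have cb: "continuous_on UNIV b" "continuous_on UNIV b'"
    using b' bump_fun_deriv[OF b'(1)]
    by (meson has_vector_derivative_continuous continuous_at_imp_continuous_on)+
  have shift: "((\<lambda>s. b (x - s)) has_vector_derivative - b' (x - s)) (at s within U)"
    and shift': "((\<lambda>x. b (x - s)) has_vector_derivative b' (x - s)) (at x)" for x s U
  proof -
    have "((\<lambda>s. x - s) has_vector_derivative - 1) (at s within U)"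
      by (auto intro!: derivative_eq_intros)
    from vector_diff_chain_within[OF this has_vector_derivative_at_within[OF b'(2)]]
    show "((\<lambda>s. b (x - s)) has_vector_derivative - b' (x - s)) (at s within U)"
      by (simp add: o_def)
    have "((\<lambda>x. x - s) has_vector_derivative 1) (at x)"
      by (auto intro!: derivative_eq_intros)
    from vector_diff_chain_within[OF this has_vector_derivative_at_within[OF b'(2)]]
    show "((\<lambda>x. b (x - s)) has_vector_derivative b' (x - s)) (at x)"
      by (simp add: o_def)
  qed
  let ?J = "\<lambda>s. integral (cbox 0 T) (\<lambda>x. z x * b (x - s))"
  let ?U = "{0<..<T - e}"
  have "(?J has_vector_derivative integral (cbox 0 T) (\<lambda>x. z x * (- b' (x - s)))) (at s within ?U)"
    if "s \<in> ?U" for s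
  proof (rule leibniz_rule_vector_derivative)
    show "((\<lambda>s. z x * b (x - s)) has_vector_derivative z x * (- b' (x - s))) (at s within ?U)" for s x
      by (intro has_vector_derivative_mult_right shift)
    show "(\<lambda>x. z x * b (x - s)) integrable_on cbox 0 T" for s
      using z by (intro integrable_continuous continuous_intros continuous_on_compose2[OF cb(1)]) auto
    show "continuous_on (?U \<times> cbox 0 T) (\<lambda>(s, x). z x * (- b' (x - s)))"
      unfolding split_beta
      by (intro continuous_intros continuous_on_compose2[OF cb(2)] continuous_on_compose2[OF z]) auto
  qed (use that in auto)
  moreover have "integral (cbox 0 T) (\<lambda>x. z x * (- b' (x - s))) = 0" if "s \<in> ?U" for s
  proof -
    have "bump_fun s (s + e) (\<lambda>x. b (x - s))"
      using bump_fun.base[of s "s + e" 1 1] by (simp add: b_def algebra_simps)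
    then have "(\<lambda>x. b (x - s)) \<in> time_test T"
      using that by (intro bump_fun_time_test) auto
    from weak[OF this] show ?thesis
      by (simp add: vector_derivative_at[OF shift'])
  qed
  ultimately have "(?J has_derivative (\<lambda>h. 0)) (at s within ?U)" if "s \<in> ?U" for s
    using that by (fastforce simp: has_vector_derivative_def)
  then have "\<exists>c. \<forall>s\<in>?U. ?J s = c"
    by (intro has_derivative_zero_constant) auto
  then have "?J s = ?J t" using st by metis
  then show ?thesis by (simp add: b_def algebra_simps)
qed

text \<open>Du Bois-Reymond: concentrating the bump at two points compares the values there.\<close>

lemma weak_derivative_zero_imp_constant:
  fixes z :: "real \<Rightarrow> complex"
  assumes T: "T > 0" and z: "continuous_on {0..T} z"
    and weak: "\<And>\<phi>. \<phi> \<in> time_test T \<Longrightarrow> integral {0..T} (\<lambda>t. z t * vector_derivative \<phi> (at t)) = 0"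
    and st: "s \<in> {0<..<T}" "t \<in> {0<..<T}"
  shows "z s = z t"
proof -
  have "norm (z s - z t) \<le> 2 * \<eta>" if \<eta>: "\<eta> > 0" for \<eta>
  proof -
    have near: "\<exists>d>0. \<forall>x\<in>{0..T}. \<bar>x - s\<bar> < d \<longrightarrow> norm (z x - z s) \<le> \<eta>" if "s \<in> {0<..<T}" for s
    proof -
      have "s \<in> {0..T}" using that by simp
      then obtain d where "d > 0" "\<forall>x\<in>{0..T}. dist x s < d \<longrightarrow> dist (z x) (z s) < \<eta>"
        using z \<eta> unfolding continuous_on_iff by metis
      then show ?thesis by (intro exI[of _ d]) (force simp: dist_norm)
    qed
    obtain d1 d2 where d: "d1 > 0" "d2 > 0"
      "\<And>x. x \<in> {0..T} \<Longrightarrow> \<bar>x - s\<bar> < d1 \<Longrightarrow> norm (z x - z s) \<le> \<eta>"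
      "\<And>x. x \<in> {0..T} \<Longrightarrow> \<bar>x - t\<bar> < d2 \<Longrightarrow> norm (z x - z t) \<le> \<eta>"
      using near[OF st(1)] near[OF st(2)] by blast
    \<comment> \<open>Small enough that both bumps see only values of \<open>z\<close> within
      \<open>\<eta>\<close> of their reference value and stay inside \<open>(0,T)\<close>; halving
      makes the inequalities strict.\<close>
    define e where "e = Min {d1, d2, T - s, T - t} / 2"
    have e: "e > 0" "e < d1" "e < d2" "s + e < T" "t + e < T"
      using d(1,2) st by (auto simp: e_def min_def field_simps)
    let ?b = "\<lambda>s x. flat_exp 1 (x - s) * flat_exp 1 (s + e - x)"
    have b_cont: "continuous_on A (?b s)" for A s by (intro continuous_intros)
    define I where "I s = integral {0..T} (?b s)" for s
    have of_real_I: "complex_of_real (I s) = integral {0..T} (\<lambda>x. complex_of_real (?b s x))" for s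
      unfolding I_def
      by (rule integral_linear[OF _ bounded_linear_of_real, unfolded o_def, symmetric])
        (intro integrable_continuous_real b_cont)
    have close: "norm (integral {0..T} (\<lambda>x. z x * complex_of_real (?b s x)) - z s * I s) \<le> \<eta> * I s"
      if near: "\<And>x. x \<in> {0..T} \<Longrightarrow> \<bar>x - s\<bar> < d \<Longrightarrow> norm (z x - z s) \<le> \<eta>" and "e < d" for s d
    proof -
      have "integral {0..T} (\<lambda>x. z x * complex_of_real (?b s x)) - z s * I s
          = integral {0..T} (\<lambda>x. z x * complex_of_real (?b s x) - z s * complex_of_real (?b s x))"
        unfolding of_real_I
        by (subst integral_diff)
          (auto intro!: integrable_continuous_real continuous_intros b_cont z
            simp del: of_real_mult)
      also have "norm \<dots> \<le> integral {0..T} (\<lambda>x. \<eta> * ?b s x)"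
      proof (rule integral_norm_bound_integral)
        fix x assume x: "x \<in> {0..T}"
        have "norm ((z x - z s) * complex_of_real (?b s x)) \<le> \<eta> * ?b s x"
        proof (cases "s < x \<and> x < s + e")
          case True
          then have "norm (z x - z s) \<le> \<eta>" using near[OF x] \<open>e < d\<close> by simp
          moreover have "?b s x \<ge> 0" by (simp add: flat_exp_def)
          ultimately show ?thesis
            by (simp add: norm_mult abs_mult flat_exp_def mult_right_mono)
        qed (auto simp: flat_exp_def)
        then show "norm (z x * complex_of_real (?b s x) - z s * complex_of_real (?b s x)) \<le> \<eta> * ?b s x"
          by (simp add: left_diff_distrib)
      qed (auto intro!: integrable_continuous_real continuous_intros z)
      also have "\<dots> = \<eta> * I s" by (simp add: I_def)
      finally show ?thesis .
    qed
    have "I s > 0"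
    proof -
      have "I s \<ge> 0" unfolding I_def
        by (intro integral_nonneg integrable_continuous_real b_cont) (simp add: flat_exp_def)
      moreover have "I s \<noteq> 0"
      proof
        assume "I s = 0"
        then have "(?b s has_integral 0) (cbox 0 T)"
          using integrable_integral[OF integrable_continuous_real[OF b_cont[of "{0..T}" s]]]
          by (simp add: I_def)
        then have "?b s (s + e / 2) = 0"
          by (rule has_integral_0_cbox_imp_0[OF b_cont, rotated])
            (use T st e in \<open>auto simp: flat_exp_def\<close>)
        then show False using e by (simp add: flat_exp_def)
      qed
      ultimately show ?thesis by simp
    qed
    have "s \<in> {0<..<T - e}" "t \<in> {0<..<T - e}" using st e by auto
    note J = bump_translate_integral[OF _ _ this]
    \<comment> \<open>The constant function \<open>1\<close> also has weak derivative zero, so the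
      same translation argument shows that the two bumps have equal mass.\<close>
    have "integral {0..T} (\<lambda>t. 1 * vector_derivative \<phi> (at t)) = 0" if "\<phi> \<in> time_test T" for \<phi>
      using time_test_integral_by_parts[OF T that, of "\<lambda>_. 0" "\<lambda>_. 1"] by simp
    from J[OF continuous_on_const this] have "complex_of_real (I s) = complex_of_real (I t)"
      unfolding of_real_I by (simp only: mult_1_left)
    then have I: "I s = I t" by simp
    define A where "A s = integral {0..T} (\<lambda>x. z x * complex_of_real (?b s x))" for s
    have "A s = A t" unfolding A_def by (rule J[OF z weak])
    moreover have "norm (A s - z s * I s) \<le> \<eta> * I s"
      unfolding A_def by (rule close[where d = d1], fact d(3), fact e(2))
    moreover have "norm (A t - z t * I t) \<le> \<eta> * I t"
      unfolding A_def by (rule close[where d = d2], fact d(4), fact e(3))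
    ultimately have "norm (z s * I s - z t * I s) \<le> \<eta> * I s + \<eta> * I s"
      unfolding I by (intro norm_diff_triangle_le[of _ "A t"]) (simp_all add: norm_minus_commute)
    then have "norm (z s - z t) * I s \<le> (2 * \<eta>) * I s"
      using \<open>I s > 0\<close> by (simp add: norm_mult flip: left_diff_distrib)
    then show ?thesis using \<open>I s > 0\<close> by (simp only: mult_le_cancel_right)
  qed
  \<comment> \<open>For distinct values this choice would bound their distance by half of
    itself.\<close>
  from this[of "norm (z s - z t) / 4"] show ?thesis
    by (cases "z s = z t") auto
qed

section \<open>The scalar Cauchy problem\<close>

lemma integrating_factor_deriv:
  fixes p :: "real \<Rightarrow> complex"
  assumes "continuous_on {0..T} p" "t \<in> {0..T}"
  shows "((\<lambda>t. exp (c * integral {0..t} p)) has_vector_derivative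
    c * p t * exp (c * integral {0..t} p)) (at t within {0..T})"
proof -
  have "((\<lambda>t. c * integral {0..t} p) has_vector_derivative c * p t) (at t within {0..T})"
    by (intro has_vector_derivative_mult_right integral_has_vector_derivative assms)
  from field_vector_diff_chain_within[OF this DERIV_exp[THEN has_field_derivative_at_within]]
  show ?thesis by (simp add: o_def)
qed

text \<open>As \<open>y\<close> is only continuous, the equation is first integrated: with
  \<open>Q\<close> a primitive of \<open>p * y\<close>, the function \<open>\<i> * y - Q\<close> has
  weak derivative zero and vanishes at \<open>0\<close>. Hence \<open>y = - \<i> * Q\<close>, so
  \<open>Q\<close> solves a classical homogeneous equation, which the integrating factor
  resolves.\<close>

lemma weak_ode_unique:
  fixes y p :: "real \<Rightarrow> complex"
  assumes T: "T > 0" and y: "continuous_on {0..T} y" "y 0 = 0" and p: "continuous_on {0..T} p"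
    and weak: "\<And>\<phi>. \<phi> \<in> time_test T \<Longrightarrow>
      integral {0..T} (\<lambda>t. y t * (- ((1 / \<i>) * vector_derivative \<phi> (at t))))
        + integral {0..T} (\<lambda>t. p t * y t * \<phi> t) = 0"
    and t: "t \<in> {0..T}"
  shows "y t = 0"
proof -
  define Q where "Q t = integral {0..t} (\<lambda>s. p s * y s)" for t
  have py: "continuous_on {0..T} (\<lambda>s. p s * y s)" by (intro continuous_intros p y)
  have Q: "(Q has_vector_derivative p t * y t) (at t within {0..T})" if "t \<in> {0..T}" for t
    unfolding Q_def by (rule integral_has_vector_derivative[OF py that])
  then have contQ: "continuous_on {0..T} Q"
    using has_vector_derivative_continuous[OF Q] by (simp add: continuous_on_eq_continuous_within)
  define z where "z t = \<i> * y t - Q t" for t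
  have z: "continuous_on {0..T} z" unfolding z_def by (intro continuous_intros contQ y)
  have "integral {0..T} (\<lambda>t. z t * vector_derivative \<phi> (at t)) = 0" if \<phi>: "\<phi> \<in> time_test T" for \<phi>
  proof -
    note cont = time_test_deriv(2,3)[OF \<phi>]
    have "integral {0..T} (\<lambda>t. z t * vector_derivative \<phi> (at t))
        = integral {0..T} (\<lambda>t. y t * (- ((1 / \<i>) * vector_derivative \<phi> (at t)))
            - Q t * vector_derivative \<phi> (at t))"
      by (rule integral_cong) (simp add: z_def algebra_simps)
    also have "\<dots> = integral {0..T} (\<lambda>t. y t * (- ((1 / \<i>) * vector_derivative \<phi> (at t))))
        - integral {0..T} (\<lambda>t. Q t * vector_derivative \<phi> (at t))"
      by (intro integral_diff integrable_continuous_real continuous_intros cont y contQ)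
    also have "\<dots> = 0"
      using weak[OF \<phi>] time_test_integral_by_parts[OF T \<phi> py Q] by simp
    finally show ?thesis .
  qed
  note const = weak_derivative_zero_imp_constant[OF T z this]
  have z0: "z 0 = 0" by (simp add: z_def Q_def y)
  \<comment> \<open>Du Bois-Reymond compares interior points only; continuity brings in the endpoint
    \<open>0\<close>, where the initial value is known.\<close>
  have zc: "z s = z (T / 2)" if "s \<in> {0..T}" for s
  proof (rule continuous_constant_on_closure[of "{0<..<T}"])
    show "z x = z (T / 2)" if "x \<in> {0<..<T}" for x
      using that T by (intro const) auto
  qed (use T that z in auto)
  have yQ: "y s = - \<i> * Q s" if "s \<in> {0..T}" for s
  proof -
    have "z s = 0" using zc[OF that] zc[of 0] z0 T by simp
    then have "Q s = \<i> * y s" by (simp add: z_def)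
    then show ?thesis by (simp flip: mult.assoc)
  qed
  let ?E = "\<lambda>t. exp (\<i> * integral {0..t} p)"
  have "((\<lambda>t. Q t * ?E t) has_derivative (\<lambda>h. 0)) (at t within {0..T})" if "t \<in> {0..T}" for t
  proof -
    have "((\<lambda>t. Q t * ?E t) has_vector_derivative
        Q t * (\<i> * p t * ?E t) + p t * y t * ?E t) (at t within {0..T})"
      by (intro has_vector_derivative_mult Q integrating_factor_deriv p that)
    then show ?thesis
      using yQ[OF that] by (simp add: has_vector_derivative_def)
  qed
  then have "\<exists>c. \<forall>t\<in>{0..T}. Q t * ?E t = c"
    by (intro has_derivative_zero_constant) auto
  then obtain c where "\<forall>t\<in>{0..T}. Q t * ?E t = c" ..
  from bspec[OF this, of 0] bspec[OF this t] have "Q t * ?E t = 0"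
    using T by (simp add: Q_def)
  then have "Q t = 0" by simp
  then show ?thesis using yQ[OF t] by simp
qed

text \<open>Duhamel's formula with the kernel from \<open>s\<close> to \<open>t\<close> factored
  into two exponentials, so that the product rule applies. Estimates have to recombine them, since
  the second factor alone is not bounded uniformly in the frequency.\<close>

definition ode_solution :: "(real \<Rightarrow> complex) \<Rightarrow> complex \<Rightarrow> (real \<Rightarrow> complex) \<Rightarrow> real \<Rightarrow> complex" where
  "ode_solution p g f t = exp (- \<i> * integral {0..t} p)
     * (g + \<i> * integral {0..t} (\<lambda>s. exp (\<i> * integral {0..s} p) * f s))"

lemma ode_solution_0 [simp]: "ode_solution p g f 0 = g"
  by (simp add: ode_solution_def)

lemma continuous_on_integrating_factor:
  fixes p :: "real \<Rightarrow> complex"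
  assumes "continuous_on {0..T} p"
  shows "continuous_on {0..T} (\<lambda>t. exp (c * integral {0..t} p))"
  by (intro continuous_intros indefinite_integral_continuous_1 integrable_continuous_real assms)

lemma ode_solution_deriv:
  assumes p: "continuous_on {0..T} p" and f: "continuous_on {0..T} f" and t: "t \<in> {0..T}"
  shows "(ode_solution p g f has_vector_derivative - \<i> * p t * ode_solution p g f t + \<i> * f t)
    (at t within {0..T})"
proof -
  have cont: "continuous_on {0..T} (\<lambda>s. exp (\<i> * integral {0..s} p) * f s)"
    by (intro continuous_on_mult continuous_on_integrating_factor p f)
  have D: "(ode_solution p g f has_vector_derivative
      exp (- \<i> * integral {0..t} p) * (0 + \<i> * (exp (\<i> * integral {0..t} p) * f t))
      + - \<i> * p t * exp (- \<i> * integral {0..t} p)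
        * (g + \<i> * integral {0..t} (\<lambda>s. exp (\<i> * integral {0..s} p) * f s))) (at t within {0..T})"
    unfolding ode_solution_def[abs_def]
    by (intro has_vector_derivative_mult has_vector_derivative_add has_vector_derivative_const
        has_vector_derivative_mult_right integral_has_vector_derivative[OF cont] integrating_factor_deriv p t)
  have "exp (- \<i> * integral {0..t} p) * exp (\<i> * integral {0..t} p) = 1"
    by (simp flip: exp_add)
  then have eq: "exp (- \<i> * integral {0..t} p) * (0 + \<i> * (exp (\<i> * integral {0..t} p) * f t)) = \<i> * f t"
    by (simp add: mult.left_commute mult.assoc[symmetric])
  show ?thesis
    using D unfolding eq by (simp only: ode_solution_def mult.assoc add.commute)
qed

lemma continuous_on_ode_solution:
  assumes "continuous_on {0..T} p" "continuous_on {0..T} f"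
  shows "continuous_on {0..T} (ode_solution p g f)"
  using has_vector_derivative_continuous[OF ode_solution_deriv[OF assms]]
  by (simp add: continuous_on_eq_continuous_within)

lemma ode_solution_weak:
  assumes T: "T > 0" and p: "continuous_on {0..T} p" and f: "continuous_on {0..T} f"
    and \<phi>: "\<phi> \<in> time_test T"
  shows "integral {0..T} (\<lambda>t. ode_solution p g f t * (- ((1 / \<i>) * vector_derivative \<phi> (at t))))
      + integral {0..T} (\<lambda>t. p t * ode_solution p g f t * \<phi> t) = integral {0..T} (\<lambda>t. f t * \<phi> t)"
proof -
  let ?y = "ode_solution p g f"
  note cont = continuous_on_ode_solution[OF p f] time_test_deriv(2,3)[OF \<phi>]
  have "integral {0..T} (\<lambda>t. ?y t * (- ((1 / \<i>) * vector_derivative \<phi> (at t))))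
      = \<i> * integral {0..T} (\<lambda>t. ?y t * vector_derivative \<phi> (at t))"
    by (subst integral_mult_right[symmetric]) (auto intro!: integral_cong simp: algebra_simps)
  also have "integral {0..T} (\<lambda>t. ?y t * vector_derivative \<phi> (at t))
      = - integral {0..T} (\<lambda>t. (- \<i> * p t * ?y t + \<i> * f t) * \<phi> t)"
    by (rule time_test_integral_by_parts[OF T \<phi> _ ode_solution_deriv[OF p f]])
      (intro continuous_intros cont p f)
  also have "(\<lambda>t. (- \<i> * p t * ?y t + \<i> * f t) * \<phi> t)
      = (\<lambda>t. - \<i> * (p t * ?y t * \<phi> t) + \<i> * (f t * \<phi> t))"
    by (simp add: algebra_simps)
  also have "integral {0..T} (\<lambda>t. - \<i> * (p t * ?y t * \<phi> t) + \<i> * (f t * \<phi> t))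
      = - \<i> * integral {0..T} (\<lambda>t. p t * ?y t * \<phi> t) + \<i> * integral {0..T} (\<lambda>t. f t * \<phi> t)"
    by (subst integral_add) (auto intro!: integrable_continuous_real continuous_intros cont p f)
  finally show ?thesis by (simp add: algebra_simps)
qed

text \<open>The kernel has modulus \<open>exp\<close> of the integral of \<open>Im p\<close> over
  \<open>{s..t}\<close>, hence at most \<open>exp (K * (t - s))\<close>; \<open>K \<ge> 0\<close>
  allows replacing \<open>t - s\<close> by \<open>T\<close>. Only an upper bound on
  \<open>Im p\<close> enters, so the constant can be the same for all frequencies.\<close>

lemma norm_ode_solution_le:
  assumes p: "continuous_on {0..T} p" and f: "continuous_on {0..T} f" and t: "t \<in> {0..T}"
    and K: "K \<ge> 0" "\<And>t. t \<in> {0..T} \<Longrightarrow> Im (p t) \<le> K"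
  shows "norm (ode_solution p g f t) \<le> exp (K * T) * (norm g + integral {0..T} (\<lambda>s. norm (f s)))"
proof -
  have kernel: "norm (exp (- \<i> * integral {0..t} p) * exp (\<i> * integral {0..s} p)) \<le> exp (K * T)"
    if s: "0 \<le> s" "s \<le> t" for s
  proof -
    have p_int: "p integrable_on {a..b}" if "0 \<le> a" "b \<le> T" for a b
      using p that by (intro integrable_continuous_real) (auto elim: continuous_on_subset)
    have "integral {0..s} p + integral {s..t} p = integral {0..t} p"
      using s t by (intro Henstock_Kurzweil_Integration.integral_combine p_int) auto
    then have "integral {s..t} p = integral {0..t} p - integral {0..s} p"
      by (simp add: eq_diff_eq add.commute)
    then have "norm (exp (- \<i> * integral {0..t} p) * exp (\<i> * integral {0..s} p))
        = exp (Im (integral {s..t} p))"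
      by (auto simp: norm_exp_eq_Re simp flip: exp_add)
    also have "Im (integral {s..t} p) = integral {s..t} (\<lambda>x. Im (p x))"
      using integral_linear[OF p_int bounded_linear_Im, of s t] s t by (simp add: o_def)
    also have "\<dots> \<le> integral {s..t} (\<lambda>x. K)"
    proof (rule integral_le)
      show "(\<lambda>x. Im (p x)) integrable_on {s..t}"
        using integrable_linear[OF p_int bounded_linear_Im, of s t] s t by (simp add: o_def)
    qed (use K(2) s t in auto)
    also have "\<dots> \<le> K * T" using s t K(1) by (simp add: mult.commute mult_left_mono)
    finally show ?thesis by simp
  qed
  let ?F = "\<lambda>s. exp (- \<i> * integral {0..t} p) * exp (\<i> * integral {0..s} p) * f s"
  have sub: "continuous_on {0..t} h" if "continuous_on {0..T} h" for h :: "real \<Rightarrow> complex"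
    using that t by (auto elim: continuous_on_subset)
  have cont: "continuous_on {0..t} ?F"
    by (intro continuous_on_mult continuous_on_const sub continuous_on_integrating_factor p f)
  \<comment> \<open>The trivial factor with \<open>integral {0..0} p\<close> exhibits the
    initial-data term as the kernel at \<open>s = 0\<close>, so one bound serves both terms.\<close>
  have eq: "ode_solution p g f t
      = exp (- \<i> * integral {0..t} p) * exp (\<i> * integral {0..0} p) * g + \<i> * integral {0..t} ?F"
    by (simp add: ode_solution_def mult.assoc distrib_left)
  have "norm (integral {0..t} ?F) \<le> integral {0..t} (\<lambda>s. exp (K * T) * norm (f s))"
  proof (rule integral_norm_bound_integral)
    show "norm (?F s) \<le> exp (K * T) * norm (f s)" if "s \<in> {0..t}" for s
      using that unfolding norm_mult[of _ "f s"] by (intro mult_right_mono kernel) auto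
  qed (auto intro!: integrable_continuous_real continuous_intros sub f p
      indefinite_integral_continuous_1)
  also have "\<dots> \<le> integral {0..T} (\<lambda>s. exp (K * T) * norm (f s))"
    by (rule integral_subset_le)
      (use t in \<open>auto intro!: integrable_continuous_real continuous_intros sub f\<close>)
  also have "\<dots> = exp (K * T) * integral {0..T} (\<lambda>s. norm (f s))" by simp
  finally have 1: "norm (\<i> * integral {0..t} ?F) \<le> exp (K * T) * integral {0..T} (\<lambda>s. norm (f s))"
    by (simp add: norm_mult)
  have 2: "norm (exp (- \<i> * integral {0..t} p) * exp (\<i> * integral {0..0} p) * g) \<le> exp (K * T) * norm g"
    using t unfolding norm_mult[of _ g] by (intro mult_right_mono kernel) auto
  show ?thesis
    unfolding eq distrib_left by (rule norm_triangle_le[OF add_mono[OF 2 1]])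
qed

text \<open>Cauchy-Schwarz against the constant \<open>1\<close>, read off from the nonnegativity of
  the variance: \<open>A / T\<close> is the mean of \<open>norm (f s)\<close>.\<close>

lemma integral_norm_squared_le:
  fixes f :: "real \<Rightarrow> 'a::real_normed_vector"
  assumes T: "T > 0" and f: "continuous_on {0..T} f"
  shows "(integral {0..T} (\<lambda>s. norm (f s)))\<^sup>2 \<le> T * integral {0..T} (\<lambda>s. (norm (f s))\<^sup>2)"
proof -
  define A where "A = integral {0..T} (\<lambda>s. norm (f s))"
  have int: "(\<lambda>s. (norm (f s))\<^sup>2) integrable_on {0..T}" "(\<lambda>s. norm (f s)) integrable_on {0..T}"
    by (intro integrable_continuous_real continuous_intros f)+
  have "0 \<le> integral {0..T} (\<lambda>s. (norm (f s) - A / T)\<^sup>2)"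
    by (intro integral_nonneg integrable_continuous_real continuous_intros f) simp
  also have "(\<lambda>s. (norm (f s) - A / T)\<^sup>2) = (\<lambda>s. (norm (f s))\<^sup>2 - (2 * A / T) * norm (f s) + (A / T)\<^sup>2)"
    by (simp add: power2_diff algebra_simps)
  also have "integral {0..T} \<dots>
      = integral {0..T} (\<lambda>s. (norm (f s))\<^sup>2) - (2 * A / T) * A + T * (A / T)\<^sup>2"
    by (rule integral_unique, intro has_integral_add has_integral_diff has_integral_mult_right)
      (use int T has_integral_const_real[of "(A / T)\<^sup>2" 0 T] in \<open>auto simp: A_def\<close>)
  also have "\<dots> = integral {0..T} (\<lambda>s. (norm (f s))\<^sup>2) - A\<^sup>2 / T"
    using T by (simp add: power2_eq_square field_simps)
  finally show ?thesis using T by (simp add: A_def field_simps)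
qed

section \<open>Sobolev spaces\<close>

text \<open>A nonnegative constant and freedom to raise the order allow bounds of different orders
  to be added.\<close>

lemma distributions_bound:
  assumes "u \<in> distributions"
  obtains m C where "C \<ge> 0" "\<And>m' \<psi>. m \<le> m' \<Longrightarrow> norm (u \<psi>) \<le> C * test_seminorm m' \<psi>"
proof -
  obtain m C where C: "\<And>\<psi>. norm (u \<psi>) \<le> C * test_seminorm m \<psi>"
    using distributionsD(3)[OF assms] by blast
  have "norm (u \<psi>) \<le> \<bar>C\<bar> * test_seminorm m' \<psi>" if "m \<le> m'" for m' \<psi>
    using C[of \<psi>] mult_mono[OF abs_ge_self[of C] test_seminorm_mono[OF that, of \<psi>]]
      test_seminorm_nonneg[of m \<psi>] by simp
  then show thesis using that[of "\<bar>C\<bar>" m] by simp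
qed

section \<open>Linear operations on distributions\<close>

lemma test_pderiv_linear:
  "test_pderiv j (test_add \<phi> \<psi>) = test_add (test_pderiv j \<phi>) (test_pderiv j \<psi>)"
  "test_pderiv j (test_scale c \<psi>) = test_scale c (test_pderiv j \<psi>)"
  using foldr_pderiv_at_add[of "Rep_torus_test \<phi>" "Rep_torus_test \<psi>" "[j]"]
    foldr_pderiv_at_scale[of "Rep_torus_test \<psi>" "[j]" c]
  by (simp_all add: Rep_torus_test_inject[symmetric] test_pderiv.rep_eq test_scale.rep_eq
      test_add.rep_eq)

lemma distributions_add:
  assumes u: "u \<in> distributions" and v: "v \<in> distributions"
  shows "(\<lambda>\<psi>. u \<psi> + v \<psi>) \<in> distributions"
proof -
  obtain m C where C: "\<And>m' \<psi>. m \<le> m' \<Longrightarrow> norm (u \<psi>) \<le> C * test_seminorm m' \<psi>"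
    using distributions_bound[OF u] by metis
  obtain n D where D: "\<And>m' \<psi>. n \<le> m' \<Longrightarrow> norm (v \<psi>) \<le> D * test_seminorm m' \<psi>"
    using distributions_bound[OF v] by metis
  have "norm (u \<psi> + v \<psi>) \<le> (C + D) * test_seminorm (max m n) \<psi>" for \<psi>
    unfolding distrib_right by (intro norm_triangle_le add_mono C D) auto
  then show ?thesis
    unfolding distributions_def using distributionsD[OF u] distributionsD[OF v]
    by (auto simp: algebra_simps intro!: exI[of _ "max m n"] exI[of _ "C + D"])
qed

lemma distributions_scale:
  assumes u: "u \<in> distributions"
  shows "(\<lambda>\<psi>. c * u \<psi>) \<in> distributions"
proof -
  obtain m C where C: "\<And>\<psi>. norm (u \<psi>) \<le> C * test_seminorm m \<psi>"
    using distributionsD(3)[OF u] by blast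
  have "norm (c * u \<psi>) \<le> (norm c * C) * test_seminorm m \<psi>" for \<psi>
    unfolding norm_mult mult.assoc by (intro mult_left_mono C) auto
  then have "\<exists>m C. \<forall>\<psi>. norm (c * u \<psi>) \<le> C * test_seminorm m \<psi>" by blast
  then show ?thesis
    unfolding distributions_def using distributionsD[OF u] by (auto simp: algebra_simps)
qed

lemma distributions_diff:
  assumes "u \<in> distributions" "v \<in> distributions"
  shows "(\<lambda>\<psi>. u \<psi> - v \<psi>) \<in> distributions"
  using distributions_add[OF assms(1) distributions_scale[OF assms(2), of "- 1"]] by simp

lemma distributions_pderiv:
  assumes u: "u \<in> distributions"
  shows "(\<lambda>\<psi>. u (test_pderiv j \<psi>)) \<in> distributions"
proof -
  obtain m C where C: "C \<ge> 0" "\<And>m' \<psi>. m \<le> m' \<Longrightarrow> norm (u \<psi>) \<le> C * test_seminorm m' \<psi>"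
    using distributions_bound[OF u] by metis
  have "norm (u (test_pderiv j \<psi>)) \<le> C * test_seminorm (Suc m) \<psi>" for \<psi>
    using C(2)[of m "test_pderiv j \<psi>"] mult_left_mono[OF test_seminorm_pderiv[of m j \<psi>] C(1)] by simp
  then show ?thesis
    unfolding distributions_def using distributionsD[OF u]
    by (auto simp: test_pderiv_linear)
qed

lemma distributions_sum:
  assumes "finite J" "\<And>j. j \<in> J \<Longrightarrow> u j \<in> distributions"
  shows "(\<lambda>\<psi>. \<Sum>j\<in>J. u j \<psi>) \<in> distributions"
  using assms
proof (induction J)
  case empty
  show ?case
    unfolding distributions_def using test_seminorm_nonneg by (auto intro!: exI[of _ 0] exI[of _ 1])
next
  case (insert j J)
  then show ?case by (simp add: distributions_add)
qed

section \<open>Sobolev norms and their pairing with test functions\<close>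

lemma sobolev_term_bracket:
  "sobolev_term r u \<xi> = (norm (fourier_coeff u \<xi>))\<^sup>2 * bracket \<xi> powr (2 * r)"
  by (simp add: sobolev_term_def bracket_def)

lemma sobolev_term_nonneg: "sobolev_term r u \<xi> \<ge> 0"
  by (simp add: sobolev_term_bracket)

lemma norm_diff_squared_le: "(norm (a - b))\<^sup>2 \<le> 2 * (norm a)\<^sup>2 + 2 * (norm b)\<^sup>2"
  for a b :: "'a::real_normed_vector"
proof -
  have "(norm (a - b))\<^sup>2 \<le> (norm a + norm b)\<^sup>2"
    by (intro power_mono norm_triangle_ineq4) simp
  also have "\<dots> \<le> 2 * (norm a)\<^sup>2 + 2 * (norm b)\<^sup>2"
    using zero_le_power2[of "norm a - norm b"] by (simp add: power2_sum power2_diff)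
  finally show ?thesis .
qed

lemma sobolev_term_diff_le:
  "sobolev_term r (\<lambda>\<psi>. u \<psi> - v \<psi>) \<xi> \<le> 2 * sobolev_term r u \<xi> + 2 * sobolev_term r v \<xi>"
  using mult_right_mono[OF norm_diff_squared_le[of "fourier_coeff u \<xi>" "fourier_coeff v \<xi>"],
      of "bracket \<xi> powr (2 * r)"]
  by (simp add: sobolev_term_bracket fourier_coeff_def algebra_simps)

lemma sobolev_diff:
  assumes "u \<in> sobolev r" "v \<in> sobolev r"
  shows "(\<lambda>\<psi>. u \<psi> - v \<psi>) \<in> sobolev r"
proof -
  have "sobolev_term r (\<lambda>\<psi>. u \<psi> - v \<psi>) summable_on UNIV"
    by (rule summable_on_comparison_test[of "\<lambda>\<xi>. 2 * sobolev_term r u \<xi> + 2 * sobolev_term r v \<xi>"])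
      (use assms in \<open>auto intro!: summable_on_add summable_on_cmult_right sobolev_term_diff_le
        sobolev_term_nonneg simp: sobolev_def\<close>)
  then show ?thesis using assms by (simp add: sobolev_def distributions_diff)
qed

lemma sobolev_norm_nonneg: "sobolev_norm r u \<ge> 0"
  by (simp add: sobolev_norm_def infsum_nonneg sobolev_term_nonneg)

lemma sobolev_norm_power2: "(sobolev_norm r u)\<^sup>2 = (\<Sum>\<^sub>\<infinity>\<xi>. sobolev_term r u \<xi>)"
  by (simp add: sobolev_norm_def infsum_nonneg sobolev_term_nonneg)

text \<open>A triangle inequality with factors \<open>2\<close>, obtained by summing a termwise
  estimate. It serves to bound the norm locally in time.\<close>

lemma sobolev_norm_diff_power2_le:
  assumes u: "u \<in> sobolev r" and v: "v \<in> sobolev r"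
  shows "(sobolev_norm r u)\<^sup>2 \<le> 2 * (sobolev_norm r (\<lambda>\<psi>. u \<psi> - v \<psi>))\<^sup>2 + 2 * (sobolev_norm r v)\<^sup>2"
proof -
  let ?w = "\<lambda>\<psi>. u \<psi> - v \<psi>"
  have s: "sobolev_term r u summable_on UNIV" "sobolev_term r v summable_on UNIV"
      "sobolev_term r ?w summable_on UNIV"
    using u v sobolev_diff[OF u v] by (simp_all add: sobolev_def)
  have "norm (u \<psi>) = norm (?w \<psi> - (- v \<psi>))" for \<psi> by simp
  then have "sobolev_term r u \<xi> \<le> 2 * sobolev_term r ?w \<xi> + 2 * sobolev_term r v \<xi>" for \<xi>
    using mult_right_mono[OF norm_diff_squared_le[of "?w (wave (- \<xi>))" "- v (wave (- \<xi>))"],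
        of "bracket \<xi> powr (2 * r)"]
    by (simp add: sobolev_term_bracket fourier_coeff_def algebra_simps)
  then have "(\<Sum>\<^sub>\<infinity>\<xi>. sobolev_term r u \<xi>) \<le> (\<Sum>\<^sub>\<infinity>\<xi>. 2 * sobolev_term r ?w \<xi> + 2 * sobolev_term r v \<xi>)"
    by (intro infsum_mono summable_on_add summable_on_cmult_right s) auto
  also have "\<dots> = 2 * (\<Sum>\<^sub>\<infinity>\<xi>. sobolev_term r ?w \<xi>) + 2 * (\<Sum>\<^sub>\<infinity>\<xi>. sobolev_term r v \<xi>)"
    by (subst infsum_add) (auto intro!: summable_on_cmult_right s simp: infsum_cmult_right')
  finally show ?thesis by (simp add: sobolev_norm_power2)
qed

lemma norm_fourier_coeff_le:
  assumes "u \<in> sobolev r"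
  shows "norm (fourier_coeff u \<xi>) \<le> sobolev_norm r u * bracket \<xi> powr (- r)"
proof -
  have "sobolev_term r u \<xi> \<le> (\<Sum>\<^sub>\<infinity>\<xi>. sobolev_term r u \<xi>)"
    using finite_sum_le_infsum[of "sobolev_term r u" UNIV "{\<xi>}"] assms
    by (simp add: sobolev_def sobolev_term_nonneg)
  then have "(norm (fourier_coeff u \<xi>) * bracket \<xi> powr r)\<^sup>2 \<le> (sobolev_norm r u)\<^sup>2"
    by (simp add: sobolev_term_bracket sobolev_norm_power2 power_mult_distrib powr_power)
  then have "norm (fourier_coeff u \<xi>) * bracket \<xi> powr r \<le> sobolev_norm r u"
    by (rule power2_le_imp_le[OF _ sobolev_norm_nonneg])
  moreover have "bracket \<xi> powr r > 0" using bracket_pos[of \<xi>] by simp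
  ultimately show ?thesis by (simp add: powr_minus_divide pos_le_divide_eq)
qed

text \<open>The order \<open>m\<close> is chosen so that \<open>tcoef \<psi>\<close> decays with
  exponent \<open>2 * N - r\<close>; against coefficients of size
  \<open>bracket \<xi> powr (- r)\<close> this leaves the summable exponent \<open>2 * N\<close>.
  Both \<open>C\<close> and \<open>m\<close> depend on \<open>r\<close> and the dimension
  alone.\<close>

lemma tcoef_pairing_bound:
  fixes r :: real
  obtains C m where "C \<ge> 0"
    "\<And>c A (\<psi> :: 'n::finite torus_test). (\<And>\<xi>. norm (c \<xi>) \<le> A * bracket \<xi> powr (- r)) \<Longrightarrow>
      (\<lambda>\<xi>. norm (tcoef \<psi> \<xi> * c \<xi>)) summable_on UNIV \<and>
      norm (\<Sum>\<^sub>\<infinity>\<xi>. tcoef \<psi> \<xi> * c \<xi>) \<le> C * A * test_seminorm m \<psi>"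
proof -
  let ?N = "real CARD('n)"
  define m where "m = nat \<lceil>2 * ?N - r\<rceil>"
  have m: "2 * ?N - r \<le> real m" unfolding m_def by linarith
  define S where "S = (\<Sum>\<^sub>\<infinity>\<xi>::int^'n. bracket \<xi> powr (- (2 * ?N)))"
  have sum: "(\<lambda>\<xi>::int^'n. bracket \<xi> powr (- (2 * ?N))) summable_on UNIV"
    by (rule summable_on_bracket) simp
  define C where "C = (1 + ?N) ^ m * S"
  have "S \<ge> 0" unfolding S_def by (intro infsum_nonneg) simp
  then have "C \<ge> 0" by (simp add: C_def)
  moreover have "(\<lambda>\<xi>. norm (tcoef \<psi> \<xi> * c \<xi>)) summable_on UNIV \<and>
      norm (\<Sum>\<^sub>\<infinity>\<xi>. tcoef \<psi> \<xi> * c \<xi>) \<le> C * A * test_seminorm m \<psi>"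
    if c: "\<And>\<xi>. norm (c \<xi>) \<le> A * bracket \<xi> powr (- r)" for c A and \<psi> :: "'n torus_test"
  proof -
    let ?B = "(1 + ?N) ^ m * test_seminorm m \<psi> * A"
    have le: "norm (tcoef \<psi> \<xi> * c \<xi>) \<le> ?B * bracket \<xi> powr (- (2 * ?N))" for \<xi>
    proof -
      have "norm (tcoef \<psi> \<xi> * c \<xi>)
          \<le> ((1 + ?N) ^ m * test_seminorm m \<psi> * bracket \<xi> powr (- (2 * ?N - r)))
            * (A * bracket \<xi> powr (- r))"
        unfolding norm_mult
        by (intro mult_mono tcoef_decay_powr m c) (auto simp: test_seminorm_nonneg)
      also have "\<dots> = ?B * (bracket \<xi> powr (- (2 * ?N - r)) * bracket \<xi> powr (- r))"
        by (simp only: mult_ac)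
      also have "bracket \<xi> powr (- (2 * ?N - r)) * bracket \<xi> powr (- r) = bracket \<xi> powr (- (2 * ?N))"
        by (simp flip: powr_add)
      finally show ?thesis .
    qed
    have sB: "(\<lambda>\<xi>::int^'n. ?B * bracket \<xi> powr (- (2 * ?N))) summable_on UNIV"
      by (intro summable_on_cmult_right sum)
    have abs: "(\<lambda>\<xi>. norm (tcoef \<psi> \<xi> * c \<xi>)) summable_on UNIV"
      by (rule summable_on_comparison_test[OF sB]) (use le in auto)
    have "norm (\<Sum>\<^sub>\<infinity>\<xi>. tcoef \<psi> \<xi> * c \<xi>) \<le> (\<Sum>\<^sub>\<infinity>\<xi>::int^'n. ?B * bracket \<xi> powr (- (2 * ?N)))"
      by (rule norm_infsum_le[OF has_sum_infsum[OF abs_summable_summable[OF abs]] has_sum_infsum[OF sB] le])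
    also have "\<dots> = C * A * test_seminorm m \<psi>"
      by (simp add: infsum_cmult_right' S_def C_def)
    finally show ?thesis using abs by blast
  qed
  ultimately show thesis by (rule that)
qed

text \<open>One order \<open>m\<close> serves all of \<open>sobolev r\<close>, which membership in
  \<open>distributions\<close> does not provide. Continuity of \<open>u t \<psi>\<close> in time and
  the seminorm bound for time integrals both rest on this uniformity.\<close>

lemma sobolev_apply_bound:
  obtains C m where "C \<ge> 0"
    "\<And>u (\<psi> :: 'n::finite torus_test). u \<in> sobolev r \<Longrightarrow>
      norm (u \<psi>) \<le> C * sobolev_norm r u * test_seminorm m \<psi>"
proof -
  obtain C m where C: "C \<ge> 0" "\<And>c A (\<psi> :: 'n torus_test).
      (\<And>\<xi>. norm (c \<xi>) \<le> A * bracket \<xi> powr (- r)) \<Longrightarrow>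
      (\<lambda>\<xi>. norm (tcoef \<psi> \<xi> * c \<xi>)) summable_on UNIV \<and>
      norm (\<Sum>\<^sub>\<infinity>\<xi>. tcoef \<psi> \<xi> * c \<xi>) \<le> C * A * test_seminorm m \<psi>"
    using tcoef_pairing_bound[of r, where 'n = 'n] by blast
  have "norm (u \<psi>) \<le> C * sobolev_norm r u * test_seminorm m \<psi>" if u: "u \<in> sobolev r"
    for u and \<psi> :: "'n torus_test"
  proof -
    have "norm (u (wave \<xi>)) \<le> sobolev_norm r u * bracket \<xi> powr (- r)" for \<xi>
      using norm_fourier_coeff_le[OF u, of "- \<xi>"] by (simp add: fourier_coeff_def)
    moreover have "(\<Sum>\<^sub>\<infinity>\<xi>. tcoef \<psi> \<xi> * u (wave \<xi>)) = u \<psi>"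
      using u by (intro infsumI distribution_fourier_series) (simp add: sobolev_def)
    ultimately show ?thesis
      using C(2)[of "\<lambda>\<xi>. u (wave \<xi>)" "sobolev_norm r u" \<psi>] by simp
  qed
  then show thesis by (rule that[OF C(1)])
qed

text \<open>The index is reflected because \<open>fourier_coeff u \<xi>\<close> is \<open>u\<close> tested against \<open>wave (- \<xi>)\<close>.\<close>

definition synthesis :: "(int ^ 'n::finite \<Rightarrow> complex) \<Rightarrow> 'n torus_functional" where
  "synthesis c \<psi> = (\<Sum>\<^sub>\<infinity>\<xi>. tcoef \<psi> \<xi> * c (- \<xi>))"

lemma fourier_coeff_synthesis: "fourier_coeff (synthesis c) \<xi> = c \<xi>"
proof -
  have "((\<lambda>\<eta>. tcoef (wave (- \<xi>)) \<eta> * c (- \<eta>)) has_sum c \<xi>) UNIV"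
    by (rule has_sum_finite_neutralI[of "{- \<xi>}"]) (auto simp: fcoef_wave)
  then show ?thesis by (simp add: fourier_coeff_def synthesis_def infsumI)
qed

text \<open>Each term is at most the whole weighted sum \<open>A^2\<close>, so the coefficients are
  bounded by \<open>A * bracket \<xi> powr (- r)\<close> and the pairing bound makes the series a
  distribution.\<close>

lemma synthesis_in_sobolev:
  fixes c :: "int ^ 'n::finite \<Rightarrow> complex"
  assumes "(\<lambda>\<xi>. (norm (c \<xi>))\<^sup>2 * bracket \<xi> powr (2 * r)) summable_on UNIV"
  shows "synthesis c \<in> sobolev r"
proof -
  define A where "A = sqrt (\<Sum>\<^sub>\<infinity>\<xi>. (norm (c \<xi>))\<^sup>2 * bracket \<xi> powr (2 * r))"
  have "norm (c \<xi>) \<le> A * bracket \<xi> powr (- r)" for \<xi>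
  proof -
    have "(norm (c \<xi>))\<^sup>2 * bracket \<xi> powr (2 * r) \<le> (\<Sum>\<^sub>\<infinity>\<xi>. (norm (c \<xi>))\<^sup>2 * bracket \<xi> powr (2 * r))"
      using finite_sum_le_infsum[OF assms, of "{\<xi>}"] by simp
    then have "(norm (c \<xi>) * bracket \<xi> powr r)\<^sup>2 \<le> A\<^sup>2"
      by (simp add: A_def power_mult_distrib powr_power infsum_nonneg)
    then have "norm (c \<xi>) * bracket \<xi> powr r \<le> A"
      by (rule power2_le_imp_le) (simp add: A_def infsum_nonneg)
    moreover have "bracket \<xi> powr r > 0" using bracket_pos[of \<xi>] by simp
    ultimately show ?thesis by (simp add: powr_minus_divide pos_le_divide_eq)
  qed
  from this[of "- \<xi>" for \<xi>] have c: "norm (c (- \<xi>)) \<le> A * bracket \<xi> powr (- r)" for \<xi>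
    by simp
  obtain C m where "C \<ge> 0" and C: "\<And>c A (\<psi> :: 'n torus_test).
      (\<And>\<xi>. norm (c \<xi>) \<le> A * bracket \<xi> powr (- r)) \<Longrightarrow>
      (\<lambda>\<xi>. norm (tcoef \<psi> \<xi> * c \<xi>)) summable_on UNIV \<and>
      norm (\<Sum>\<^sub>\<infinity>\<xi>. tcoef \<psi> \<xi> * c \<xi>) \<le> C * A * test_seminorm m \<psi>"
    using tcoef_pairing_bound[of r, where 'n = 'n] by blast
  have summable: "(\<lambda>\<xi>. tcoef \<psi> \<xi> * c (- \<xi>)) summable_on UNIV" for \<psi> :: "'n torus_test"
    using C[of "\<lambda>\<xi>. c (- \<xi>)", OF c] by (blast intro: abs_summable_summable)
  have "norm (synthesis c \<psi>) \<le> (C * A) * test_seminorm m \<psi>" for \<psi>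
    using C[of "\<lambda>\<xi>. c (- \<xi>)", OF c] by (simp add: synthesis_def)
  moreover have "synthesis c (test_add \<phi> \<psi>) = synthesis c \<phi> + synthesis c \<psi>" for \<phi> \<psi>
    unfolding synthesis_def test_add.rep_eq
    by (subst infsum_add[symmetric])
      (auto intro!: summable infsum_cong simp: fcoef_add continuous_on_Rep_test distrib_right)
  moreover have "synthesis c (test_scale a \<psi>) = a * synthesis c \<psi>" for a \<psi>
    unfolding synthesis_def test_scale.rep_eq fcoef_scale
    by (simp add: mult.assoc infsum_cmult_right')
  ultimately have "synthesis c \<in> distributions"
    unfolding distributions_def by blast
  then show ?thesis
    using assms by (simp add: sobolev_def sobolev_term_bracket[abs_def] fourier_coeff_synthesis)
qed

lemma synthesis_fourier_coeff:
  assumes "g \<in> distributions"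
  shows "synthesis (fourier_coeff g) = g"
proof
  fix \<psi>
  show "synthesis (fourier_coeff g) \<psi> = g \<psi>"
    using infsumI[OF distribution_fourier_series[OF assms, of \<psi>]]
    by (simp add: synthesis_def fourier_coeff_def)
qed

section \<open>Time-dependent distributions\<close>

text \<open>Dominated convergence for sums: a finite \<open>X\<close> carries all but
  \<open>e / 2\<close> of the majorant, and on \<open>X\<close> the sum is finite and tends to
  zero.\<close>

lemma infsum_dominated_tendsto_0:
  fixes g :: "'b \<Rightarrow> 'a \<Rightarrow> real"
  assumes b: "b summable_on UNIV"
    and le: "\<forall>\<^sub>F s in F. \<forall>x. 0 \<le> g s x \<and> g s x \<le> b x"
    and lim: "\<And>x. ((\<lambda>s. g s x) \<longlongrightarrow> 0) F"
  shows "((\<lambda>s. \<Sum>\<^sub>\<infinity>x. g s x) \<longlongrightarrow> 0) F"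
proof (rule tendstoI)
  fix e :: real assume e: "e > 0"
  then obtain X where X: "finite X" "dist (sum b X) (infsum b UNIV) \<le> e / 2"
    using infsum_finite_approximation[OF b, of "e / 2"] by auto
  have "((\<lambda>s. \<Sum>x\<in>X. g s x) \<longlongrightarrow> (\<Sum>x\<in>X. 0)) F"
    by (intro tendsto_sum lim)
  then have "\<forall>\<^sub>F s in F. dist (\<Sum>x\<in>X. g s x) 0 < e / 2"
    using e by (intro tendstoD) auto
  with le show "\<forall>\<^sub>F s in F. dist (\<Sum>\<^sub>\<infinity>x. g s x) 0 < e"
  proof eventually_elim
    case (elim s)
    have gs: "g s summable_on UNIV"
      by (rule summable_on_comparison_test[OF b]) (use elim in auto)
    have split: "infsum h UNIV = sum h X + infsum h (- X)" if "h summable_on UNIV" for h :: "'a \<Rightarrow> real"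
      using infsum_Un_disjoint[of h X "- X"] X(1) summable_on_subset[OF that] by simp
    have "infsum (g s) (- X) \<le> infsum b (- X)"
      using elim summable_on_subset[OF gs] summable_on_subset[OF b] by (intro infsum_mono) auto
    moreover have "0 \<le> infsum (g s) UNIV"
      using elim by (intro infsum_nonneg) auto
    ultimately show ?case
      using elim(2) X(2) split[OF gs] split[OF b] by (simp add: dist_real_def)
  qed
qed

lemma compact_locally_bounded_above:
  fixes h :: "'a::topological_space \<Rightarrow> real"
  assumes "compact K" and "\<And>t. t \<in> K \<Longrightarrow> \<exists>B. \<forall>\<^sub>F s in at t within K. h s \<le> B"
  obtains B where "\<And>t. t \<in> K \<Longrightarrow> h t \<le> B"
proof -
  have "\<exists>U B. open U \<and> t \<in> U \<and> (\<forall>s\<in>U \<inter> K. h s \<le> B)" if t: "t \<in> K" for t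
  proof -
    obtain B where "\<forall>\<^sub>F s in at t within K. h s \<le> B" using assms(2)[OF t] by blast
    then obtain U where "open U" "t \<in> U" "\<forall>s\<in>U. s \<noteq> t \<longrightarrow> s \<in> K \<longrightarrow> h s \<le> B"
      unfolding eventually_at_topological by blast
    \<comment> \<open>The filter omits \<open>t\<close> itself, so its value enters the local bound
      separately.\<close>
    then show ?thesis by (intro exI[of _ U] exI[of _ "max B (h t)"]) (auto simp: le_max_iff_disj)
  qed
  then obtain U B where U: "\<And>t. t \<in> K \<Longrightarrow> open (U t)" "\<And>t. t \<in> K \<Longrightarrow> t \<in> U t"
    "\<And>t s. t \<in> K \<Longrightarrow> s \<in> U t \<Longrightarrow> s \<in> K \<Longrightarrow> h s \<le> B t" by (metis IntI)
  obtain C where C: "C \<subseteq> K" "finite C" "K \<subseteq> (\<Union>t\<in>C. U t)"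
    using compactE_image[OF assms(1), of K U] U(1,2) by blast
  have "h s \<le> Max (insert 0 (B ` C))" if "s \<in> K" for s
  proof -
    have "s \<in> (\<Union>t\<in>C. U t)" using C(3) that by blast
    then obtain t where t: "t \<in> C" "s \<in> U t" by blast
    then have "h s \<le> B t" using U(3) C(1) that by blast
    also have "\<dots> \<le> Max (insert 0 (B ` C))" using C(2) t(1) by (intro Max_ge) auto
    finally show ?thesis .
  qed
  then show thesis by (rule that)
qed

lemma C_sobolevD:
  assumes "u \<in> C_sobolev T r" "t \<in> {0..T}"
  shows "u t \<in> sobolev r" "u t \<in> distributions"
    and "((\<lambda>s. sobolev_norm r (\<lambda>\<psi>. u s \<psi> - u t \<psi>)) \<longlongrightarrow> 0) (at t within {0..T})"
  using assms by (auto simp: C_sobolev_def sobolev_def)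

text \<open>Near \<open>t\<close> the difference has norm below \<open>1\<close>, so the squared
  norm is at most \<open>2 + 2 * (sobolev_norm r (u t))^2\<close>; compactness of
  \<open>{0..T}\<close> glues these local bounds.\<close>

lemma C_sobolev_bounded:
  assumes u: "u \<in> C_sobolev T r"
  obtains B where "\<And>t. t \<in> {0..T} \<Longrightarrow> (sobolev_norm r (u t))\<^sup>2 \<le> B"
proof -
  have loc: "\<exists>B. \<forall>\<^sub>F s in at t within {0..T}. (sobolev_norm r (u s))\<^sup>2 \<le> B" if t: "t \<in> {0..T}" for t
  proof -
  have "\<forall>\<^sub>F s in at t within {0..T}. sobolev_norm r (\<lambda>\<psi>. u s \<psi> - u t \<psi>) < 1"
    using C_sobolevD(3)[OF u t] by (rule order_tendstoD) simp
  moreover have "\<forall>\<^sub>F s in at t within {0..T}. s \<in> {0..T}"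
    by (simp add: eventually_at_filter)
  ultimately have "\<forall>\<^sub>F s in at t within {0..T}.
      (sobolev_norm r (u s))\<^sup>2 \<le> 2 + 2 * (sobolev_norm r (u t))\<^sup>2"
  proof eventually_elim
    case (elim s)
    have "(sobolev_norm r (\<lambda>\<psi>. u s \<psi> - u t \<psi>))\<^sup>2 \<le> 1"
      using elim(1) by (intro power_le_one sobolev_norm_nonneg) auto
    then show ?case
      using sobolev_norm_diff_power2_le[OF C_sobolevD(1)[OF u elim(2)] C_sobolevD(1)[OF u t]] by linarith
  qed
  then show ?thesis by blast
  qed
  show thesis using compact_locally_bounded_above[OF compact_Icc loc] that by blast
qed

lemma C_sobolev_apply_continuous:
  fixes u :: "real \<Rightarrow> 'n::finite torus_functional"
  assumes u: "u \<in> C_sobolev T r"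
  shows "continuous_on {0..T} (\<lambda>t. u t \<psi>)"
proof -
  obtain C m where "C \<ge> 0" and C: "\<And>u (\<psi> :: 'n::finite torus_test). u \<in> sobolev r \<Longrightarrow>
      norm (u \<psi>) \<le> C * sobolev_norm r u * test_seminorm m \<psi>"
    using sobolev_apply_bound[of r, where 'n = 'n] by blast
  show ?thesis
    unfolding continuous_on_def
  proof
    fix t assume t: "t \<in> {0..T}"
    have "((\<lambda>s. C * sobolev_norm r (\<lambda>\<psi>. u s \<psi> - u t \<psi>) * test_seminorm m \<psi>) \<longlongrightarrow>
        C * 0 * test_seminorm m \<psi>) (at t within {0..T})"
      by (intro tendsto_intros C_sobolevD(3) u t)
    then have lim: "((\<lambda>s. C * sobolev_norm r (\<lambda>\<psi>. u s \<psi> - u t \<psi>) * test_seminorm m \<psi>)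
        \<longlongrightarrow> 0) (at t within {0..T})" by simp
    have "norm (u s \<psi> - u t \<psi>)
        \<le> C * sobolev_norm r (\<lambda>\<psi>. u s \<psi> - u t \<psi>) * test_seminorm m \<psi>" if "s \<in> {0..T}" for s
      by (rule C[OF sobolev_diff[OF C_sobolevD(1)[OF u that] C_sobolevD(1)[OF u t]]])
    then have "\<forall>\<^sub>F s in at t within {0..T}. norm (u s \<psi> - u t \<psi>)
        \<le> C * sobolev_norm r (\<lambda>\<psi>. u s \<psi> - u t \<psi>) * test_seminorm m \<psi>"
      by (simp add: eventually_at_filter)
    then have "((\<lambda>s. u s \<psi> - u t \<psi>) \<longlongrightarrow> 0) (at t within {0..T})"
      by (rule Lim_null_comparison[OF _ lim])
    then show "((\<lambda>t. u t \<psi>) \<longlongrightarrow> u t \<psi>) (at t within {0..T})"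
      by (simp add: LIM_zero_iff)
  qed
qed

text \<open>The estimate of \<open>u t \<psi>\<close> has order and constant independent of
  \<open>t\<close>, because \<open>sobolev_apply_bound\<close> is uniform and the norm of
  \<open>u t\<close> is bounded on \<open>{0..T}\<close>. Such an estimate survives integration in
  time.\<close>

lemma C_sobolev_integral_distribution:
  fixes u :: "real \<Rightarrow> 'n::finite torus_functional"
  assumes T: "T > 0" and u: "u \<in> C_sobolev T r" and h: "continuous_on {0..T} h"
  shows "(\<lambda>\<psi>. integral {0..T} (\<lambda>t. u t \<psi> * h t)) \<in> distributions"
proof -
  note int = integrable_continuous_real[OF continuous_on_mult[OF C_sobolev_apply_continuous[OF u] h]]
  obtain C m where C: "C \<ge> 0" "\<And>u (\<psi> :: 'n::finite torus_test). u \<in> sobolev r \<Longrightarrow>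
      norm (u \<psi>) \<le> C * sobolev_norm r u * test_seminorm m \<psi>"
    using sobolev_apply_bound[of r, where 'n = 'n] by blast
  obtain B where B: "\<And>t. t \<in> {0..T} \<Longrightarrow> (sobolev_norm r (u t))\<^sup>2 \<le> B"
    using C_sobolev_bounded[OF u] by blast
  have B': "sobolev_norm r (u t) \<le> sqrt B" if "t \<in> {0..T}" for t
    using B[OF that] by (rule real_le_rsqrt)
  have "compact (h ` {0..T})" using h by (intro compact_continuous_image) auto
  then obtain H where H: "\<And>t. t \<in> {0..T} \<Longrightarrow> norm (h t) \<le> H"
    by (meson compact_imp_bounded bounded_iff imageI)
  have "norm (integral {0..T} (\<lambda>t. u t \<psi> * h t)) \<le> (T * (C * sqrt B * H)) * test_seminorm m \<psi>" for \<psi>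
  proof -
    have "norm (integral {0..T} (\<lambda>t. u t \<psi> * h t))
        \<le> integral {0..T} (\<lambda>t. C * sqrt B * test_seminorm m \<psi> * H)"
    proof (rule integral_norm_bound_integral[OF int])
      fix t assume t: "t \<in> {0..T}"
      have "0 \<le> sqrt B" using order_trans[OF sobolev_norm_nonneg B'[OF t]] .
      have "norm (u t \<psi>) \<le> C * sobolev_norm r (u t) * test_seminorm m \<psi>"
        by (rule C(2)[OF C_sobolevD(1)[OF u t]])
      also have "\<dots> \<le> C * sqrt B * test_seminorm m \<psi>"
        by (intro mult_right_mono mult_left_mono B' t C(1) test_seminorm_nonneg)
      finally show "norm (u t \<psi> * h t) \<le> C * sqrt B * test_seminorm m \<psi> * H"
        unfolding norm_mult
        using \<open>0 \<le> sqrt B\<close> C(1) by (intro mult_mono H t) (auto intro!: mult_nonneg_nonneg test_seminorm_nonneg)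
    qed auto
    also have "\<dots> = (T * (C * sqrt B * H)) * test_seminorm m \<psi>"
      using T by simp
    finally show ?thesis .
  qed
  then have "\<exists>m C. \<forall>\<psi>. norm (integral {0..T} (\<lambda>t. u t \<psi> * h t)) \<le> C * test_seminorm m \<psi>"
    by blast
  moreover have "integral {0..T} (\<lambda>t. u t (test_add \<phi> \<psi>) * h t)
      = integral {0..T} (\<lambda>t. u t \<phi> * h t) + integral {0..T} (\<lambda>t. u t \<psi> * h t)" for \<phi> \<psi>
    by (subst integral_add[OF int int, symmetric])
      (auto intro!: integral_cong simp: distributionsD[OF C_sobolevD(2)[OF u]] distrib_right)
  moreover have "integral {0..T} (\<lambda>t. u t (test_scale c \<psi>) * h t)
      = c * integral {0..T} (\<lambda>t. u t \<psi> * h t)" for c \<psi>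
  proof -
    have "integral {0..T} (\<lambda>t. u t (test_scale c \<psi>) * h t)
        = integral {0..T} (\<lambda>t. c * (u t \<psi> * h t))"
      by (rule integral_cong) (simp add: distributionsD[OF C_sobolevD(2)[OF u]])
    then show ?thesis by simp
  qed
  ultimately show ?thesis unfolding distributions_def by blast
qed

section \<open>The equation tested on exponentials\<close>

definition symbol :: "(real \<Rightarrow> complex) \<Rightarrow> ('n::finite \<Rightarrow> real \<Rightarrow> complex) \<Rightarrow> (real \<Rightarrow> complex) \<Rightarrow>
    int ^ 'n \<Rightarrow> real \<Rightarrow> complex" where
  "symbol a2 a1 a0 \<xi> t = a2 t * (\<Sum>j\<in>UNIV. (of_int (\<xi> $ j))\<^sup>2)
     + (\<Sum>j\<in>UNIV. a1 j t * of_int (\<xi> $ j)) + a0 t"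

text \<open>Each derivative of \<open>wave (- \<xi>)\<close> contributes
  \<open>- \<i> * \<xi>_j\<close>. Two of them give \<open>- \<xi>_j^2\<close>, cancelling the sign
  in front of the Laplacian, and the sign built into \<open>dist_Dx\<close> turns one of them into
  \<open>\<xi>_j\<close>.\<close>

lemma symbol_fourier_coeff:
  assumes "u \<in> distributions"
  shows "- (a2 t * dist_Laplacian u (wave (- \<xi>))) + (\<Sum>j\<in>UNIV. a1 j t * dist_Dx j u (wave (- \<xi>)))
    + a0 t * u (wave (- \<xi>)) = symbol a2 a1 a0 \<xi> t * fourier_coeff u \<xi>"
proof -
  have "u (test_pderiv j (test_pderiv j (wave (- \<xi>))))
      = - ((of_int (\<xi> $ j))\<^sup>2 * fourier_coeff u \<xi>)" for j
  proof -
    have "u (test_pderiv j (test_pderiv j (wave (- \<xi>))))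
        = (\<i> * of_int ((- \<xi>) $ j)) * ((\<i> * of_int ((- \<xi>) $ j)) * u (wave (- \<xi>)))"
      by (simp only: test_pderiv_wave test_pderiv_linear distributionsD[OF assms])
    then show ?thesis
      by (simp add: fourier_coeff_def complex_eq_iff power2_eq_square algebra_simps)
  qed
  then have "dist_Laplacian u (wave (- \<xi>)) = - (\<Sum>j\<in>UNIV. (of_int (\<xi> $ j))\<^sup>2) * fourier_coeff u \<xi>"
    by (simp add: dist_Laplacian_def sum_distrib_right sum_negf)
  moreover have "dist_Dx j u (wave (- \<xi>)) = of_int (\<xi> $ j) * fourier_coeff u \<xi>" for j
    by (simp add: dist_Dx_def test_pderiv_wave distributionsD[OF assms] fourier_coeff_def)
      (simp flip: mult.assoc)
  ultimately show ?thesis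
    by (simp add: symbol_def fourier_coeff_def algebra_simps sum_distrib_left)
qed

lemma evolution_op_wave:
  assumes "\<And>t. t \<in> {0..T} \<Longrightarrow> u t \<in> distributions"
  shows "evolution_op T a2 a1 a0 u \<phi> (wave (- \<xi>))
    = integral {0..T} (\<lambda>t. fourier_coeff (u t) \<xi> * (- ((1 / \<i>) * vector_derivative \<phi> (at t))))
      + integral {0..T} (\<lambda>t. symbol a2 a1 a0 \<xi> t * fourier_coeff (u t) \<xi> * \<phi> t)"
proof -
  have "integral {0..T} (\<lambda>t. (- (a2 t * dist_Laplacian (u t) (wave (- \<xi>)))
        + (\<Sum>j\<in>UNIV. a1 j t * dist_Dx j (u t) (wave (- \<xi>))) + a0 t * u t (wave (- \<xi>))) * \<phi> t)
      = integral {0..T} (\<lambda>t. symbol a2 a1 a0 \<xi> t * fourier_coeff (u t) \<xi> * \<phi> t)"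
    by (rule integral_cong) (simp only: symbol_fourier_coeff assms)
  then show ?thesis
    unfolding evolution_op_def weak_Dt_def regular_distr_def dist_integral_def fourier_coeff_def
    by simp
qed

text \<open>The coefficients depend on time only and can be moved next to \<open>\<phi>\<close>.
  Every term then becomes a time integral of \<open>u\<close> against a continuous weight, tested on
  a derivative of \<open>\<psi>\<close> of order at most two.\<close>

lemma evolution_op_distribution:
  fixes a1 :: "'n::finite \<Rightarrow> real \<Rightarrow> complex"
  assumes T: "T > 0" and u: "u \<in> C_sobolev T r" and \<phi>: "\<phi> \<in> time_test T"
    and a: "continuous_on {0..T} a2" "\<And>j. continuous_on {0..T} (a1 j)" "continuous_on {0..T} a0"
  shows "evolution_op T a2 a1 a0 u \<phi> \<in> distributions"
proof -
  let ?I = "\<lambda>h \<psi>. integral {0..T} (\<lambda>t. u t \<psi> * h t)"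
  note cont = time_test_deriv(2,3)[OF \<phi>]
  note cu = C_sobolev_apply_continuous[OF u]
  have "integral {0..T} (\<lambda>t. (- (a2 t * dist_Laplacian (u t) \<psi>)
        + (\<Sum>j\<in>UNIV. a1 j t * dist_Dx j (u t) \<psi>) + a0 t * u t \<psi>) * \<phi> t)
      = (\<Sum>j\<in>UNIV. ?I (\<lambda>t. - a2 t * \<phi> t) (test_pderiv j (test_pderiv j \<psi>)))
        + (\<Sum>j\<in>UNIV. ?I (\<lambda>t. - (1 / \<i>) * a1 j t * \<phi> t) (test_pderiv j \<psi>))
        + ?I (\<lambda>t. a0 t * \<phi> t) \<psi>" for \<psi>
  proof -
    have "integral {0..T} (\<lambda>t. (- (a2 t * dist_Laplacian (u t) \<psi>)
        + (\<Sum>j\<in>UNIV. a1 j t * dist_Dx j (u t) \<psi>) + a0 t * u t \<psi>) * \<phi> t)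
      = integral {0..T} (\<lambda>t. (\<Sum>j\<in>UNIV. u t (test_pderiv j (test_pderiv j \<psi>)) * (- a2 t * \<phi> t))
        + (\<Sum>j\<in>UNIV. u t (test_pderiv j \<psi>) * (- (1 / \<i>) * a1 j t * \<phi> t))
        + u t \<psi> * (a0 t * \<phi> t))"
      by (rule integral_cong)
        (simp add: dist_Laplacian_def dist_Dx_def sum_distrib_left sum_negf algebra_simps)
    also have "\<dots> = (\<Sum>j\<in>UNIV. ?I (\<lambda>t. - a2 t * \<phi> t) (test_pderiv j (test_pderiv j \<psi>)))
        + (\<Sum>j\<in>UNIV. ?I (\<lambda>t. - (1 / \<i>) * a1 j t * \<phi> t) (test_pderiv j \<psi>))
        + ?I (\<lambda>t. a0 t * \<phi> t) \<psi>"
      by (intro integral_unique has_integral_add has_integral_sum integrable_integral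
          integrable_continuous_real continuous_intros cont cu a) auto
    finally show ?thesis .
  qed
  then have eq: "evolution_op T a2 a1 a0 u \<phi> = (\<lambda>\<psi>.
      ?I (\<lambda>t. - ((1 / \<i>) * vector_derivative \<phi> (at t))) \<psi>
      + ((\<Sum>j\<in>UNIV. ?I (\<lambda>t. - a2 t * \<phi> t) (test_pderiv j (test_pderiv j \<psi>)))
        + (\<Sum>j\<in>UNIV. ?I (\<lambda>t. - (1 / \<i>) * a1 j t * \<phi> t) (test_pderiv j \<psi>))
        + ?I (\<lambda>t. a0 t * \<phi> t) \<psi>))"
    unfolding evolution_op_def weak_Dt_def regular_distr_def dist_integral_def by simp
  have I0: "(\<lambda>\<psi>. ?I h \<psi>) \<in> distributions" if "continuous_on {0..T} h" for h
    by (rule C_sobolev_integral_distribution[OF T u that])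
  have I1: "(\<lambda>\<psi>. ?I h (test_pderiv j \<psi>)) \<in> distributions" if "continuous_on {0..T} h" for h j
    using distributions_pderiv[OF I0[OF that]] .
  have I2: "(\<lambda>\<psi>. ?I h (test_pderiv j (test_pderiv j \<psi>))) \<in> distributions"
    if "continuous_on {0..T} h" for h j
    using distributions_pderiv[OF I1[OF that]] .
  have c: "continuous_on {0..T} (\<lambda>t. - ((1 / \<i>) * vector_derivative \<phi> (at t)))"
    "continuous_on {0..T} (\<lambda>t. - a2 t * \<phi> t)" "continuous_on {0..T} (\<lambda>t. a0 t * \<phi> t)"
    "\<And>j. continuous_on {0..T} (\<lambda>t. - (1 / \<i>) * a1 j t * \<phi> t)"
    by (intro continuous_intros cont a)+
  show ?thesis
    unfolding eq
    by (intro distributions_add distributions_sum finite_class.finite_UNIV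
        I0[OF c(1)] I0[OF c(3)] I1[OF c(4)] I2[OF c(2)])
qed

section \<open>Well-posedness\<close>

lemma continuous_on_symbol:
  assumes "continuous_on {0..T} a2" "\<And>j. continuous_on {0..T} (a1 j)" "continuous_on {0..T} a0"
  shows "continuous_on {0..T} (symbol a2 a1 a0 \<xi>)"
  unfolding symbol_def[abs_def] by (intro continuous_intros assms)

text \<open>The parabolicity \<open>Im a\<^sub>2 < 0\<close> absorbs the first-order terms by completing the square.\<close>

lemma Im_symbol_bounded_above:
  fixes a1 :: "'n::finite \<Rightarrow> real \<Rightarrow> complex"
  assumes T: "T > 0"
    and a: "continuous_on {0..T} a2" "\<And>j. continuous_on {0..T} (a1 j)" "continuous_on {0..T} a0"
    and neg: "\<And>t. t \<in> {0..T} \<Longrightarrow> Im (a2 t) < 0"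
  shows "\<exists>K\<ge>0. \<forall>\<xi>. \<forall>t\<in>{0..T}. Im (symbol a2 a1 a0 \<xi> t) \<le> K"
proof -
  have bound: "\<exists>B\<ge>0. \<forall>t\<in>{0..T}. norm (h t) \<le> B" if "continuous_on {0..T} h" for h :: "real \<Rightarrow> complex"
  proof -
    have "compact (h ` {0..T})" using that by (intro compact_continuous_image) auto
    then obtain B where "\<And>t. t \<in> {0..T} \<Longrightarrow> norm (h t) \<le> B"
      by (meson compact_imp_bounded bounded_iff imageI)
    then show ?thesis by (intro exI[of _ "max 0 B"]) (auto simp: le_max_iff_disj)
  qed
  \<comment> \<open>The maximum over the compact interval turns pointwise negativity into the
    uniform bound \<open>Im (a2 t) \<le> - c\<close>.\<close>
  obtain t0 where t0: "t0 \<in> {0..T}" "\<And>t. t \<in> {0..T} \<Longrightarrow> Im (a2 t) \<le> Im (a2 t0)"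
  proof -
    have "continuous_on {0..T} (\<lambda>t. Im (a2 t))" by (intro continuous_intros a)
    then show ?thesis
      using continuous_attains_sup[of "{0..T}" "\<lambda>t. Im (a2 t)"] T that by fastforce
  qed
  define c where "c = - Im (a2 t0)"
  have c: "c > 0" using neg[OF t0(1)] by (simp add: c_def)
  obtain A1 where A1: "\<And>j. A1 j \<ge> 0" "\<And>j t. t \<in> {0..T} \<Longrightarrow> norm (a1 j t) \<le> A1 j"
    using bound[OF a(2)] by metis
  obtain A0 where A0: "A0 \<ge> 0" "\<And>t. t \<in> {0..T} \<Longrightarrow> norm (a0 t) \<le> A0"
    using bound[OF a(3)] by blast
  \<comment> \<open>The maximum of \<open>- c * x^2 + A1 j * x\<close> over real \<open>x\<close> is
    \<open>(A1 j)^2 / (4 * c)\<close>; the coordinates are estimated one by one.\<close>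
  define K where "K = (\<Sum>j\<in>UNIV. (A1 j)\<^sup>2 / (4 * c)) + A0"
  have "K \<ge> 0" unfolding K_def using c A0 by (intro add_nonneg_nonneg sum_nonneg) auto
  moreover have "Im (symbol a2 a1 a0 \<xi> t) \<le> K" if t: "t \<in> {0..T}" for \<xi> :: "int ^ 'n" and t
  proof -
    let ?x = "\<lambda>j. real_of_int (\<xi> $ j)"
    have "Im (a2 t * (\<Sum>j\<in>UNIV. (of_int (\<xi> $ j))\<^sup>2)) = (\<Sum>j\<in>UNIV. Im (a2 t) * (?x j)\<^sup>2)"
      by (simp add: sum_distrib_left power2_eq_square)
    moreover have "Im (\<Sum>j\<in>UNIV. a1 j t * of_int (\<xi> $ j)) = (\<Sum>j\<in>UNIV. Im (a1 j t) * ?x j)"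
      by simp
    ultimately have "Im (symbol a2 a1 a0 \<xi> t)
        = (\<Sum>j\<in>UNIV. Im (a2 t) * (?x j)\<^sup>2 + Im (a1 j t) * ?x j) + Im (a0 t)"
      by (simp add: symbol_def sum.distrib)
    also have "\<dots> \<le> K"
      unfolding K_def
    proof (intro add_mono sum_mono)
      show "Im (a0 t) \<le> A0" using A0(2)[OF t] abs_Im_le_cmod[of "a0 t"] by linarith
      fix j
      have "Im (a2 t) * (?x j)\<^sup>2 \<le> - c * (?x j)\<^sup>2"
        using t0(2)[OF t] by (intro mult_right_mono) (auto simp: c_def)
      moreover have "Im (a1 j t) * ?x j \<le> A1 j * \<bar>?x j\<bar>"
      proof -
        have "\<bar>Im (a1 j t)\<bar> \<le> A1 j" using A1(2)[OF t, of j] abs_Im_le_cmod[of "a1 j t"] by linarith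
        then have "\<bar>Im (a1 j t)\<bar> * \<bar>?x j\<bar> \<le> A1 j * \<bar>?x j\<bar>" by (intro mult_right_mono) auto
        then show ?thesis using abs_ge_self[of "Im (a1 j t) * ?x j"] by (simp add: abs_mult)
      qed
      moreover have "0 \<le> (2 * c * \<bar>?x j\<bar> - A1 j)\<^sup>2 / (4 * c)" using c by simp
      then have "A1 j * \<bar>?x j\<bar> \<le> c * (?x j)\<^sup>2 + (A1 j)\<^sup>2 / (4 * c)"
        using c by (simp add: power2_diff field_simps power2_eq_square)
      ultimately show "Im (a2 t) * (?x j)\<^sup>2 + Im (a1 j t) * ?x j \<le> (A1 j)\<^sup>2 / (4 * c)"
        by linarith
    qed
    finally show ?thesis .
  qed
  ultimately show ?thesis by blast
qed

text \<open>A finite sum commutes with the time integral, and at each time it is at most the squared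
  Sobolev norm, hence at most \<open>B\<close>. All partial sums are thus bounded by the integral of
  \<open>B\<close>.\<close>

lemma C_sobolev_coeff_integral_summable:
  assumes T: "T > 0" and f: "f \<in> C_sobolev T r"
  shows "(\<lambda>\<xi>. bracket \<xi> powr (2 * r) * integral {0..T} (\<lambda>s. (norm (fourier_coeff (f s) \<xi>))\<^sup>2))
    summable_on UNIV"
proof -
  obtain B where B: "\<And>t. t \<in> {0..T} \<Longrightarrow> (sobolev_norm r (f t))\<^sup>2 \<le> B"
    using C_sobolev_bounded[OF f] by blast
  have cont: "continuous_on {0..T} (\<lambda>s. fourier_coeff (f s) \<xi>)" for \<xi>
    unfolding fourier_coeff_def by (rule C_sobolev_apply_continuous[OF f])
  have eq: "bracket \<xi> powr (2 * r) * integral {0..T} (\<lambda>s. (norm (fourier_coeff (f s) \<xi>))\<^sup>2)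
      = integral {0..T} (\<lambda>s. sobolev_term r (f s) \<xi>)" for \<xi>
    by (simp add: sobolev_term_bracket mult.commute)
  have int: "(\<lambda>s. sobolev_term r (f s) \<xi>) integrable_on {0..T}" for \<xi>
    unfolding sobolev_term_bracket by (intro integrable_continuous_real continuous_intros cont) auto
  show ?thesis
    unfolding eq
  proof (rule nonneg_bdd_above_summable_on)
    show "0 \<le> integral {0..T} (\<lambda>s. sobolev_term r (f s) \<xi>)" for \<xi>
      by (intro integral_nonneg int sobolev_term_nonneg)
    show "bdd_above (sum (\<lambda>\<xi>. integral {0..T} (\<lambda>s. sobolev_term r (f s) \<xi>)) ` {F. F \<subseteq> UNIV \<and> finite F})"
    proof (rule bdd_aboveI2)
      fix F :: "(int ^ 'a) set" assume "F \<in> {F. F \<subseteq> UNIV \<and> finite F}"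
      then have F: "finite F" by simp
      have "(\<Sum>\<xi>\<in>F. integral {0..T} (\<lambda>s. sobolev_term r (f s) \<xi>))
          = integral {0..T} (\<lambda>s. \<Sum>\<xi>\<in>F. sobolev_term r (f s) \<xi>)"
        by (rule integral_sum[symmetric]) (use F int in auto)
      also have "\<dots> \<le> integral {0..T} (\<lambda>s. B)"
      proof (rule integral_le)
        show "(\<lambda>s. \<Sum>\<xi>\<in>F. sobolev_term r (f s) \<xi>) integrable_on {0..T}"
          by (intro integrable_sum F int)
        fix s assume s: "s \<in> {0..T}"
        have "(\<Sum>\<xi>\<in>F. sobolev_term r (f s) \<xi>) \<le> (\<Sum>\<^sub>\<infinity>\<xi>. sobolev_term r (f s) \<xi>)"
          using C_sobolevD(1)[OF f s] F
          by (intro finite_sum_le_infsum) (auto simp: sobolev_def sobolev_term_nonneg)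
        also have "\<dots> \<le> B" using B[OF s] by (simp add: sobolev_norm_power2)
        finally show "(\<Sum>\<xi>\<in>F. sobolev_term r (f s) \<xi>) \<le> B" .
      qed (auto intro: integrable_const_ivl)
      finally show "(\<Sum>\<xi>\<in>F. integral {0..T} (\<lambda>s. sobolev_term r (f s) \<xi>)) \<le> integral {0..T} (\<lambda>s. B)" .
    qed
  qed
qed

text \<open>The majorant \<open>b\<close> does not depend on time. It gives membership in
  \<open>sobolev r\<close> at each time, and it upgrades continuity of the single coefficients to
  continuity in norm by dominated convergence.\<close>

lemma synthesis_in_C_sobolev:
  fixes c :: "real \<Rightarrow> int ^ 'n::finite \<Rightarrow> complex"
  assumes b: "b summable_on UNIV"
    and le: "\<And>t \<xi>. t \<in> {0..T} \<Longrightarrow> (norm (c t \<xi>))\<^sup>2 * bracket \<xi> powr (2 * r) \<le> b \<xi>"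
    and cont: "\<And>\<xi>. continuous_on {0..T} (\<lambda>t. c t \<xi>)"
  shows "(\<lambda>t. synthesis (c t)) \<in> C_sobolev T r"
proof -
  have "synthesis (c t) \<in> sobolev r" if "t \<in> {0..T}" for t
    by (intro synthesis_in_sobolev summable_on_comparison_test[OF b] le that) simp
  moreover have "((\<lambda>s. sobolev_norm r (\<lambda>\<psi>. synthesis (c s) \<psi> - synthesis (c t) \<psi>)) \<longlongrightarrow> 0)
      (at t within {0..T})" if t: "t \<in> {0..T}" for t
  proof -
    let ?d = "\<lambda>s. sobolev_term r (\<lambda>\<psi>. synthesis (c s) \<psi> - synthesis (c t) \<psi>)"
    have d: "?d s \<xi> = (norm (c s \<xi> - c t \<xi>))\<^sup>2 * bracket \<xi> powr (2 * r)" for s \<xi>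
      using fourier_coeff_synthesis[of "c s" \<xi>] fourier_coeff_synthesis[of "c t" \<xi>]
      by (simp add: sobolev_term_bracket fourier_coeff_def)
    have "((\<lambda>s. \<Sum>\<^sub>\<infinity>\<xi>. ?d s \<xi>) \<longlongrightarrow> 0) (at t within {0..T})"
    proof (rule infsum_dominated_tendsto_0)
      \<comment> \<open>The squared norm of a difference costs a factor \<open>2\<close> for each of
        the two times, and each contribution is at most \<open>b \<xi>\<close>.\<close>
      show "(\<lambda>\<xi>. 4 * b \<xi>) summable_on UNIV" by (intro summable_on_cmult_right b)
      have "?d s \<xi> \<le> 4 * b \<xi>" if s: "s \<in> {0..T}" for s \<xi>
        using mult_right_mono[OF norm_diff_squared_le[of "c s \<xi>" "c t \<xi>"], of "bracket \<xi> powr (2 * r)"]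
          le[OF s, of \<xi>] le[OF t, of \<xi>] by (simp add: d distrib_right)
      then show "\<forall>\<^sub>F s in at t within {0..T}. \<forall>\<xi>. 0 \<le> ?d s \<xi> \<and> ?d s \<xi> \<le> 4 * b \<xi>"
        by (simp add: eventually_at_filter sobolev_term_nonneg)
      show "((\<lambda>s. ?d s \<xi>) \<longlongrightarrow> 0) (at t within {0..T})" for \<xi>
      proof -
        have "((\<lambda>s. c s \<xi>) \<longlongrightarrow> c t \<xi>) (at t within {0..T})"
          using cont t by (simp add: continuous_on_def)
        then have "((\<lambda>s. (norm (c s \<xi> - c t \<xi>))\<^sup>2 * bracket \<xi> powr (2 * r)) \<longlongrightarrow>
            (norm (c t \<xi> - c t \<xi>))\<^sup>2 * bracket \<xi> powr (2 * r)) (at t within {0..T})"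
          by (intro tendsto_mult tendsto_power tendsto_norm tendsto_diff tendsto_const)
        then show ?thesis by (simp add: d)
      qed
    qed
    from tendsto_real_sqrt[OF this] show ?thesis by (simp add: sobolev_norm_def)
  qed
  ultimately show ?thesis by (simp add: C_sobolev_def)
qed

theorem theorem6p2:
  fixes T :: real
    and a2 a0 :: "real \<Rightarrow> complex"
    and a1 :: "'n::finite \<Rightarrow> real \<Rightarrow> complex"
  assumes "T > 0"
    and "continuous_on {0..T} a2"
    and "\<And>j. continuous_on {0..T} (a1 j)"
    and "continuous_on {0..T} a0"
    and "\<And>t. t \<in> {0..T} \<Longrightarrow> Im (a2 t) < 0"
  shows "well_posed_sobolev T a2 a1 a0"
  unfolding well_posed_sobolev_def
proof (intro allI ballI)
  fix r :: real and f :: "real \<Rightarrow> 'n torus_functional" and g :: "'n torus_functional"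
  assume f: "f \<in> C_sobolev T r" and g: "g \<in> sobolev r"
  note T = assms(1) and a = assms(2-4)
  let ?p = "symbol a2 a1 a0"
  note p = continuous_on_symbol[OF a]
  have "\<exists>K\<ge>0. \<forall>\<xi>. \<forall>t\<in>{0..T}. Im (?p \<xi> t) \<le> K"
    by (rule Im_symbol_bounded_above) (fact assms)+
  then obtain K where K: "K \<ge> 0" "\<forall>\<xi>. \<forall>t\<in>{0..T}. Im (?p \<xi> t) \<le> K"
    by (elim exE conjE)
  have coeff_cont: "continuous_on {0..T} (\<lambda>s. fourier_coeff (v s) \<xi>)" if "v \<in> C_sobolev T r" for v \<xi>
    unfolding fourier_coeff_def by (rule C_sobolev_apply_continuous[OF that])
  note fc = coeff_cont[OF f]
  define c where "c t \<xi> = ode_solution (?p \<xi>) (fourier_coeff g \<xi>) (\<lambda>s. fourier_coeff (f s) \<xi>) t" for t \<xi>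
  define u where "u t = synthesis (c t)" for t
  have uc: "fourier_coeff (u t) \<xi> = c t \<xi>" for t \<xi>
    by (simp add: u_def fourier_coeff_synthesis)
  define M where "M = exp (K * T)"
  \<comment> \<open>This is \<open>M^2 * (2 * ?G^2 + 2 * T * ?F2)\<close> times the weight: the
    squared bound of \<open>norm_ode_solution_le\<close> after splitting the square and applying
    Cauchy-Schwarz in time.\<close>
  define b where "b \<xi> = 2 * M\<^sup>2 * sobolev_term r g \<xi>
      + 2 * M\<^sup>2 * T * (bracket \<xi> powr (2 * r) * integral {0..T} (\<lambda>s. (norm (fourier_coeff (f s) \<xi>))\<^sup>2))" for \<xi>
  have b: "b summable_on UNIV"
    unfolding b_def[abs_def]
    using g by (intro summable_on_add summable_on_cmult_right C_sobolev_coeff_integral_summable T f)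
      (simp add: sobolev_def)
  have le: "(norm (c t \<xi>))\<^sup>2 * bracket \<xi> powr (2 * r) \<le> b \<xi>" if t: "t \<in> {0..T}" for t \<xi>
  proof -
    let ?G = "norm (fourier_coeff g \<xi>)" and ?F = "integral {0..T} (\<lambda>s. norm (fourier_coeff (f s) \<xi>))"
      and ?F2 = "integral {0..T} (\<lambda>s. (norm (fourier_coeff (f s) \<xi>))\<^sup>2)"
    have "norm (c t \<xi>) \<le> M * (?G + ?F)"
      unfolding c_def M_def using K by (intro norm_ode_solution_le[OF p fc t]) auto
    then have "(norm (c t \<xi>))\<^sup>2 \<le> (M * (?G + ?F))\<^sup>2" by (intro power_mono) auto
    also have "\<dots> = M\<^sup>2 * (?G + ?F)\<^sup>2" by (simp add: power_mult_distrib)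
    also have "\<dots> \<le> M\<^sup>2 * (2 * ?G\<^sup>2 + 2 * (T * ?F2))"
    proof (rule mult_left_mono)
      have "(?G + ?F)\<^sup>2 \<le> 2 * ?G\<^sup>2 + 2 * ?F\<^sup>2"
        using zero_le_power2[of "?G - ?F"] by (simp add: power2_sum power2_diff)
      then show "(?G + ?F)\<^sup>2 \<le> 2 * ?G\<^sup>2 + 2 * (T * ?F2)"
        using integral_norm_squared_le[OF T fc, of \<xi>] by linarith
    qed simp
    finally have "(norm (c t \<xi>))\<^sup>2 * bracket \<xi> powr (2 * r)
        \<le> (M\<^sup>2 * (2 * ?G\<^sup>2 + 2 * (T * ?F2))) * bracket \<xi> powr (2 * r)"
      by (rule mult_right_mono) simp
    also have "\<dots> = b \<xi>" by (simp add: b_def sobolev_term_bracket algebra_simps)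
    finally show ?thesis .
  qed
  have u: "u \<in> C_sobolev T r"
    unfolding u_def[abs_def]
  proof (rule synthesis_in_C_sobolev[OF b le])
    show "continuous_on {0..T} (\<lambda>t. c t \<xi>)" for \<xi>
      unfolding c_def using continuous_on_ode_solution[OF p fc] .
  qed
  have op_wave: "evolution_op T a2 a1 a0 v \<phi> (wave (- \<xi>))
    = integral {0..T} (\<lambda>t. fourier_coeff (v t) \<xi> * (- ((1 / \<i>) * vector_derivative \<phi> (at t))))
      + integral {0..T} (\<lambda>t. ?p \<xi> t * fourier_coeff (v t) \<xi> * \<phi> t)"
    if "v \<in> C_sobolev T r" for v \<phi> \<xi>
    by (rule evolution_op_wave) (rule C_sobolevD(2)[OF that])
  have f_dist: "regular_distr T f \<phi> \<in> distributions" if "\<phi> \<in> time_test T" for \<phi>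
    unfolding regular_distr_def dist_integral_def
    by (rule C_sobolev_integral_distribution[OF T f time_test_deriv(2)[OF that]])
  have f_wave: "regular_distr T f \<phi> (wave (- \<xi>)) = integral {0..T} (\<lambda>t. fourier_coeff (f t) \<xi> * \<phi> t)"
    for \<phi> \<xi>
    by (simp add: regular_distr_def dist_integral_def fourier_coeff_def)
  have "evolution_op T a2 a1 a0 u \<phi> = regular_distr T f \<phi>" if \<phi>: "\<phi> \<in> time_test T" for \<phi>
  proof (rule distributions_eqI)
    show "evolution_op T a2 a1 a0 u \<phi> \<in> distributions"
      by (rule evolution_op_distribution[OF T u \<phi> a])
    show "regular_distr T f \<phi> \<in> distributions" by (rule f_dist[OF \<phi>])
    fix \<xi> :: "int ^ 'n"
    \<comment> \<open>The formulas are stated at \<open>wave (- \<xi>)\<close>, so the frequency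
      enters with a double minus.\<close>
    have "evolution_op T a2 a1 a0 u \<phi> (wave (- (- \<xi>))) = regular_distr T f \<phi> (wave (- (- \<xi>)))"
      unfolding op_wave[OF u] f_wave uc c_def
      by (rule ode_solution_weak[OF T p fc \<phi>])
    then show "evolution_op T a2 a1 a0 u \<phi> (wave \<xi>) = regular_distr T f \<phi> (wave \<xi>)" by simp
  qed
  moreover have "u 0 = g"
  proof -
    have "c 0 = fourier_coeff g" by (simp add: fun_eq_iff c_def)
    then show ?thesis using g by (simp add: u_def synthesis_fourier_coeff sobolev_def)
  qed
  ultimately have sol: "solves_cauchy T a2 a1 a0 f g u"
    unfolding solves_cauchy_def using u by blast
  have "v t = u t" if v: "v \<in> C_sobolev T r" "solves_cauchy T a2 a1 a0 f g v" and t: "t \<in> {0..T}" for v t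
  proof (rule distributions_eqI)
    show "v t \<in> distributions" "u t \<in> distributions"
      using C_sobolevD(2)[OF v(1) t] C_sobolevD(2)[OF u t] .
    fix \<xi>
    \<comment> \<open>Both solutions have the same tested right-hand side and the same initial
      value, so subtracting removes \<open>f\<close> and \<open>g\<close> and leaves the homogeneous
      scalar problem.\<close>
    let ?y = "\<lambda>t. fourier_coeff (v t) (- \<xi>) - fourier_coeff (u t) (- \<xi>)"
    have "?y t = 0"
    proof (rule weak_ode_unique[OF T _ _ p _ t])
      show "continuous_on {0..T} ?y" by (intro continuous_intros coeff_cont v u)
      show "?y 0 = 0" using v(2) sol by (simp add: solves_cauchy_def)
      fix \<phi> assume \<phi>: "\<phi> \<in> time_test T"
      let ?D = "\<lambda>t. - ((1 / \<i>) * vector_derivative \<phi> (at t))"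
      note cont = time_test_deriv(2,3)[OF \<phi>] coeff_cont[OF v(1)] coeff_cont[OF u] p
      have "evolution_op T a2 a1 a0 v \<phi> (wave (- (- \<xi>))) = evolution_op T a2 a1 a0 u \<phi> (wave (- (- \<xi>)))"
        using v(2) sol \<phi> by (simp add: solves_cauchy_def)
      note eq = this[unfolded op_wave[OF u] op_wave[OF v(1)]]
      have split1: "integral {0..T} (\<lambda>t. ?y t * ?D t)
          = integral {0..T} (\<lambda>t. fourier_coeff (v t) (- \<xi>) * ?D t)
            - integral {0..T} (\<lambda>t. fourier_coeff (u t) (- \<xi>) * ?D t)"
        unfolding left_diff_distrib
        by (intro integral_diff integrable_continuous_real continuous_intros cont)
      have split2: "integral {0..T} (\<lambda>t. ?p (- \<xi>) t * ?y t * \<phi> t)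
          = integral {0..T} (\<lambda>t. ?p (- \<xi>) t * fourier_coeff (v t) (- \<xi>) * \<phi> t)
            - integral {0..T} (\<lambda>t. ?p (- \<xi>) t * fourier_coeff (u t) (- \<xi>) * \<phi> t)"
        unfolding right_diff_distrib left_diff_distrib
        by (intro integral_diff integrable_continuous_real continuous_intros cont)
      have "A + C = B + D \<Longrightarrow> (A - B) + (C - D) = 0" for A B C D :: complex
        by (simp add: algebra_simps)
      from this[OF eq] show "integral {0..T} (\<lambda>t. ?y t * ?D t)
          + integral {0..T} (\<lambda>t. ?p (- \<xi>) t * ?y t * \<phi> t) = 0"
        unfolding split1 split2 .
    qed
    then show "v t (wave \<xi>) = u t (wave \<xi>)" by (simp add: fourier_coeff_def)
  qed
  with u sol show "\<exists>u\<in>C_sobolev T r. solves_cauchy T a2 a1 a0 f g u \<and>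
      (\<forall>v\<in>C_sobolev T r. solves_cauchy T a2 a1 a0 f g v \<longrightarrow> (\<forall>t\<in>{0..T}. v t = u t))"
    by blast
qed

end
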